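(* Let $\nu(u,v)$, $\lambda(u,v)$, $\mu(u,v)$, with $\mu\neq0$ and $4\nu^2+4\lambda^2-1\neq0$, be smooth functions defined in a domain $\mathcal D\subset\mathbb R^2$, and let $$\phi_1=-\frac{\mu(\lambda^2+\nu^2-\nu)_v+(2(\lambda^2+\nu^2)+\nu-1)\mu_v}{2\mu(4\nu^2+4\lambda^2-1)},\qquad \phi_2=\frac{2\mu(\lambda_u\nu-\lambda\nu_u)+\lambda\mu_u-\lambda_u\mu}{2\mu(4\nu^2+4\lambda^2-1)},$$ $$\phi_3=\frac{2\mu(\lambda\nu_v-\lambda_v\nu)+\lambda\mu_v-\lambda_v\mu}{2\mu(4\nu^2+4\lambda^2-1)},\qquad \phi_4=-\frac{\mu(\lambda^2+\nu^2+\nu)_u+(2(\lambda^2+\nu^2)-\nu-1)\mu_u}{2\mu(4\nu^2+4\lambda^2-1)}.$$ Let $(u_0,v_0)\in\mathcal D$, let $c_1,c_2$ be constants, $c=e^{c_2-c_1}$, and $$g_1(u)=\exp\Big(\int_{u_0}^u(c\,\phi_3+\phi_4)(t,v_0)\,dt-c_1\Big),\qquad g_2(v)=\exp\Big(\int_{v_0}^v\big(\phi_1+\tfrac1c\phi_2\big)(u_0,s)\,ds-c_2\Big).$$ Let $\Phi(u,v),\Psi(u,v)$ be a solution to the Cauchy problem $$\Phi_v=\phi_1\Phi+\phi_2\Psi,\qquad \Psi_u=\phi_3\Phi+\phi_4\Psi,\qquad \Phi(u,v_0)=g_1(u),\qquad \Psi(u_0,v)=g_2(v),$$ and let the following equations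 also hold: $$2\lambda\mu=-\frac1{\Phi\Psi}\left(\Big(\frac{\Phi_v}{\Psi}\Big)_v+\Big(\frac{\Psi_u}{\Phi}\Big)_u\right),\qquad 2\nu\mu=\frac{2}{\Phi\Psi}\left(\ln\frac{|\Psi|}{|\Phi|}\right)_{uv}.$$ Then there exists a unique (up to a position in $\mathbb R^4_1$) marginally trapped surface of general type parametrized by canonical principal parameters $(u,v)$ with geometric functions $\nu(u,v)$, $\lambda(u,v)$, and $\mu(u,v)$.
   Context: $\mathbb R^4_1$ is $\mathbb R^4$ with the metric $\langle\cdot,\cdot\rangle=dx_1^2+dx_2^2+dx_3^2-dx_4^2$; "up to a position" means up to a motion of $\mathbb R^4_1$. Subscripts $u,v$ denote partial derivatives. A surface $M^2\subset\mathbb R^4_1$, $z=z(u,v)$, is spacelike if the induced metric is Riemannian; $\sigma$ denotes its second fundamental tensor and $H=\frac12\operatorname{tr}\sigma$ its mean curvature vector. A spacelike surface is marginally trapped if $H\neq0$ and $\langle H,H\rangle=0$ at each point. Principal parameters and geometric functions. Parameters $(u,v)$ on a marginally trapped surface are principal if $F=\langle z_u,z_v\rangle=0$ and, with $E=\langle z_u,z_u\rangle$, $G=\langle z_v,z_v\rangle$, $x=z_u/\sqrt E$, $y=z_v/\sqrt G$, $n_1=H$, and $n_2$ the normal vector field with $\langle n_2,n_2\rangle=0$, $\langle n_1,n_2\rangle=-1$, one has $$\sigma(x,x)=(1+\nu)n_1,\qquad \sigma(x,y)=\lambda n_1+\mu n_2,\qquad \sigma(y,y)=(1-\nu)n_1$$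 for some functions $\nu,\lambda,\mu$, with $\mu\neq0$ at each point. These $\nu,\lambda,\mu$ are the geometric functions referred to in the claim. The Gauss curvature and the curvature of the normal connection are $K=2\lambda\mu$ and $\varkappa=-2\mu\nu$. The surface is of general type if $K^2+\varkappa^2\neq\mu^2$, equivalently $4\nu^2+4\lambda^2-1\neq0$. Canonical parameters. Let $(u,v)$ be principal parameters on a marginally trapped surface of general type, and let $\phi_1,\dots,\phi_4$ be computed from its geometric functions $\nu,\lambda,\mu$ by the formulas in the claim. With the point $(u_0,v_0)$ and the constants $c_1,c_2$ as in the claim, put $$\varphi=\sqrt E\,\exp\Big(-\int_{v_0}^v\big(\phi_1+\phi_2\tfrac{\sqrt G}{\sqrt E}\big)(u,s)\,ds-\int_{u_0}^u\big(\phi_3\tfrac{\sqrt E}{\sqrt G}+\phi_4\big)(t,v_0)\,dt+c_1\Big),$$ $$\psi=\sqrt G\,\exp\Big(-\int_{u_0}^u\big(\phi_3\tfrac{\sqrt E}{\sqrt G}+\phi_4\big)(t,v)\,dt-\int_{v_0}^v\big(\phi_1+\phi_2\tfrac{\sqrt G}{\sqrt E}\big)(u_0,s)\,ds+c_2\Big);$$ $\varphi$ depends only on $u$ and $\psi$ only on $v$. The parameters $(u,v)$ are called canonical principal parameters if $\varphi$ and $\psi$ are equal to $1$. *)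

theory Defs
  imports "HOL-Analysis.Analysis"
begin

section \<open>Partial derivatives and smoothness in the parameter plane\<close>

definition pdu :: "(real \<times> real \<Rightarrow> 'a::real_normed_vector) \<Rightarrow> real \<times> real \<Rightarrow> 'a" where
  "pdu f p = vector_derivative (\<lambda>t. f (t, snd p)) (at (fst p))"

definition pdv :: "(real \<times> real \<Rightarrow> 'a::real_normed_vector) \<Rightarrow> real \<times> real \<Rightarrow> 'a" where
  "pdv f p = vector_derivative (\<lambda>t. f (fst p, t)) (at (snd p))"

text \<open>Used for open \<open>D\<close> only; there \<open>Ck_on k D f\<close> says that \<open>f\<close> is of class $C^k$ on \<open>D\<close>.\<close>

primrec Ck_on :: "nat \<Rightarrow> (real \<times> real) set \<Rightarrow> (real \<times> real \<Rightarrow> 'a::real_normed_vector) \<Rightarrow> bool" where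
  "Ck_on 0 D f \<longleftrightarrow> continuous_on D f"
| "Ck_on (Suc k) D f \<longleftrightarrow> f differentiable_on D \<and> Ck_on k D (pdu f) \<and> Ck_on k D (pdv f)"

definition smooth_on :: "(real \<times> real) set \<Rightarrow> (real \<times> real \<Rightarrow> 'a::real_normed_vector) \<Rightarrow> bool" where
  "smooth_on D f \<longleftrightarrow> (\<forall>k. Ck_on k D f)"


section \<open>Minkowski space\<close>

definition mink :: "real^4 \<Rightarrow> real^4 \<Rightarrow> real" where
  "mink x y = x$1 * y$1 + x$2 * y$2 + x$3 * y$3 - x$4 * y$4"

text \<open>All isometries count as motions, including those that reverse orientation or time:
  the geometric functions of a surface are invariant under all of them, so uniqueness up to
  position can only be meant with respect to the full group.\<close>

definition motion :: "(real^4 \<Rightarrow> real^4) \<Rightarrow> bool" where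
  "motion T \<longleftrightarrow> (\<exists>(A :: real^4^4) b. (\<forall>x y. mink (A *v x) (A *v y) = mink x y) \<and>
                                     (\<forall>x. T x = A *v x + b))"


section \<open>Parametrized surfaces\<close>

definition fE :: "(real \<times> real \<Rightarrow> real^4) \<Rightarrow> real \<times> real \<Rightarrow> real" where
  "fE z p = mink (pdu z p) (pdu z p)"

definition fF :: "(real \<times> real \<Rightarrow> real^4) \<Rightarrow> real \<times> real \<Rightarrow> real" where
  "fF z p = mink (pdu z p) (pdv z p)"

definition fG :: "(real \<times> real \<Rightarrow> real^4) \<Rightarrow> real \<times> real \<Rightarrow> real" where
  "fG z p = mink (pdv z p) (pdv z p)"

text \<open>The positivity condition makes \<open>z\<close> an immersion.\<close>

definition spacelike_surface :: "(real \<times> real) set \<Rightarrow> (real \<times> real \<Rightarrow> real^4) \<Rightarrow> bool" where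
  "spacelike_surface D z \<longleftrightarrow> open D \<and> smooth_on D z \<and>
     (\<forall>p\<in>D. \<forall>a b. (a, b) \<noteq> (0, 0) \<longrightarrow>
        mink (a *\<^sub>R pdu z p + b *\<^sub>R pdv z p) (a *\<^sub>R pdu z p + b *\<^sub>R pdv z p) > 0)"

definition tangent_part :: "(real \<times> real \<Rightarrow> real^4) \<Rightarrow> real \<times> real \<Rightarrow> real^4 \<Rightarrow> real^4" where
  "tangent_part z p w =
     ((fG z p * mink w (pdu z p) - fF z p * mink w (pdv z p)) / (fE z p * fG z p - (fF z p)\<^sup>2)) *\<^sub>R pdu z p +
     ((fE z p * mink w (pdv z p) - fF z p * mink w (pdu z p)) / (fE z p * fG z p - (fF z p)\<^sup>2)) *\<^sub>R pdv z p"

definition normal_part :: "(real \<times> real \<Rightarrow> real^4) \<Rightarrow> real \<times> real \<Rightarrow> real^4 \<Rightarrow> real^4" where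
  "normal_part z p w = w - tangent_part z p w"

definition normal_vector :: "(real \<times> real \<Rightarrow> real^4) \<Rightarrow> real \<times> real \<Rightarrow> real^4 \<Rightarrow> bool" where
  "normal_vector z p n \<longleftrightarrow> mink n (pdu z p) = 0 \<and> mink n (pdv z p) = 0"

text \<open>The second fundamental tensor; the tangent vector $a z_u + b z_v$ is represented by the
  pair \<open>(a, b)\<close>.\<close>

definition sigma :: "(real \<times> real \<Rightarrow> real^4) \<Rightarrow> real \<times> real \<Rightarrow> real \<times> real \<Rightarrow> real \<times> real \<Rightarrow> real^4" where
  "sigma z p X Y =
     (fst X * fst Y) *\<^sub>R normal_part z p (pdu (pdu z) p) +
     (fst X * snd Y + snd X * fst Y) *\<^sub>R normal_part z p (pdv (pdu z) p) +
     (snd X * snd Y) *\<^sub>R normal_part z p (pdv (pdv z) p)"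

text \<open>The trace of \<open>sigma\<close> is taken with respect to the induced metric with coefficients
  $E, F, G$.\<close>

definition mean_curv :: "(real \<times> real \<Rightarrow> real^4) \<Rightarrow> real \<times> real \<Rightarrow> real^4" where
  "mean_curv z p = (1 / 2) *\<^sub>R (1 / (fE z p * fG z p - (fF z p)\<^sup>2)) *\<^sub>R
     (fG z p *\<^sub>R sigma z p (1, 0) (1, 0) - (2 * fF z p) *\<^sub>R sigma z p (1, 0) (0, 1) +
      fE z p *\<^sub>R sigma z p (0, 1) (0, 1))"

definition marginally_trapped :: "(real \<times> real) set \<Rightarrow> (real \<times> real \<Rightarrow> real^4) \<Rightarrow> bool" where
  "marginally_trapped D z \<longleftrightarrow> spacelike_surface D z \<and>
     (\<forall>p\<in>D. mean_curv z p \<noteq> 0 \<and> mink (mean_curv z p) (mean_curv z p) = 0)"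

definition n2 :: "(real \<times> real \<Rightarrow> real^4) \<Rightarrow> real \<times> real \<Rightarrow> real^4" where
  "n2 z p = (THE n. normal_vector z p n \<and> mink n n = 0 \<and> mink (mean_curv z p) n = -1)"


subsection \<open>Gauss curvature and curvature of the normal connection\<close>

text \<open>The Levi-Civita connection of the induced metric and the normal connection, in the
  coordinate directions.\<close>

definition tan_conn_u :: "(real \<times> real \<Rightarrow> real^4) \<Rightarrow> (real \<times> real \<Rightarrow> real^4) \<Rightarrow> real \<times> real \<Rightarrow> real^4" where
  "tan_conn_u z X p = tangent_part z p (pdu X p)"

definition tan_conn_v :: "(real \<times> real \<Rightarrow> real^4) \<Rightarrow> (real \<times> real \<Rightarrow> real^4) \<Rightarrow> real \<times> real \<Rightarrow> real^4" where
  "tan_conn_v z X p = tangent_part z p (pdv X p)"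

definition nor_conn_u :: "(real \<times> real \<Rightarrow> real^4) \<Rightarrow> (real \<times> real \<Rightarrow> real^4) \<Rightarrow> real \<times> real \<Rightarrow> real^4" where
  "nor_conn_u z \<xi> p = normal_part z p (pdu \<xi> p)"

definition nor_conn_v :: "(real \<times> real \<Rightarrow> real^4) \<Rightarrow> (real \<times> real \<Rightarrow> real^4) \<Rightarrow> real \<times> real \<Rightarrow> real^4" where
  "nor_conn_v z \<xi> p = normal_part z p (pdv \<xi> p)"

definition gauss_curv :: "(real \<times> real \<Rightarrow> real^4) \<Rightarrow> real \<times> real \<Rightarrow> real" where
  "gauss_curv z p =
     mink (tan_conn_u z (tan_conn_v z (pdv z)) p - tan_conn_v z (tan_conn_u z (pdv z)) p) (pdu z p)
       / (fE z p * fG z p - (fF z p)\<^sup>2)"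

text \<open>The sign is the one for which this equals $-2\mu\nu$ in principal parameters.\<close>

definition normal_curv :: "(real \<times> real \<Rightarrow> real^4) \<Rightarrow> real \<times> real \<Rightarrow> real" where
  "normal_curv z p =
     mink (nor_conn_u z (nor_conn_v z (n2 z)) p - nor_conn_v z (nor_conn_u z (n2 z)) p) (mean_curv z p)
       / sqrt (fE z p * fG z p - (fF z p)\<^sup>2)"


section \<open>Principal parameters\<close>

text \<open>\<open>x\<close> and \<open>y\<close> are the coordinate pairs of $z_u/\sqrt E$ and $z_v/\sqrt G$.\<close>

definition principal_parameters ::
  "(real \<times> real) set \<Rightarrow> (real \<times> real \<Rightarrow> real^4) \<Rightarrow>
   (real \<times> real \<Rightarrow> real) \<Rightarrow> (real \<times> real \<Rightarrow> real) \<Rightarrow> (real \<times> real \<Rightarrow> real) \<Rightarrow> bool" where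
  "principal_parameters D z \<nu> lam \<mu> \<longleftrightarrow>
     (\<forall>p\<in>D. let x = (1 / sqrt (fE z p), 0); y = (0, 1 / sqrt (fG z p)); n1 = mean_curv z p in
        fF z p = 0 \<and> \<mu> p \<noteq> 0 \<and>
        sigma z p x x = (1 + \<nu> p) *\<^sub>R n1 \<and>
        sigma z p x y = lam p *\<^sub>R n1 + \<mu> p *\<^sub>R n2 z p \<and>
        sigma z p y y = (1 - \<nu> p) *\<^sub>R n1)"

definition general_type ::
  "(real \<times> real) set \<Rightarrow> (real \<times> real \<Rightarrow> real^4) \<Rightarrow> (real \<times> real \<Rightarrow> real) \<Rightarrow> bool" where
  "general_type D z \<mu> \<longleftrightarrow> (\<forall>p\<in>D. (gauss_curv z p)\<^sup>2 + (normal_curv z p)\<^sup>2 \<noteq> (\<mu> p)\<^sup>2)"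


section \<open>Canonical parameters\<close>

definition phi1 :: "(real \<times> real \<Rightarrow> real) \<Rightarrow> (real \<times> real \<Rightarrow> real) \<Rightarrow> (real \<times> real \<Rightarrow> real) \<Rightarrow> real \<times> real \<Rightarrow> real" where
  "phi1 \<nu> lam \<mu> p =
     - (\<mu> p * pdv (\<lambda>q. (lam q)\<^sup>2 + (\<nu> q)\<^sup>2 - \<nu> q) p + (2 * ((lam p)\<^sup>2 + (\<nu> p)\<^sup>2) + \<nu> p - 1) * pdv \<mu> p)
       / (2 * \<mu> p * (4 * (\<nu> p)\<^sup>2 + 4 * (lam p)\<^sup>2 - 1))"

definition phi2 :: "(real \<times> real \<Rightarrow> real) \<Rightarrow> (real \<times> real \<Rightarrow> real) \<Rightarrow> (real \<times> real \<Rightarrow> real) \<Rightarrow> real \<times> real \<Rightarrow> real" where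
  "phi2 \<nu> lam \<mu> p =
     (2 * \<mu> p * (pdu lam p * \<nu> p - lam p * pdu \<nu> p) + lam p * pdu \<mu> p - pdu lam p * \<mu> p)
       / (2 * \<mu> p * (4 * (\<nu> p)\<^sup>2 + 4 * (lam p)\<^sup>2 - 1))"

definition phi3 :: "(real \<times> real \<Rightarrow> real) \<Rightarrow> (real \<times> real \<Rightarrow> real) \<Rightarrow> (real \<times> real \<Rightarrow> real) \<Rightarrow> real \<times> real \<Rightarrow> real" where
  "phi3 \<nu> lam \<mu> p =
     (2 * \<mu> p * (lam p * pdv \<nu> p - pdv lam p * \<nu> p) + lam p * pdv \<mu> p - pdv lam p * \<mu> p)
       / (2 * \<mu> p * (4 * (\<nu> p)\<^sup>2 + 4 * (lam p)\<^sup>2 - 1))"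

definition phi4 :: "(real \<times> real \<Rightarrow> real) \<Rightarrow> (real \<times> real \<Rightarrow> real) \<Rightarrow> (real \<times> real \<Rightarrow> real) \<Rightarrow> real \<times> real \<Rightarrow> real" where
  "phi4 \<nu> lam \<mu> p =
     - (\<mu> p * pdu (\<lambda>q. (lam q)\<^sup>2 + (\<nu> q)\<^sup>2 + \<nu> q) p + (2 * ((lam p)\<^sup>2 + (\<nu> p)\<^sup>2) - \<nu> p - 1) * pdu \<mu> p)
       / (2 * \<mu> p * (4 * (\<nu> p)\<^sup>2 + 4 * (lam p)\<^sup>2 - 1))"

text \<open>The integrals defining canonical parameters run along axis-parallel broken lines from
  the base point \<open>(u0, v0)\<close> to \<open>(u, v)\<close>, via \<open>(u, v0)\<close> and via \<open>(u0, v)\<close>. They are meaningful at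
  all points of a domain exactly if these lines stay in the domain, which is equivalent to the
  rectangle condition below. It implies connectedness.\<close>

definition base_domain :: "real \<Rightarrow> real \<Rightarrow> (real \<times> real) set \<Rightarrow> bool" where
  "base_domain u0 v0 D \<longleftrightarrow> open D \<and> (u0, v0) \<in> D \<and>
     (\<forall>u v. (u, v) \<in> D \<longrightarrow> closed_segment u0 u \<times> closed_segment v0 v \<subseteq> D)"

definition canon_u ::
  "(real \<times> real \<Rightarrow> real^4) \<Rightarrow> (real \<times> real \<Rightarrow> real) \<Rightarrow> (real \<times> real \<Rightarrow> real) \<Rightarrow> (real \<times> real \<Rightarrow> real) \<Rightarrow>
   real \<Rightarrow> real \<Rightarrow> real \<Rightarrow> real \<times> real \<Rightarrow> real" where
  "canon_u z \<nu> lam \<mu> u0 v0 c1 p =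
     (let A = (\<lambda>q. phi1 \<nu> lam \<mu> q + phi2 \<nu> lam \<mu> q * (sqrt (fG z q) / sqrt (fE z q)));
          B = (\<lambda>q. phi3 \<nu> lam \<mu> q * (sqrt (fE z q) / sqrt (fG z q)) + phi4 \<nu> lam \<mu> q) in
      sqrt (fE z p) *
        exp (- (LBINT s=ereal v0..ereal (snd p). A (fst p, s))
             - (LBINT t=ereal u0..ereal (fst p). B (t, v0)) + c1))"

definition canon_v ::
  "(real \<times> real \<Rightarrow> real^4) \<Rightarrow> (real \<times> real \<Rightarrow> real) \<Rightarrow> (real \<times> real \<Rightarrow> real) \<Rightarrow> (real \<times> real \<Rightarrow> real) \<Rightarrow>
   real \<Rightarrow> real \<Rightarrow> real \<Rightarrow> real \<times> real \<Rightarrow> real" where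
  "canon_v z \<nu> lam \<mu> u0 v0 c2 p =
     (let A = (\<lambda>q. phi1 \<nu> lam \<mu> q + phi2 \<nu> lam \<mu> q * (sqrt (fG z q) / sqrt (fE z q)));
          B = (\<lambda>q. phi3 \<nu> lam \<mu> q * (sqrt (fE z q) / sqrt (fG z q)) + phi4 \<nu> lam \<mu> q) in
      sqrt (fG z p) *
        exp (- (LBINT t=ereal u0..ereal (fst p). B (t, snd p))
             - (LBINT s=ereal v0..ereal (snd p). A (u0, s)) + c2))"

definition canonical_parameters ::
  "(real \<times> real) set \<Rightarrow> (real \<times> real \<Rightarrow> real^4) \<Rightarrow>
   (real \<times> real \<Rightarrow> real) \<Rightarrow> (real \<times> real \<Rightarrow> real) \<Rightarrow> (real \<times> real \<Rightarrow> real) \<Rightarrow>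
   real \<Rightarrow> real \<Rightarrow> real \<Rightarrow> real \<Rightarrow> bool" where
  "canonical_parameters D z \<nu> lam \<mu> u0 v0 c1 c2 \<longleftrightarrow>
     principal_parameters D z \<nu> lam \<mu> \<and>
     (\<forall>p\<in>D. canon_u z \<nu> lam \<mu> u0 v0 c1 p = 1 \<and> canon_v z \<nu> lam \<mu> u0 v0 c2 p = 1)"

text \<open>Every point of an open set has a base domain around it inside that set.\<close>

lemma base_domain_exists:
  assumes "open D" and "(u0, v0) \<in> D"
  shows "\<exists>D0\<subseteq>D. base_domain u0 v0 D0"
proof -
  obtain A B where AB: "open A" "open B" "u0 \<in> A" "v0 \<in> B" "A \<times> B \<subseteq> D"
    using open_prod_elim[OF assms] by (metis mem_Sigma_iff)
  obtain a where a: "a > 0" "ball u0 a \<subseteq> A"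
    using AB openE by blast
  obtain b where b: "b > 0" "ball v0 b \<subseteq> B"
    using AB openE by blast
  have "base_domain u0 v0 (ball u0 a \<times> ball v0 b)"
    unfolding base_domain_def
  proof (intro conjI allI impI)
    fix u v assume "(u, v) \<in> ball u0 a \<times> ball v0 b"
    then have "closed_segment u0 u \<subseteq> ball u0 a" "closed_segment v0 v \<subseteq> ball v0 b"
      using a(1) b(1) closed_segment_subset[OF _ _ convex_ball]
      by (metis mem_Sigma_iff centre_in_ball)+
    then show "closed_segment u0 u \<times> closed_segment v0 v \<subseteq> ball u0 a \<times> ball v0 b"
      by blast
  qed (use a(1) b(1) in \<open>auto intro: open_Times\<close>)
  moreover have "ball u0 a \<times> ball v0 b \<subseteq> D"
    using a b AB by blast
  ultimately show ?thesis by blast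
qed

end

(* Put x = z_u/P, y = z_v/Q with P = sqrt E, Q = sqrt G. Together with the null normals H and n2 these
   form a frame whose derivatives are linear in the frame, with coefficients built from P, Q and the
   geometric functions; the equations for P and Q in the theorem are exactly the compatibility
   conditions of this total differential system. Existence: integrate the system together with z_u = P x,
   z_v = Q y; the solution frame keeps its Gram matrix because the coefficient matrices are skew with
   respect to it. Uniqueness: the canonical normalization turns sqrt E and sqrt G into a solution of the
   same characteristic (Goursat) problem as P and Q, so they agree with P and Q; two frames that solve the
   same linear system then differ by a constant Minkowski isometry. *)

theory Submission
  imports Defs
begin

text \<open>In the frame, the Codazzi equations split by null direction. Their
  \<open>m\<close>-components determine the normal connection coefficients \<open>k1\<close> and
  \<open>k2\<close>. After substitution, the \<open>n\<close>-components are two equations linear in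
  P_v and Q_u with determinant -4 (4 \<nu>^2 + 4 \<lambda>^2 - 1); the functions \<open>phi1\<close>
  to \<open>phi4\<close> are Cramer's rule for them, so general type means unique solvability. The
  remaining two equations of the theorem are those of Gauss and Ricci. The constant c is the value
  of sqrt E / sqrt G along both axes through the base point. The canonical normalization forces this
  ratio there, so the unknown quotients in its integrals become c and 1/c, and g_1, g_2 do not refer
  to the surface. For existence the same ratio has to be derived for P and Q. The analytic obstacle
  is differentiability in u of a solution built along lines u = const: the series solution is only
  continuous in the parameter, and the u-derivative comes from a Gronwall estimate fed by the
  compatibility condition. Every integration runs along axis-parallel lines from the base point,
  hence the rectangle condition on the domain.\<close>

section \<open>Calculus of partial derivatives as a relation\<close>

text \<open>\<open>pdu\<close> and \<open>pdv\<close> have a value even where no derivative exists.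
  The relation also records existence, and the free direction \<open>d\<close> lets each rule of
  calculus be proved once for both coordinates.\<close>

definition has_pd :: "real \<times> real \<Rightarrow> (real \<times> real \<Rightarrow> 'a::real_normed_vector) \<Rightarrow> 'a \<Rightarrow> real \<times> real \<Rightarrow> bool"
  where "has_pd d f f' p \<longleftrightarrow> ((\<lambda>t. f (p + t *\<^sub>R d)) has_vector_derivative f') (at 0)"

abbreviation (input) du :: "real \<times> real" where "du \<equiv> (1, 0)"
abbreviation (input) dv :: "real \<times> real" where "dv \<equiv> (0, 1)"

lemma has_vector_derivative_shift_0:
  fixes g :: "real \<Rightarrow> 'a::real_normed_vector"
  shows "((\<lambda>t. g (x + t)) has_vector_derivative f') (at 0) \<longleftrightarrow> (g has_vector_derivative f') (at x)"
proof
  assume "((\<lambda>t. g (x + t)) has_vector_derivative f') (at 0)"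
  then have "((\<lambda>t. g (x + t)) has_vector_derivative f') (at (x - x))" by simp
  moreover have "((\<lambda>s. s - x) has_vector_derivative 1) (at x)"
    by (auto intro!: derivative_eq_intros)
  ultimately have "((\<lambda>t. g (x + t)) \<circ> (\<lambda>s. s - x) has_vector_derivative 1 *\<^sub>R f') (at x)"
    using vector_diff_chain_at[of "\<lambda>s. s - x" 1 x "\<lambda>t. g (x + t)" f'] by blast
  then show "(g has_vector_derivative f') (at x)" by (simp add: o_def)
next
  assume "(g has_vector_derivative f') (at x)"
  then have "(g has_vector_derivative f') (at (x + 0))" by simp
  moreover have "((\<lambda>s. x + s) has_vector_derivative 1) (at 0)"
    by (auto intro!: derivative_eq_intros)
  ultimately have "(g \<circ> (\<lambda>s. x + s) has_vector_derivative 1 *\<^sub>R f') (at 0)"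
    using vector_diff_chain_at[of "\<lambda>s. x + s" 1 0 g f'] by blast
  then show "((\<lambda>t. g (x + t)) has_vector_derivative f') (at 0)" by (simp add: o_def)
qed

lemma has_pd_du_iff: "has_pd du f f' p \<longleftrightarrow> ((\<lambda>t. f (t, snd p)) has_vector_derivative f') (at (fst p))"
  using has_vector_derivative_shift_0[of "\<lambda>t. f (t, snd p)" "fst p" f']
  by (cases p) (simp add: has_pd_def)

lemma has_pd_dv_iff: "has_pd dv f f' p \<longleftrightarrow> ((\<lambda>t. f (fst p, t)) has_vector_derivative f') (at (snd p))"
  using has_vector_derivative_shift_0[of "\<lambda>t. f (fst p, t)" "snd p" f']
  by (cases p) (simp add: has_pd_def)

lemma pdu_eqI: "has_pd du f f' p \<Longrightarrow> pdu f p = f'"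
  by (simp add: has_pd_du_iff pdu_def vector_derivative_at)

lemma pdv_eqI: "has_pd dv f f' p \<Longrightarrow> pdv f p = f'"
  by (simp add: has_pd_dv_iff pdv_def vector_derivative_at)

lemma has_pd_unique: "has_pd d f f' p \<Longrightarrow> has_pd d f f'' p \<Longrightarrow> f' = f''"
  unfolding has_pd_def by (rule vector_derivative_unique_at)

lemma differentiable_imp_has_pd:
  assumes "f differentiable (at p)"
  shows "has_pd d f (frechet_derivative f (at p) d) p"
proof -
  let ?f' = "frechet_derivative f (at p)"
  have f': "(f has_derivative ?f') (at p)"
    using assms by (simp add: frechet_derivative_works)
  then have "(f has_derivative ?f') (at (p + 0 *\<^sub>R d))" by simp
  moreover have "((\<lambda>t. p + t *\<^sub>R d) has_derivative (\<lambda>t. t *\<^sub>R d)) (at 0)"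
    by (auto intro!: derivative_eq_intros)
  ultimately have "((\<lambda>t. f (p + t *\<^sub>R d)) has_derivative (\<lambda>t. ?f' (t *\<^sub>R d))) (at 0)"
    using has_derivative_compose[of "\<lambda>t. p + t *\<^sub>R d" "\<lambda>t. t *\<^sub>R d" 0 UNIV f ?f'] by simp
  moreover have "?f' (t *\<^sub>R d) = t *\<^sub>R ?f' d" for t
    using has_derivative_bounded_linear[OF f'] by (simp add: bounded_linear.linear linear_scale)
  ultimately show ?thesis by (simp add: has_pd_def has_vector_derivative_def)
qed

lemma differentiable_imp_has_pdu: "f differentiable (at p) \<Longrightarrow> has_pd du f (pdu f p) p"
  using differentiable_imp_has_pd pdu_eqI by metis

lemma differentiable_imp_has_pdv: "f differentiable (at p) \<Longrightarrow> has_pd dv f (pdv f p) p"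
  using differentiable_imp_has_pd pdv_eqI by metis

named_theorems pd_intros

lemma has_pd_const [pd_intros]: "has_pd d (\<lambda>q. c) 0 p"
  by (simp add: has_pd_def)

lemma has_pd_add [pd_intros]:
  "has_pd d f f' p \<Longrightarrow> has_pd d g g' p \<Longrightarrow> has_pd d (\<lambda>q. f q + g q) (f' + g') p"
  unfolding has_pd_def by (rule has_vector_derivative_add)

lemma has_pd_diff [pd_intros]:
  "has_pd d f f' p \<Longrightarrow> has_pd d g g' p \<Longrightarrow> has_pd d (\<lambda>q. f q - g q) (f' - g') p"
  unfolding has_pd_def by (rule has_vector_derivative_diff)

lemma has_pd_minus [pd_intros]: "has_pd d f f' p \<Longrightarrow> has_pd d (\<lambda>q. - f q) (- f') p"
  unfolding has_pd_def by (rule has_vector_derivative_minus)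

lemma has_pd_bounded_linear:
  "bounded_linear h \<Longrightarrow> has_pd d f f' p \<Longrightarrow> has_pd d (\<lambda>q. h (f q)) (h f') p"
  unfolding has_pd_def by (rule bounded_linear.has_vector_derivative)

lemma has_pd_bilinear:
  assumes "bounded_bilinear h" "has_pd d f f' p" "has_pd d g g' p"
  shows "has_pd d (\<lambda>q. h (f q) (g q)) (h (f p) g' + h f' (g p)) p"
  using bounded_bilinear.has_vector_derivative[OF assms(1) assms(2)[unfolded has_pd_def] assms(3)[unfolded has_pd_def]]
  unfolding has_pd_def by simp

lemmas has_pd_mult [pd_intros] = has_pd_bilinear[OF bounded_bilinear_mult]
lemmas has_pd_scaleR [pd_intros] = has_pd_bilinear[OF bounded_bilinear_scaleR]

lemma has_pd_power2 [pd_intros]: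
  fixes f :: "real \<times> real \<Rightarrow> real"
  shows "has_pd d f f' p \<Longrightarrow> has_pd d (\<lambda>q. (f q)\<^sup>2) (2 * f p * f') p"
  using has_pd_mult[of d f f' p f f'] by (simp add: power2_eq_square algebra_simps)

lemma has_pd_real_chain:
  fixes f :: "real \<times> real \<Rightarrow> real" and h :: "real \<Rightarrow> real"
  assumes "(h has_real_derivative h') (at (f p))" "has_pd d f f' p"
  shows "has_pd d (\<lambda>q. h (f q)) (h' * f') p"
proof -
  have "((\<lambda>t. f (p + t *\<^sub>R d)) has_real_derivative f') (at 0)"
    using assms(2) by (simp add: has_pd_def has_real_derivative_iff_has_vector_derivative)
  moreover have "(h has_real_derivative h') (at (f (p + 0 *\<^sub>R d)))" using assms(1) by simp
  ultimately have "((\<lambda>t. h (f (p + t *\<^sub>R d))) has_real_derivative h' * f') (at 0)"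
    using DERIV_chain2[where f=h and g="\<lambda>t. f (p + t *\<^sub>R d)"] by blast
  then show ?thesis by (simp add: has_pd_def has_real_derivative_iff_has_vector_derivative)
qed

lemma has_pd_inverse [pd_intros]:
  fixes f :: "real \<times> real \<Rightarrow> real"
  assumes "f p \<noteq> 0" "has_pd d f f' p"
  shows "has_pd d (\<lambda>q. inverse (f q)) (- f' / (f p)\<^sup>2) p"
  using has_pd_real_chain[OF DERIV_inverse[OF assms(1)] assms(2)]
  by (simp add: power2_eq_square field_simps)

lemma has_pd_divide [pd_intros]:
  fixes f g :: "real \<times> real \<Rightarrow> real"
  assumes "g p \<noteq> 0" "has_pd d f f' p" "has_pd d g g' p"
  shows "has_pd d (\<lambda>q. f q / g q) ((f' * g p - f p * g') / (g p)\<^sup>2) p"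
  using has_pd_mult[OF assms(2) has_pd_inverse[OF assms(1,3)]] assms(1)
  by (simp add: divide_inverse[symmetric]) (simp add: field_simps power2_eq_square)

lemma has_pd_cong:
  assumes "open S" "p \<in> S" "\<And>q. q \<in> S \<Longrightarrow> f q = g q" "has_pd d f f' p"
  shows "has_pd d g f' p"
proof -
  have "continuous (at 0) (\<lambda>t::real. p + t *\<^sub>R d)" by (intro continuous_intros)
  then have "((\<lambda>t. p + t *\<^sub>R d) \<longlongrightarrow> p) (at 0)" by (simp add: continuous_at)
  then have "\<forall>\<^sub>F t in at 0. p + t *\<^sub>R d \<in> S" using assms(1,2) by (rule topological_tendstoD)
  then have "\<forall>\<^sub>F t in nhds 0. p + t *\<^sub>R d \<in> S" using assms(2) by (simp add: eventually_nhds_conv_at)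
  then have "\<forall>\<^sub>F t in nhds 0. f (p + t *\<^sub>R d) = g (p + t *\<^sub>R d)"
    by (rule eventually_mono) (use assms(3) in auto)
  then show ?thesis
    using assms(4) unfolding has_pd_def
    by (subst has_vector_derivative_cong_ev[symmetric, where f="\<lambda>t. f (p + t *\<^sub>R d)"])
      (auto dest: eventually_nhds_x_imp_x intro: eventually_mono)
qed

text \<open>Differentiability is not assumed: \<open>vector_derivative\<close> chooses from the set
  of all derivatives, and locally equal functions have the same set, empty or not.\<close>

lemma pdu_cong: 
  assumes "open S" "p \<in> S" "\<And>q. q \<in> S \<Longrightarrow> f q = g q"
  shows "pdu f p = pdu g p"
proof -
  have "has_pd du f f' p \<longleftrightarrow> has_pd du g f' p" for f'
    using has_pd_cong[OF assms(1,2), of f g du f'] has_pd_cong[OF assms(1,2), of g f du f'] assms(3) by auto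
  then show ?thesis
    unfolding pdu_def vector_derivative_def has_pd_du_iff by simp
qed

lemma pdv_cong: 
  assumes "open S" "p \<in> S" "\<And>q. q \<in> S \<Longrightarrow> f q = g q"
  shows "pdv f p = pdv g p"
proof -
  have "has_pd dv f f' p \<longleftrightarrow> has_pd dv g f' p" for f'
    using has_pd_cong[OF assms(1,2), of f g dv f'] has_pd_cong[OF assms(1,2), of g f dv f'] assms(3) by auto
  then show ?thesis
    unfolding pdv_def vector_derivative_def has_pd_dv_iff by simp
qed

section \<open>Functions of class \<open>C\<^sup>k\<close>\<close>

lemma Ck_on_imp_continuous_on: "Ck_on k D f \<Longrightarrow> continuous_on D f"
  by (cases k) (auto intro: differentiable_imp_continuous_on)

lemma Ck_on_SucD: "Ck_on (Suc k) D f \<Longrightarrow> Ck_on k D f"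
proof (induction k arbitrary: f)
  case 0
  then have "f differentiable_on D" by simp
  then show ?case by (simp add: differentiable_imp_continuous_on)
next
  case (Suc k)
  then show ?case using Ck_on.simps(2) by blast
qed

lemma Ck_on_Suc_differentiable:
  "open D \<Longrightarrow> Ck_on (Suc k) D f \<Longrightarrow> p \<in> D \<Longrightarrow> f differentiable (at p)"
  by (simp add: differentiable_on_eq_differentiable_at)

lemma Ck_on_Suc_has_pd:
  assumes "open D" "Ck_on (Suc k) D f" "p \<in> D"
  shows "has_pd du f (pdu f p) p" "has_pd dv f (pdv f p) p"
  using Ck_on_Suc_differentiable[OF assms] differentiable_imp_has_pdu differentiable_imp_has_pdv by blast+

lemma Ck_on_cong:
  assumes "open D" "\<And>p. p \<in> D \<Longrightarrow> f p = g p" "Ck_on k D f"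
  shows "Ck_on k D g"
  using assms(2,3)
proof (induction k arbitrary: f g)
  case 0
  then show ?case using continuous_on_cong[of D D f g] by simp
next
  case (Suc k)
  have "g differentiable_on D"
    unfolding differentiable_on_eq_differentiable_at[OF assms(1)]
  proof
    fix p assume p: "p \<in> D"
    then obtain f' where "(f has_derivative f') (at p)"
      using Ck_on_Suc_differentiable[OF assms(1) Suc.prems(2) p] unfolding differentiable_def by blast
    then have "(g has_derivative f') (at p)"
      by (rule has_derivative_transform_within_open[OF _ assms(1) p]) (use Suc.prems(1) in auto)
    then show "g differentiable (at p)" by (auto simp: differentiable_def)
  qed
  moreover have "pdu f p = pdu g p" "pdv f p = pdv g p" if "p \<in> D" for p
    using pdu_cong[OF assms(1) that] pdv_cong[OF assms(1) that] Suc.prems(1) by auto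
  moreover have "Ck_on k D (pdu f)" "Ck_on k D (pdv f)" using Suc.prems(2) by simp_all
  ultimately show ?case using Suc.IH[of "pdu f" "pdu g"] Suc.IH[of "pdv f" "pdv g"] by simp
qed

text \<open>Formulas for partial derivatives are available only at points of \<open>D\<close>, so
  regularity is shown for the formulas \<open>fu\<close>, \<open>fv\<close> and carried over to
  \<open>pdu f\<close>, \<open>pdv f\<close> by congruence.\<close>

lemma Ck_on_SucI:
  assumes "open D" "f differentiable_on D"
    and "\<And>p. p \<in> D \<Longrightarrow> pdu f p = fu p" "\<And>p. p \<in> D \<Longrightarrow> pdv f p = fv p"
    and "Ck_on k D fu" "Ck_on k D fv"
  shows "Ck_on (Suc k) D f"
  using assms(2) Ck_on_cong[OF assms(1) _ assms(5), of "pdu f"] Ck_on_cong[OF assms(1) _ assms(6), of "pdv f"] assms(3,4)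
  by simp

lemma Ck_on_const: "open D \<Longrightarrow> Ck_on k D (\<lambda>p. c)"
proof (induction k arbitrary: c)
  case (Suc k)
  have "pdu (\<lambda>p. c) = (\<lambda>p. 0)" "pdv (\<lambda>p. c) = (\<lambda>p. 0)" by (auto simp: pdu_def pdv_def)
  then show ?case using Suc by simp
qed simp

lemma Ck_on_add:
  assumes "open D" "Ck_on k D f" "Ck_on k D g"
  shows "Ck_on k D (\<lambda>p. f p + g p)"
  using assms(2,3)
proof (induction k arbitrary: f g)
  case 0
  then show ?case by (auto intro: continuous_intros)
next
  case (Suc k)
  have "pdu (\<lambda>p. f p + g p) p = pdu f p + pdu g p" "pdv (\<lambda>p. f p + g p) p = pdv f p + pdv g p" if "p \<in> D" for p
    using Ck_on_Suc_has_pd[OF assms(1) Suc.prems(1) that] Ck_on_Suc_has_pd[OF assms(1) Suc.prems(2) that]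
    by (auto intro!: pdu_eqI pdv_eqI pd_intros)
  moreover have "Ck_on k D (\<lambda>p. pdu f p + pdu g p)" "Ck_on k D (\<lambda>p. pdv f p + pdv g p)"
    using Suc by auto
  moreover have "(\<lambda>p. f p + g p) differentiable_on D"
    using Suc.prems by (auto intro: derivative_intros)
  ultimately show ?case
    using Ck_on_SucI[OF assms(1), where fu="\<lambda>p. pdu f p + pdu g p" and fv="\<lambda>p. pdv f p + pdv g p"] by simp
qed

lemma Ck_on_bounded_linear:
  assumes "open D" "bounded_linear h" "Ck_on k D f"
  shows "Ck_on k D (\<lambda>p. h (f p))"
  using assms(3)
proof (induction k arbitrary: f)
  case 0
  then show ?case using assms(2) by (auto intro: bounded_linear.continuous_on)
next
  case (Suc k)
  have "pdu (\<lambda>p. h (f p)) p = h (pdu f p)" "pdv (\<lambda>p. h (f p)) p = h (pdv f p)" if "p \<in> D" for p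
    using Ck_on_Suc_has_pd[OF assms(1) Suc.prems(1) that]
    by (auto intro!: pdu_eqI pdv_eqI has_pd_bounded_linear[OF assms(2)])
  moreover have "Ck_on k D (\<lambda>p. h (pdu f p))" "Ck_on k D (\<lambda>p. h (pdv f p))"
    using Suc by auto
  moreover have "(\<lambda>p. h (f p)) differentiable_on D"
    unfolding differentiable_on_eq_differentiable_at[OF assms(1)]
  proof
    fix p assume p: "p \<in> D"
    obtain f' where "(f has_derivative f') (at p)"
      using Ck_on_Suc_differentiable[OF assms(1) Suc.prems(1) p] by (auto simp: differentiable_def)
    from bounded_linear.has_derivative[OF assms(2) this]
    show "(\<lambda>p. h (f p)) differentiable (at p)" by (auto simp: differentiable_def)
  qed
  ultimately show ?case
    using Ck_on_SucI[OF assms(1), where fu="\<lambda>p. h (pdu f p)" and fv="\<lambda>p. h (pdv f p)"] by simp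
qed

text \<open>One product rule serves real products, scalar multiples, \<open>mink\<close> and the
  matrix product. Each term of the derivative keeps one factor undifferentiated, which is weakened
  by \<open>Ck_on_SucD\<close> before the induction hypothesis applies.\<close>

lemma Ck_on_bilinear:
  assumes "open D" "bounded_bilinear h" "Ck_on k D f" "Ck_on k D g"
  shows "Ck_on k D (\<lambda>p. h (f p) (g p))"
  using assms(3,4)
proof (induction k arbitrary: f g)
  case 0
  then show ?case using assms(2) by (auto intro: bounded_bilinear.continuous_on)
next
  case (Suc k)
  have "pdu (\<lambda>p. h (f p) (g p)) p = h (f p) (pdu g p) + h (pdu f p) (g p)"
    "pdv (\<lambda>p. h (f p) (g p)) p = h (f p) (pdv g p) + h (pdv f p) (g p)" if "p \<in> D" for p
    using Ck_on_Suc_has_pd[OF assms(1) Suc.prems(1) that] Ck_on_Suc_has_pd[OF assms(1) Suc.prems(2) that]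
    by (auto intro!: pdu_eqI pdv_eqI has_pd_bilinear[OF assms(2)])
  moreover have "Ck_on k D (\<lambda>p. h (f p) (pdu g p) + h (pdu f p) (g p))"
     "Ck_on k D (\<lambda>p. h (f p) (pdv g p) + h (pdv f p) (g p))"
    using Suc.prems Suc.prems[THEN Ck_on_SucD] by (auto intro!: Ck_on_add[OF assms(1)] Suc.IH)
  moreover have "(\<lambda>p. h (f p) (g p)) differentiable_on D"
    unfolding differentiable_on_eq_differentiable_at[OF assms(1)]
  proof
    fix p assume p: "p \<in> D"
    obtain f' g' where "(f has_derivative f') (at p)" "(g has_derivative g') (at p)"
      using Ck_on_Suc_differentiable[OF assms(1) Suc.prems(1) p]
        Ck_on_Suc_differentiable[OF assms(1) Suc.prems(2) p] by (auto simp: differentiable_def)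
    from bounded_bilinear.FDERIV[OF assms(2) this]
    show "(\<lambda>p. h (f p) (g p)) differentiable (at p)" by (auto simp: differentiable_def)
  qed
  ultimately show ?case
    using Ck_on_SucI[OF assms(1), where fu="\<lambda>p. h (f p) (pdu g p) + h (pdu f p) (g p)" and fv="\<lambda>p. h (f p) (pdv g p) + h (pdv f p) (g p)"] by simp
qed

lemma Ck_on_inverse:
  fixes f :: "real \<times> real \<Rightarrow> real"
  assumes "open D" "\<And>p. p \<in> D \<Longrightarrow> f p \<noteq> 0" "Ck_on k D f"
  shows "Ck_on k D (\<lambda>p. inverse (f p))"
  using assms(3)
proof (induction k)
  case 0
  then show ?case using assms(2) by (auto intro: continuous_on_inverse)
next
  case (Suc k)
  \<comment> \<open>The derivative of 1/f is -f' (1/f)^2; written through \<open>i\<close>, it is a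
    product to which the induction hypothesis on \<open>i\<close> itself applies.\<close>
  define i where "i = (\<lambda>p. inverse (f p))"
  have i: "Ck_on k D i" unfolding i_def using Suc.IH Suc.prems[THEN Ck_on_SucD] by simp
  have eq: "pdu i p = - (pdu f p * (i p * i p))" "pdv i p = - (pdv f p * (i p * i p))" if "p \<in> D" for p
    using pdu_eqI[OF has_pd_inverse[OF assms(2)[OF that] Ck_on_Suc_has_pd(1)[OF assms(1) Suc.prems(1) that]]]
      pdv_eqI[OF has_pd_inverse[OF assms(2)[OF that] Ck_on_Suc_has_pd(2)[OF assms(1) Suc.prems(1) that]]]
    by (simp_all add: i_def power2_eq_square divide_inverse)
  note mult = Ck_on_bilinear[OF assms(1) bounded_bilinear_mult]
  have "Ck_on k D (\<lambda>p. - (pdu f p * (i p * i p)))" "Ck_on k D (\<lambda>p. - (pdv f p * (i p * i p)))"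
    using Suc.prems by (auto intro!: mult i Ck_on_bounded_linear[OF assms(1) bounded_linear_minus[OF bounded_linear_ident]])
  moreover have "i differentiable_on D"
    using Suc.prems assms(2) by (auto simp: differentiable_on_def i_def intro!: differentiable_inverse)
  ultimately show ?case
    unfolding i_def[symmetric]
    using eq Ck_on_SucI[OF assms(1), where fu="\<lambda>p. - (pdu f p * (i p * i p))" and fv="\<lambda>p. - (pdv f p * (i p * i p))"] by simp
qed

lemma Ck_on_subset:
  assumes "open D" "open D'" "D' \<subseteq> D" "Ck_on k D f"
  shows "Ck_on k D' f"
  using assms(4) by (induction k arbitrary: f)
    (auto intro: continuous_on_subset[OF _ assms(3)] differentiable_on_subset[OF _ assms(3)])

named_theorems smooth_intros

lemma smooth_on_const [smooth_intros]: "open D \<Longrightarrow> smooth_on D (\<lambda>p. c)"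
  by (simp add: smooth_on_def Ck_on_const)

lemma smooth_on_add [smooth_intros]:
  "open D \<Longrightarrow> smooth_on D f \<Longrightarrow> smooth_on D g \<Longrightarrow> smooth_on D (\<lambda>p. f p + g p)"
  by (simp add: smooth_on_def Ck_on_add)

lemma smooth_on_bounded_linear:
  "bounded_linear h \<Longrightarrow> open D \<Longrightarrow> smooth_on D f \<Longrightarrow> smooth_on D (\<lambda>p. h (f p))"
  by (simp add: smooth_on_def Ck_on_bounded_linear)

lemma smooth_on_bilinear:
  "bounded_bilinear h \<Longrightarrow> open D \<Longrightarrow> smooth_on D f \<Longrightarrow> smooth_on D g \<Longrightarrow> smooth_on D (\<lambda>p. h (f p) (g p))"
  by (simp add: smooth_on_def Ck_on_bilinear)

lemmas smooth_on_minus [smooth_intros] = smooth_on_bounded_linear[OF bounded_linear_minus[OF bounded_linear_ident]]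
lemmas smooth_on_mult [smooth_intros] = smooth_on_bilinear[OF bounded_bilinear_mult]
lemmas smooth_on_scaleR [smooth_intros] = smooth_on_bilinear[OF bounded_bilinear_scaleR]

lemma smooth_on_diff [smooth_intros]:
  "open D \<Longrightarrow> smooth_on D f \<Longrightarrow> smooth_on D g \<Longrightarrow> smooth_on D (\<lambda>p. f p - g p)"
  using smooth_on_add[OF _ _ smooth_on_minus] by force

lemma smooth_on_sum [smooth_intros]:
  "open D \<Longrightarrow> (\<And>i. i \<in> I \<Longrightarrow> smooth_on D (f i)) \<Longrightarrow> smooth_on D (\<lambda>p. \<Sum>i\<in>I. f i p)"
  by (induction I rule: infinite_finite_induct) (auto intro!: smooth_intros)

lemma smooth_on_inverse [smooth_intros]:
  fixes f :: "real \<times> real \<Rightarrow> real"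
  shows "open D \<Longrightarrow> (\<And>p. p \<in> D \<Longrightarrow> f p \<noteq> 0) \<Longrightarrow> smooth_on D f \<Longrightarrow> smooth_on D (\<lambda>p. inverse (f p))"
  by (simp add: smooth_on_def Ck_on_inverse)

lemma smooth_on_divide [smooth_intros]:
  fixes f g :: "real \<times> real \<Rightarrow> real"
  shows "open D \<Longrightarrow> (\<And>p. p \<in> D \<Longrightarrow> g p \<noteq> 0) \<Longrightarrow> smooth_on D f \<Longrightarrow> smooth_on D g \<Longrightarrow> smooth_on D (\<lambda>p. f p / g p)"
  unfolding divide_inverse by (intro smooth_intros)

lemma smooth_on_power2 [smooth_intros]:
  fixes f :: "real \<times> real \<Rightarrow> real"
  shows "open D \<Longrightarrow> smooth_on D f \<Longrightarrow> smooth_on D (\<lambda>p. (f p)\<^sup>2)"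
  unfolding power2_eq_square by (intro smooth_intros)

lemma smooth_on_pdu [smooth_intros]: "smooth_on D f \<Longrightarrow> smooth_on D (pdu f)"
  unfolding smooth_on_def using Ck_on.simps(2) by blast

lemma smooth_on_pdv [smooth_intros]: "smooth_on D f \<Longrightarrow> smooth_on D (pdv f)"
  unfolding smooth_on_def using Ck_on.simps(2) by blast

lemma smooth_on_cong:
  "open D \<Longrightarrow> (\<And>p. p \<in> D \<Longrightarrow> f p = g p) \<Longrightarrow> smooth_on D f \<Longrightarrow> smooth_on D g"
  unfolding smooth_on_def using Ck_on_cong by blast

lemma smooth_on_subset:
  "open D \<Longrightarrow> open D' \<Longrightarrow> D' \<subseteq> D \<Longrightarrow> smooth_on D f \<Longrightarrow> smooth_on D' f"
  unfolding smooth_on_def using Ck_on_subset by blast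

lemma smooth_on_imp_continuous_on: "smooth_on D f \<Longrightarrow> continuous_on D f"
  unfolding smooth_on_def using Ck_on_imp_continuous_on by blast

lemma smooth_on_imp_differentiable: "open D \<Longrightarrow> smooth_on D f \<Longrightarrow> p \<in> D \<Longrightarrow> f differentiable (at p)"
  unfolding smooth_on_def using Ck_on_Suc_differentiable by blast

lemma smooth_on_has_pdu: "open D \<Longrightarrow> smooth_on D f \<Longrightarrow> p \<in> D \<Longrightarrow> has_pd du f (pdu f p) p"
  using smooth_on_imp_differentiable differentiable_imp_has_pdu by blast

lemma smooth_on_has_pdv: "open D \<Longrightarrow> smooth_on D f \<Longrightarrow> p \<in> D \<Longrightarrow> has_pd dv f (pdv f p) p"
  using smooth_on_imp_differentiable differentiable_imp_has_pdv by blast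

section \<open>Mixed and total derivatives\<close>

lemma open_contains_rectangle:
  fixes D :: "(real \<times> real) set"
  assumes "open D" "(a, b) \<in> D"
  obtains e where "e > 0" "{a - e..a + e} \<times> {b - e..b + e} \<subseteq> D"
proof -
  obtain A B where AB: "open A" "open B" "a \<in> A" "b \<in> B" "A \<times> B \<subseteq> D"
    using open_prod_elim[OF assms] by (metis mem_Sigma_iff)
  obtain e1 where e1: "e1 > 0" "cball a e1 \<subseteq> A" using AB open_contains_cball by blast
  obtain e2 where e2: "e2 > 0" "cball b e2 \<subseteq> B" using AB open_contains_cball by blast
  let ?e = "min e1 e2"
  have "{a - ?e..a + ?e} \<subseteq> cball a e1" "{b - ?e..b + ?e} \<subseteq> cball b e2"
    by (auto simp: cball_eq_atLeastAtMost)
  then have "{a - ?e..a + ?e} \<times> {b - ?e..b + ?e} \<subseteq> D"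
    using e1(2) e2(2) AB(5) by blast
  then show thesis using that[of ?e] e1(1) e2(1) by simp
qed

text \<open>Schwarz's theorem by integration: f(u,v) - f(c,v) is the integral of
  \<open>pdu f\<close> over [c,u]. Differentiating in v under the integral sign presents
  \<open>pdv f\<close> as an integral with upper limit u, and differentiating that in u leaves the
  integrand \<open>pdv (pdu f)\<close>.\<close>

lemma pdv_pdu_commute:
  fixes f :: "real \<times> real \<Rightarrow> 'a::banach"
  assumes "open D" "Ck_on (Suc (Suc 0)) D f" "p \<in> D"
  shows "pdv (pdu f) p = pdu (pdv f) p"
proof -
  obtain a b where p: "p = (a, b)" by (cases p)
  obtain e where e: "e > 0" and R: "{a - e..a + e} \<times> {b - e..b + e} \<subseteq> D"
    using open_contains_rectangle[OF assms(1)] assms(3) p by blast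
  define U V c where "U = {a - e..a + e}" and "V = {b - e..b + e}" and "c = a - e"
  have inD: "(u, v) \<in> D" if "u \<in> U" "v \<in> V" for u v using R that by (auto simp: U_def V_def)
  have cU: "c \<in> U" and aU: "a \<in> U" and bV: "b \<in> V" using e by (auto simp: U_def V_def c_def)
  have sub: "{c..u} \<subseteq> U" if "u \<in> U" for u using that by (auto simp: U_def c_def)
  have C1: "Ck_on (Suc 0) D (pdu f)" "Ck_on (Suc 0) D (pdv f)" using assms(2) by auto
  have cont: "continuous_on D (pdu f)" "continuous_on D (pdv (pdu f))"
    using C1 Ck_on_imp_continuous_on by (blast, simp)
  have fu: "((\<lambda>t. f (t, v)) has_vector_derivative pdu f (u, v)) (at u)"
    and fv: "((\<lambda>t. f (u, t)) has_vector_derivative pdv f (u, v)) (at v)"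
    and fuv: "((\<lambda>t. pdu f (u, t)) has_vector_derivative pdv (pdu f) (u, v)) (at v)"
    if "u \<in> U" "v \<in> V" for u v
    using Ck_on_Suc_has_pd[OF assms(1,2) inD[OF that]] Ck_on_Suc_has_pd[OF assms(1) C1(1) inD[OF that]]
    unfolding has_pd_du_iff has_pd_dv_iff by simp_all
  have I: "integral (cbox c u) (\<lambda>t. pdu f (t, v)) = f (u, v) - f (c, v)" if "u \<in> U" "v \<in> V" for u v
    unfolding box_real
  proof (rule integral_unique, rule fundamental_theorem_of_calculus)
    show "c \<le> u" using that by (simp add: U_def c_def)
    show "((\<lambda>t. f (t, v)) has_vector_derivative pdu f (t, v)) (at t within {c..u})" if "t \<in> {c..u}" for t
      using fu sub that \<open>u \<in> U\<close> \<open>v \<in> V\<close> has_vector_derivative_at_within by blast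
  qed
  have fv_eq: "pdv f (u, b) = pdv f (c, b) + integral {c..u} (\<lambda>t. pdv (pdu f) (t, b))" if u: "u \<in> U" for u
  proof -
    have "((\<lambda>v. integral (cbox c u) (\<lambda>t. pdu f (t, v))) has_vector_derivative
            integral (cbox c u) (\<lambda>t. pdv (pdu f) (t, b))) (at b within V)"
    proof (rule leibniz_rule_vector_derivative)
      show "((\<lambda>v. pdu f (t, v)) has_vector_derivative pdv (pdu f) (t, v)) (at v within V)"
        if "v \<in> V" "t \<in> cbox c u" for v t
        using fuv sub[OF u] that has_vector_derivative_at_within by (metis box_real(2) subsetD)
      show "(\<lambda>t. pdu f (t, v)) integrable_on cbox c u" if "v \<in> V" for v
        using sub[OF u] inD that
        by (intro integrable_continuous continuous_on_compose2[OF cont(1)]) (auto intro!: continuous_intros)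
      show "continuous_on (V \<times> cbox c u) (\<lambda>(v, t). pdv (pdu f) (t, v))"
        unfolding split_beta using sub[OF u] inD
        by (intro continuous_on_compose2[OF cont(2)]) (auto intro!: continuous_intros)
    qed (use bV in \<open>auto simp: V_def\<close>)
    then have "((\<lambda>v. f (u, v) - f (c, v)) has_vector_derivative
            integral {c..u} (\<lambda>t. pdv (pdu f) (t, b))) (at b within V)"
      unfolding box_real by (rule has_vector_derivative_weaken[where S=V]) (use I[OF u] bV in auto)
    moreover have "((\<lambda>v. f (u, v) - f (c, v)) has_vector_derivative pdv f (u, b) - pdv f (c, b)) (at b within V)"
      using has_vector_derivative_diff[OF fv[OF u bV] fv[OF cU bV]] by (rule has_vector_derivative_at_within)
    moreover have "at b within V \<noteq> bot" unfolding V_def using e by (simp add: at_within_Icc_at)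
    ultimately have "pdv f (u, b) - pdv f (c, b) = integral {c..u} (\<lambda>t. pdv (pdu f) (t, b))"
      using vector_derivative_unique_within by blast
    then show ?thesis by (simp add: algebra_simps)
  qed
  have "continuous_on U (\<lambda>t. pdv (pdu f) (t, b))"
    using inD bV by (intro continuous_on_compose2[OF cont(2)]) (auto intro!: continuous_intros)
  then have "((\<lambda>u. integral {c..u} (\<lambda>t. pdv (pdu f) (t, b))) has_vector_derivative pdv (pdu f) (a, b)) (at a within U)"
    using aU unfolding U_def c_def by (rule integral_has_vector_derivative)
  then have "((\<lambda>u. pdv f (c, b) + integral {c..u} (\<lambda>t. pdv (pdu f) (t, b))) has_vector_derivative pdv (pdu f) (a, b)) (at a within U)"
    by (auto intro!: derivative_eq_intros)
  then have "((\<lambda>u. pdv f (u, b)) has_vector_derivative pdv (pdu f) (a, b)) (at a within U)"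
    by (rule has_vector_derivative_weaken[where S=U]) (use fv_eq aU in auto)
  then have "((\<lambda>u. pdv f (u, b)) has_vector_derivative pdv (pdu f) (a, b)) (at a)"
    unfolding U_def using e by (simp add: at_within_Icc_at)
  then have "has_pd du (pdv f) (pdv (pdu f) p) p" by (simp add: has_pd_du_iff p)
  then show ?thesis using pdu_eqI by metis
qed

lemma smooth_on_pdv_pdu: 
  fixes f :: "real \<times> real \<Rightarrow> 'a::banach"
  shows "open D \<Longrightarrow> smooth_on D f \<Longrightarrow> p \<in> D \<Longrightarrow> pdv (pdu f) p = pdu (pdv f) p"
  using pdv_pdu_commute unfolding smooth_on_def by blast

text \<open>An increment splits into a horizontal step at fixed height, covered by the u-derivative
  at the point, and a vertical step, controlled uniformly by continuity of \<open>fv\<close>. The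
  vector \<open>fv q\<close> enters as the bounded linear map
  \<open>blinfun_scaleR_left (fv q)\<close>.\<close>

lemma has_pd_imp_differentiable:
  fixes f :: "real \<times> real \<Rightarrow> 'a::real_normed_vector"
  assumes "open D" "\<And>q. q \<in> D \<Longrightarrow> has_pd du f (fu q) q" "\<And>q. q \<in> D \<Longrightarrow> has_pd dv f (fv q) q"
    and "continuous_on D fv" "p \<in> D"
  shows "f differentiable (at p)"
proof -
  obtain a b where p: "p = (a, b)" by (cases p)
  obtain e where e: "e > 0" and R: "{a - e..a + e} \<times> {b - e..b + e} \<subseteq> D"
    using open_contains_rectangle[OF assms(1)] assms(5) p by blast
  define U V where "U = {a - e<..<a + e}" and "V = {b - e<..<b + e}"
  have UV: "U \<times> V \<subseteq> D" using R unfolding U_def V_def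
    using greaterThanLessThan_subseteq_atLeastAtMost_iff[of "a - e" "a + e" "a - e" "a + e"]
      greaterThanLessThan_subseteq_atLeastAtMost_iff[of "b - e" "b + e" "b - e" "b + e"] by blast
  have ab: "a \<in> U" "b \<in> V" using e by (auto simp: U_def V_def)
  have "((\<lambda>(x, y). f (x, y)) has_derivative (\<lambda>(tx, ty). tx *\<^sub>R fu (a, b) + blinfun_scaleR_left (fv (a, b)) ty))
      (at (a, b) within U \<times> V)"
  proof (rule has_derivative_partialsI[where f="\<lambda>x y. f (x, y)" and fx="\<lambda>tx. tx *\<^sub>R fu (a, b)" and fy="\<lambda>x y. blinfun_scaleR_left (fv (x, y))"])
    show "((\<lambda>x. f (x, b)) has_derivative (\<lambda>tx. tx *\<^sub>R fu (a, b))) (at a within U)"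
    proof (rule has_derivative_at_withinI)
      have "(a, b) \<in> D" using UV ab by blast
      then show "((\<lambda>x. f (x, b)) has_derivative (\<lambda>tx. tx *\<^sub>R fu (a, b))) (at a)"
        using assms(2)[of "(a, b)"] unfolding has_pd_du_iff has_vector_derivative_def by simp
    qed
    show "((\<lambda>y. f (x, y)) has_derivative blinfun_apply (blinfun_scaleR_left (fv (x, y)))) (at y within V)"
      if "x \<in> U" "y \<in> V" for x y
    proof (rule has_derivative_at_withinI)
      have "(x, y) \<in> D" using UV that by blast
      then show "((\<lambda>y. f (x, y)) has_derivative blinfun_apply (blinfun_scaleR_left (fv (x, y)))) (at y)"
        using assms(3)[of "(x, y)"] unfolding has_pd_dv_iff has_vector_derivative_def blinfun_scaleR_left.rep_eq by simp
    qed
    have "continuous_on (U \<times> V) (\<lambda>q. blinfun_scaleR_left (fv q))"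
      using continuous_on_subset[OF assms(4) UV]
      by (rule bounded_linear.continuous_on[OF bounded_linear_blinfun_scaleR_left])
    then show "continuous (at (a, b) within U \<times> V) (\<lambda>(x, y). blinfun_scaleR_left (fv (x, y)))"
      using ab by (simp add: split_def continuous_on_eq_continuous_within)
  qed (use ab in \<open>auto simp: V_def\<close>)
  moreover have "at (a, b) within U \<times> V = at (a, b)"
    using ab by (intro at_within_open open_Times) (auto simp: U_def V_def)
  ultimately show ?thesis unfolding differentiable_def p by (auto simp: split_def)
qed

text \<open>Made for solutions of differential systems, where only partial derivatives are known:
  total differentiability comes from the continuity of \<open>fv\<close>.\<close>

lemma Ck_on_SucI_has_pd:
  assumes "open D" "\<And>q. q \<in> D \<Longrightarrow> has_pd du f (fu q) q" "\<And>q. q \<in> D \<Longrightarrow> has_pd dv f (fv q) q"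
    and "Ck_on k D fu" "Ck_on k D fv"
  shows "Ck_on (Suc k) D f"
proof (rule Ck_on_SucI[OF assms(1) _ _ _ assms(4,5)])
  show "f differentiable_on D"
    unfolding differentiable_on_eq_differentiable_at[OF assms(1)]
    using has_pd_imp_differentiable[OF assms(1-3)] Ck_on_imp_continuous_on[OF assms(5)] by blast
qed (use assms(2,3) pdu_eqI pdv_eqI in blast)+

lemma base_domainD:
  "base_domain u0 v0 D \<Longrightarrow> (u, v) \<in> D \<Longrightarrow> s \<in> closed_segment u0 u \<Longrightarrow> t \<in> closed_segment v0 v \<Longrightarrow> (s, t) \<in> D"
  unfolding base_domain_def by blast

text \<open>The broken line from the base point along v = v0 and then vertically to \<open>p\<close>
  stays in \<open>D\<close>, and \<open>f\<close> is constant on both pieces.\<close>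

lemma has_pd_zero_imp_constant:
  fixes f :: "real \<times> real \<Rightarrow> 'a::real_normed_vector"
  assumes D: "base_domain u0 v0 D"
    and "\<And>q. q \<in> D \<Longrightarrow> has_pd du f 0 q" "\<And>q. q \<in> D \<Longrightarrow> has_pd dv f 0 q" "p \<in> D"
  shows "f p = f (u0, v0)"
proof -
  obtain u v where p: "p = (u, v)" by (cases p)
  have inD: "(s, t) \<in> D" if "s \<in> closed_segment u0 u" "t \<in> closed_segment v0 v" for s t
    using base_domainD[OF D] that assms(4) p by blast
  have "\<exists>c. \<forall>s\<in>closed_segment u0 u. f (s, v0) = c"
  proof (rule has_vector_derivative_zero_constant[of "closed_segment u0 u" "\<lambda>s. f (s, v0)"])
    show "((\<lambda>s. f (s, v0)) has_vector_derivative 0) (at s within closed_segment u0 u)" if "s \<in> closed_segment u0 u" for s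
      using assms(2)[OF inD[OF that ends_in_segment(1)]] has_vector_derivative_at_within by (simp add: has_pd_du_iff)
  qed auto
  moreover have "\<exists>c. \<forall>t\<in>closed_segment v0 v. f (u, t) = c"
  proof (rule has_vector_derivative_zero_constant[of "closed_segment v0 v" "\<lambda>t. f (u, t)"])
    show "((\<lambda>t. f (u, t)) has_vector_derivative 0) (at t within closed_segment v0 v)" if "t \<in> closed_segment v0 v" for t
      using assms(3)[OF inD[OF ends_in_segment(2) that]] has_vector_derivative_at_within by (simp add: has_pd_dv_iff)
  qed auto
  ultimately show ?thesis using ends_in_segment p by metis
qed

section \<open>The Minkowski product\<close>

lemma bounded_bilinear_mink: "bounded_bilinear mink"
  unfolding bilinear_conv_bounded_bilinear[symmetric] bilinear_def
  by (auto intro!: linearI simp: mink_def algebra_simps)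

lemmas has_pd_mink [pd_intros] = has_pd_bilinear[OF bounded_bilinear_mink]
lemmas smooth_on_mink [smooth_intros] = smooth_on_bilinear[OF bounded_bilinear_mink]

lemma mink_commute: "mink x y = mink y x"
  by (simp add: mink_def algebra_simps)

lemma mink_simps:
  "mink (x + y) w = mink x w + mink y w" "mink w (x + y) = mink w x + mink w y"
  "mink (x - y) w = mink x w - mink y w" "mink w (x - y) = mink w x - mink w y"
  "mink (- x) w = - mink x w" "mink w (- x) = - mink w x"
  "mink (a *\<^sub>R x) w = a * mink x w" "mink w (a *\<^sub>R x) = a * mink w x"
  "mink 0 w = 0" "mink w 0 = 0"
  by (simp_all add: mink_def algebra_simps)

section \<open>Linear differential equations with a parameter\<close>

lemma real_segment_memI:
  fixes a b t :: real
  shows "t \<in> {0..1} \<Longrightarrow> a + t * (b - a) \<in> closed_segment a b"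
  by (auto simp: closed_segment_def algebra_simps intro!: exI[of _ t])

text \<open>Gronwall's inequality for |w|^2, since the norm itself need not be differentiable where
  \<open>w\<close> vanishes. The function exp(-k t) (|w|^2 + e^2) is nonincreasing.\<close>

lemma gronwall_squared:
  fixes w :: "real \<Rightarrow> 'a::real_inner"
  assumes "M \<ge> 0" "e \<ge> 0"
    and deriv: "\<And>t. t \<in> {0..1} \<Longrightarrow> (w has_vector_derivative w' t) (at t within {0..1})"
    and bound: "\<And>t. t \<in> {0..1} \<Longrightarrow> norm (w' t) \<le> M * norm (w t) + e"
    and "t \<in> {0..1}"
  shows "(norm (w t))\<^sup>2 \<le> exp (2 * M + 1) * ((norm (w 0))\<^sup>2 + e\<^sup>2)"
proof -
  \<comment> \<open>From 2 w.w' \<le> 2 M |w|^2 + 2 |w| e and 2 |w| e \<le> |w|^2 + e^2, the rate 2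
    M + 1 suffices.\<close>
  define k where "k = 2 * M + 1"
  define g where "g = (\<lambda>s. exp (- k * s) * (w s \<bullet> w s + e\<^sup>2))"
  have "g t \<le> g 0"
  proof (rule DERIV_nonpos_imp_decreasing_open[where f=g and a=0 and b=t])
    show "0 \<le> t" using assms(5) by simp
    have "continuous_on {0..1} w"
      using deriv has_vector_derivative_continuous continuous_on_eq_continuous_within by blast
    then have "continuous_on {0..t} w" using assms(5) continuous_on_subset by fastforce
    then show "continuous_on {0..t} g" unfolding g_def by (intro continuous_intros)
    fix s assume s: "0 < s" "s < t"
    then have s1: "s \<in> {0..1}" and "at s within {0..1} = at s"
      using assms(5) by (auto simp: at_within_Icc_at)
    then have "(w has_vector_derivative w' s) (at s)" using deriv by metis
    from bounded_bilinear.has_vector_derivative[OF bounded_bilinear_inner this this]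
    have "((\<lambda>s. w s \<bullet> w s) has_real_derivative 2 * (w s \<bullet> w' s)) (at s)"
      by (simp add: has_real_derivative_iff_has_vector_derivative inner_commute)
    then have "(g has_real_derivative exp (- k * s) * (2 * (w s \<bullet> w' s) - k * (w s \<bullet> w s + e\<^sup>2))) (at s)"
      unfolding g_def by (auto intro!: derivative_eq_intros simp: algebra_simps)
    moreover have "2 * (w s \<bullet> w' s) - k * (w s \<bullet> w s + e\<^sup>2) \<le> 0"
    proof -
      have "w s \<bullet> w' s \<le> norm (w s) * norm (w' s)" by (rule norm_cauchy_schwarz)
      also have "\<dots> \<le> norm (w s) * (M * norm (w s) + e)" using bound[OF s1] by (intro mult_left_mono) auto
      finally have "2 * (w s \<bullet> w' s) \<le> 2 * M * (norm (w s))\<^sup>2 + 2 * norm (w s) * e"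
        by (simp add: power2_eq_square algebra_simps)
      also have "\<dots> \<le> 2 * M * (norm (w s))\<^sup>2 + ((norm (w s))\<^sup>2 + e\<^sup>2)"
        using sum_squares_bound[of "norm (w s)" e] by simp
      also have "\<dots> \<le> k * ((norm (w s))\<^sup>2 + e\<^sup>2)"
        using assms(1) unfolding k_def by (simp add: algebra_simps)
      finally show ?thesis by (simp add: power2_norm_eq_inner)
    qed
    ultimately show "\<exists>y. (g has_real_derivative y) (at s) \<and> y \<le> 0"
      by (meson exp_ge_zero mult_nonneg_nonpos)
  qed
  then have "exp (k * t) * (exp (- k * t) * (w t \<bullet> w t + e\<^sup>2)) \<le> exp (k * t) * (w 0 \<bullet> w 0 + e\<^sup>2)"
    unfolding g_def by (intro mult_left_mono) auto
  then have "w t \<bullet> w t + e\<^sup>2 \<le> exp (k * t) * (w 0 \<bullet> w 0 + e\<^sup>2)"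
    by (simp add: mult.assoc[symmetric] exp_add[symmetric])
  also have "\<dots> \<le> exp k * (w 0 \<bullet> w 0 + e\<^sup>2)"
    using assms(1,5) unfolding k_def by (intro mult_right_mono) (auto intro: mult_left_le)
  finally have "w t \<bullet> w t \<le> exp k * (w 0 \<bullet> w 0 + e\<^sup>2)"
    by (smt (verit) zero_le_power2)
  then show ?thesis by (simp add: k_def power2_norm_eq_inner)
qed

text \<open>Each rescaled Picard step integrates a power t^n over the unit interval; the quotient by
  n + 1 builds up the factorial that makes the series converge.\<close>

lemma has_integral_power_unit: "((\<lambda>t::real. k * t ^ n) has_integral k / real (Suc n)) {0..1}"
proof -
  have "((\<lambda>t::real. k * t ^ n) has_integral (k / real (Suc n) * 1 ^ Suc n - k / real (Suc n) * 0 ^ Suc n)) {0..1}"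
  proof (rule fundamental_theorem_of_calculus)
    fix x :: real
    have "((\<lambda>t. k / real (Suc n) * t ^ Suc n) has_real_derivative k / real (Suc n) * (real (Suc n) * x ^ (Suc n - Suc 0)))
        (at x within {0..1})"
      by (intro DERIV_cmult DERIV_pow)
    moreover have "k / real (Suc n) * (real (Suc n) * x ^ (Suc n - Suc 0)) = k * x ^ n"
      by (simp del: of_nat_Suc)
    ultimately show "((\<lambda>t. k / real (Suc n) * t ^ Suc n) has_vector_derivative k * x ^ n) (at x within {0..1})"
      unfolding has_real_derivative_iff_has_vector_derivative[symmetric] by simp
  qed simp
  then show ?thesis by simp
qed

text \<open>The Picard iteration, with the integral from \<open>v0\<close> to \<open>v\<close> rescaled to the unit interval so that
  its dependence on \<open>v\<close> is continuous for trivial reasons.\<close>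

primrec picard :: "('a \<Rightarrow> 'b \<Rightarrow> 'b) \<Rightarrow> real \<Rightarrow> (real \<times> real \<Rightarrow> 'a) \<Rightarrow> (real \<Rightarrow> 'b) \<Rightarrow> nat \<Rightarrow> real \<times> real \<Rightarrow> 'b::euclidean_space"
  where
  "picard pr v0 A c 0 p = c (fst p)"
| "picard pr v0 A c (Suc n) p = (snd p - v0) *\<^sub>R integral (cbox 0 1)
     (\<lambda>t. pr (A (fst p, v0 + t * (snd p - v0))) (picard pr v0 A c n (fst p, v0 + t * (snd p - v0))))"

text \<open>By linearity the series of iterated integrals converges along whole vertical lines, not
  just for short times, so the solution lives on all of \<open>D\<close>. The initial value
  \<open>c\<close> is merely continuous, so only continuity is claimed in the parameter u.\<close>

lemma linear_ode_with_parameter: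
  fixes pr :: "'a::real_normed_vector \<Rightarrow> 'b::euclidean_space \<Rightarrow> 'b"
  assumes bil: "bounded_bilinear pr" and "open D"
    and star: "\<And>u v t. (u, v) \<in> D \<Longrightarrow> t \<in> closed_segment v0 v \<Longrightarrow> (u, t) \<in> D"
    and contA: "continuous_on D A" and contc: "continuous_on {u. (u, v0) \<in> D} c"
  shows "\<exists>y. continuous_on D y \<and> (\<forall>u. (u, v0) \<in> D \<longrightarrow> y (u, v0) = c u) \<and>
    (\<forall>p\<in>D. has_pd dv y (pr (A p) (y p)) p)"
proof -
  define Y where "Y = picard pr v0 A c"
  \<comment> \<open>\<open>Y n\<close> is the n-th term, not the n-th approximation: each term is
    the integral of the previous one under the equation, and the solution is their sum.\<close>
  define y where "y = (\<lambda>p. suminf (\<lambda>n. Y n p))"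
  define l where "l = (\<lambda>p t. (fst p, v0 + t * (snd p - v0)) :: real \<times> real)"
  have Y0: "Y 0 p = c (fst p)" for p by (simp add: Y_def)
  have YSuc: "Y (Suc n) p = (snd p - v0) *\<^sub>R integral (cbox 0 1) (\<lambda>t. pr (A (l p t)) (Y n (l p t)))" for n p
    by (simp add: Y_def l_def)
  have lD: "l p t \<in> D" if "p \<in> D" "t \<in> {0..1}" for p t
  proof -
    have "v0 + t * (snd p - v0) \<in> closed_segment v0 (snd p)"
      using that(2) by (auto simp: closed_segment_def algebra_simps intro!: exI[of _ t])
    then show ?thesis using star[of "fst p" "snd p"] that(1) by (simp add: l_def)
  qed
  have v0D: "(fst p, v0) \<in> D" if "p \<in> D" for p
    using lD[OF that, of 0] by (simp add: l_def)
  have cont_l: "continuous_on S (\<lambda>(p, t). l p t)" for S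
    unfolding l_def split_beta by (intro continuous_intros)
  have contY: "continuous_on D (Y n)" for n
  proof (induction n)
    case 0
    show ?case unfolding Y0
      using v0D by (intro continuous_on_compose2[OF contc]) (auto intro!: continuous_intros)
  next
    case (Suc n)
    have 1: "continuous_on (D \<times> cbox 0 1) (\<lambda>(p, t). pr (A (l p t)) (Y n (l p t)))"
      unfolding split_beta using lD
      by (intro bounded_bilinear.continuous_on[OF bil] continuous_on_compose2[OF contA cont_l[unfolded split_beta]]
          continuous_on_compose2[OF Suc cont_l[unfolded split_beta]]) auto
    show ?case unfolding YSuc by (intro continuous_intros integral_continuous_on_param 1)
  qed
  obtain K where K: "K > 0" "\<And>a b. norm (pr a b) \<le> norm a * norm b * K"
    using bounded_bilinear.pos_bounded[OF bil] by blast
  have local_bound: "\<exists>e S M C. e > 0 \<and> cball p0 e \<subseteq> S \<and> S \<subseteq> D \<and> summable C \<and> M \<ge> 0 \<and>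
      (\<forall>q\<in>S. norm (A q) * K \<le> M \<and> (\<forall>t\<in>{0..1}. l q t \<in> S) \<and> (\<forall>n. norm (Y n q) \<le> C n))"
    if p0: "p0 \<in> D" for p0
  proof -
    obtain e where e: "e > 0" "cball p0 e \<subseteq> D" using \<open>open D\<close> p0 open_contains_cball by blast
    \<comment> \<open>The ball together with all its vertical segments down or up to height v0:
      compact, inside \<open>D\<close>, and mapped into itself by every \<open>l _ t\<close>, so
      bounds on \<open>S\<close> survive the recursion.\<close>
    define S where "S = (\<lambda>(p, t). l p t) ` (cball p0 e \<times> {0..1})"
    have cS: "compact S" unfolding S_def by (intro compact_continuous_image cont_l compact_Times compact_cball) auto
    have SD: "S \<subseteq> D" using lD e(2) by (auto simp: S_def)
    have "p \<in> S" if "p \<in> cball p0 e" for p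
    proof -
      have "p = (\<lambda>(p, t). l p t) (p, 1)" by (simp add: l_def)
      then show ?thesis unfolding S_def using that by (metis (no_types, lifting) SigmaI atLeastAtMost_iff imageI order_refl zero_le_one)
    qed
    then have cbS: "cball p0 e \<subseteq> S" by blast
    have lS: "l q t \<in> S" if qS: "q \<in> S" and t: "t \<in> {0..1}" for q t
    proof -
      obtain x where x: "x \<in> cball p0 e \<times> {0..1}" "q = (\<lambda>(p, t). l p t) x"
        using qS unfolding S_def by (rule imageE) simp
      define p s where "p = fst x" and "s = snd x"
      have ps: "q = l p s" "p \<in> cball p0 e" "s \<in> {0..1}" using x by (simp_all add: p_def s_def split_beta mem_Times_iff)
      \<comment> \<open>Contracting towards height v0 by s and then by t is contracting by t *
        s.\<close>
      have "l q t = (\<lambda>(p, t). l p t) (p, t * s)" unfolding ps(1) by (simp add: l_def algebra_simps)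
      moreover have "t * s \<in> {0..1}" using t ps(3) by (auto intro: mult_le_one)
      ultimately show ?thesis unfolding S_def using ps(2) by (metis (no_types, lifting) SigmaI imageI)
    qed
    have "bounded (A ` S)" using contA cS SD by (meson compact_continuous_image compact_imp_bounded continuous_on_subset)
    then obtain M0 where M0: "\<And>q. q \<in> S \<Longrightarrow> norm (A q) \<le> M0" by (auto simp: bounded_iff)
    define M where "M = \<bar>M0\<bar> * K"
    have M: "M \<ge> 0" "norm (A q) * K \<le> M" if "q \<in> S" for q
      using K(1) M0[OF that] by (auto simp: M_def)
    have "bounded (Y 0 ` S)" using contY cS SD by (meson compact_continuous_image compact_imp_bounded continuous_on_subset)
    then obtain C where C: "\<And>q. q \<in> S \<Longrightarrow> norm (Y 0 q) \<le> C" by (auto simp: bounded_iff)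
    have C0: "C \<ge> 0" using C cbS e(1) by (meson centre_in_cball less_imp_le norm_ge_zero order_trans subsetD)
    have M0': "M \<ge> 0" using K(1) by (simp add: M_def)
    have "bounded ((\<lambda>q. snd q - v0) ` S)"
      by (intro compact_imp_bounded compact_continuous_image cS) (intro continuous_intros)
    then obtain L where L: "\<And>q. q \<in> S \<Longrightarrow> \<bar>snd q - v0\<bar> \<le> L" by (auto simp: bounded_iff)
    \<comment> \<open>Keeping the distance to v0 in the bound is essential: at \<open>l q t\<close>
      it is t times the distance at \<open>q\<close>, which produces the factor t^n and hence
      1/(n+1) after integration.\<close>
    have Yn: "norm (Y n q) \<le> C * (M * \<bar>snd q - v0\<bar>) ^ n / fact n" if "q \<in> S" for n q
      using that
    proof (induction n arbitrary: q)
      case 0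
      then show ?case using C by simp
    next
      case (Suc n)
      define x where "x = \<bar>snd q - v0\<bar>"
      have x: "x \<ge> 0" by (simp add: x_def)
      define k where "k = M * (C * (M * x) ^ n / fact n)"
      have "norm (integral (cbox 0 1) (\<lambda>t. pr (A (l q t)) (Y n (l q t)))) \<le> integral (cbox 0 1) (\<lambda>t. k * t ^ n)"
      proof (rule integral_norm_bound_integral)
        have q: "q \<in> D" using Suc.prems SD by blast
        have "continuous_on {0..1} (l q)" unfolding l_def by (intro continuous_intros)
        then show "(\<lambda>t. pr (A (l q t)) (Y n (l q t))) integrable_on cbox 0 1"
          using lD[OF q]
          by (intro integrable_continuous bounded_bilinear.continuous_on[OF bil] continuous_on_compose2[OF contA]
            continuous_on_compose2[OF contY]) auto
        show "(\<lambda>t::real. k * t ^ n) integrable_on cbox 0 1" using has_integral_power_unit by (auto simp: integrable_on_def)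
        fix t :: real assume t: "t \<in> cbox 0 1"
        have lq: "l q t \<in> S" using lS Suc.prems t by simp
        have "norm (pr (A (l q t)) (Y n (l q t))) \<le> (norm (A (l q t)) * K) * norm (Y n (l q t))"
          using K(2)[of "A (l q t)" "Y n (l q t)"] by (simp add: algebra_simps)
        also have "\<dots> \<le> M * (C * (M * \<bar>snd (l q t) - v0\<bar>) ^ n / fact n)"
          using M(2)[OF lq] Suc.IH[OF lq] M0' by (intro mult_mono) auto
        also have "\<bar>snd (l q t) - v0\<bar> = t * x" using t by (simp add: l_def x_def abs_mult)
        finally show "norm (pr (A (l q t)) (Y n (l q t))) \<le> k * t ^ n"
          by (simp add: k_def power_mult_distrib algebra_simps)
      qed
      also have "\<dots> = k / real (Suc n)" using integral_unique[OF has_integral_power_unit] by (metis box_real(2))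
      finally have "norm (Y (Suc n) q) \<le> x * (k / real (Suc n))"
        unfolding YSuc norm_scaleR x_def real_norm_def by (rule mult_left_mono) simp
      also have "\<dots> = C * (M * x) ^ Suc n / fact (Suc n)"
        by (simp add: k_def field_simps)
      finally show ?case by (simp add: x_def)
    qed
    have "norm (Y n q) \<le> C * (M * L) ^ n / fact n" if "q \<in> S" for n q
    proof -
      have "C * (M * \<bar>snd q - v0\<bar>) ^ n / fact n \<le> C * (M * L) ^ n / fact n"
        using C0 M0' L[OF that] by (intro divide_right_mono mult_left_mono power_mono) auto
      then show ?thesis using Yn[OF that, of n] by linarith
    qed
    moreover have "summable (\<lambda>n. C * (M * L) ^ n / fact n)"
      using summable_mult[OF summable_exp[of "M * L"], of C] by (simp add: field_simps)
    ultimately show ?thesis using e(1) cbS SD M M0' lS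
      by (intro exI[of _ e] exI[of _ S] exI[of _ M] exI[of _ "\<lambda>n. C * (M * L) ^ n / fact n"]) auto
  qed
  have conty: "continuous_on D y"
  proof (rule continuous_at_imp_continuous_on, rule ballI)
    fix p0 assume p0: "p0 \<in> D"
    obtain e S M C where e: "e > 0" "cball p0 e \<subseteq> S" "S \<subseteq> D" and C: "summable C" "\<forall>q\<in>S. \<forall>n. norm (Y n q) \<le> C n"
      using local_bound[OF p0] by blast
    have "uniform_limit S (\<lambda>n q. \<Sum>i<n. Y i q) y sequentially"
      unfolding y_def using C by (intro Weierstrass_m_test) auto
    then have "continuous_on S y"
      by (rule uniform_limit_theorem[rotated])
        (simp_all add: continuous_on_sum continuous_on_subset[OF contY e(3)])
    then have "continuous_on (ball p0 e) y" using e(2) by (meson ball_subset_cball continuous_on_subset)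
    then show "continuous (at p0) y" using e(1) by (simp add: continuous_on_eq_continuous_at)
  qed
  \<comment> \<open>Uniform convergence permits summing under the integral; the sum of the shifted
    terms \<open>Y (Suc i)\<close> is the whole series without \<open>Y 0\<close>, which gives the
    fixed point equation.\<close>
  have int_eq: "y p = c (fst p) + (snd p - v0) *\<^sub>R integral (cbox 0 1) (\<lambda>t. pr (A (l p t)) (y (l p t)))"
    if p: "p \<in> D" for p
  proof -
    obtain e S M C where e: "e > 0" "cball p e \<subseteq> S" "S \<subseteq> D" and C: "summable C" "M \<ge> 0"
       "\<forall>q\<in>S. norm (A q) * K \<le> M \<and> (\<forall>t\<in>{0..1}. l q t \<in> S) \<and> (\<forall>n. norm (Y n q) \<le> C n)"
      using local_bound[OF p] by blast
    have pS: "p \<in> S" using e by auto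
    have sm: "summable (\<lambda>n. Y n q)" if "q \<in> S" for q
      by (rule summable_comparison_test'[OF C(1)]) (use C(3) that in blast)
    define Z where "Z = (\<lambda>n t. pr (A (l p t)) (Y n (l p t)))"
    have contZ: "continuous_on {0..1} (Z n)" for n
      unfolding Z_def using lD[OF p] contY
      by (intro bounded_bilinear.continuous_on[OF bil] continuous_on_compose2[OF contA]
            continuous_on_compose2[OF contY]) (auto simp: l_def intro!: continuous_intros)
    have Zsum: "(\<Sum>n. Z n t) = pr (A (l p t)) (y (l p t))" if "t \<in> {0..1}" for t
      unfolding Z_def y_def
      using bounded_linear.suminf[OF bounded_bilinear.bounded_linear_right[OF bil] sm[of "l p t"]] C(3) pS that by simp
    have "uniform_limit {0..1} (\<lambda>n t. \<Sum>i<n. Z i t) (\<lambda>t. \<Sum>n. Z n t) sequentially"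
    proof (rule Weierstrass_m_test)
      show "summable (\<lambda>n. M * C n)" using C(1) by (rule summable_mult)
      fix n and t :: real assume "t \<in> {0..1}"
      then have lq: "l p t \<in> S" using C(3) pS by blast
      have "norm (Z n t) \<le> (norm (A (l p t)) * K) * norm (Y n (l p t))"
          using K(2)[of "A (l p t)" "Y n (l p t)"] by (simp add: Z_def algebra_simps)
      also have "\<dots> \<le> M * C n" using C(2,3) lq by (intro mult_mono) auto
      finally show "norm (Z n t) \<le> M * C n" .
    qed
    then obtain I J where IJ: "\<And>n. ((\<lambda>t. \<Sum>i<n. Z i t) has_integral I n) {0..1}"
        "((\<lambda>t. \<Sum>n. Z n t) has_integral J) {0..1}" "I \<longlonglongrightarrow> J"
      by (rule uniform_limit_integral) (auto intro!: continuous_on_sum contZ)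
    have "I n = (\<Sum>i<n. integral (cbox 0 1) (Z i))" for n
      using integral_unique[OF IJ(1)] by (simp add: integral_sum integrable_continuous_real contZ)
    then have "(snd p - v0) *\<^sub>R I n = (\<Sum>i<n. Y (Suc i) p)" for n
      by (simp add: YSuc Z_def scaleR_sum_right)
    then have "(\<lambda>n. \<Sum>i<n. Y (Suc i) p) \<longlonglongrightarrow> (snd p - v0) *\<^sub>R J"
      using tendsto_scaleR[OF tendsto_const IJ(3), of "snd p - v0"] by simp
    moreover have "(\<lambda>n. \<Sum>i<n. Y (Suc i) p) \<longlonglongrightarrow> (\<Sum>i. Y (Suc i) p)"
      using sm[OF pS] summable_Suc_iff[of "\<lambda>n. Y n p"] by (intro summable_LIMSEQ) blast
    moreover have "(\<Sum>i. Y (Suc i) p) = y p - Y 0 p"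
      unfolding y_def using suminf_split_head[OF sm[OF pS]] by simp
    moreover have "J = integral (cbox 0 1) (\<lambda>t. pr (A (l p t)) (y (l p t)))"
      using integral_unique[OF IJ(2)] integral_cong[of "{0..1}" "\<lambda>t. \<Sum>n. Z n t", OF Zsum] by simp
    ultimately show ?thesis using LIMSEQ_unique by (fastforce simp: Y0 algebra_simps)
  qed
  have "has_pd dv y (pr (A p) (y p)) p" if "p \<in> D" for p
  proof -
    obtain u v where p: "p = (u, v)" by (cases p)
    obtain d where d: "d > 0" "{u - d..u + d} \<times> {v - d..v + d} \<subseteq> D"
      using open_contains_rectangle[OF \<open>open D\<close>] \<open>p \<in> D\<close> p by blast
    \<comment> \<open>An interval containing v0 and having v in its interior. Its part outside
      [v - d, v + d] lies on segments from v0 to v - d or v + d, so the vertical line over it stays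
      in \<open>D\<close>.\<close>
    define a b where "a = min v0 (v - d)" and "b = max v0 (v + d)"
    have ab: "(u, s) \<in> D" if s: "s \<in> {a..b}" for s
    proof -
      consider "s \<in> {v - d..v + d}" | "s \<in> closed_segment v0 (v - d)" | "s \<in> closed_segment v0 (v + d)"
        using s d(1) by (fastforce simp: a_def b_def closed_segment_eq_real_ivl min_def max_def split: if_splits)
      then show ?thesis
      proof cases
        case 1
        then show ?thesis using d by auto
      next
        case 2
        then show ?thesis by (rule star[of u "v - d", rotated]) (use d in auto)
      next
        case 3
        then show ?thesis by (rule star[of u "v + d", rotated]) (use d in auto)
      qed
    qed
    define f where "f = (\<lambda>s. pr (A (u, s)) (y (u, s)))"
    have "continuous_on {a..b} f"
      unfolding f_def using ab
      by (intro bounded_bilinear.continuous_on[OF bil] continuous_on_compose2[OF contA]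
            continuous_on_compose2[OF conty]) (auto intro!: continuous_intros)
    \<comment> \<open>An antiderivative on the whole interval turns the rescaled integral back into
      G s - G v0 by substitution, whichever side of v0 the point s lies on.\<close>
    then obtain G where G: "\<And>s. s \<in> {a..b} \<Longrightarrow> (G has_vector_derivative f s) (at s within {a..b})"
      using antiderivative_continuous by blast
    have v0ab: "v0 \<in> {a..b}" and vab: "a < v" "v < b" using d(1) by (auto simp: a_def b_def)
    have yG: "y (u, s) = c u + (G s - G v0)" if s: "s \<in> {a..b}" for s
    proof -
      have im: "(\<lambda>t. v0 + t * (s - v0)) ` {0..1} \<subseteq> {a..b}"
      proof
        fix x assume "x \<in> (\<lambda>t. v0 + t * (s - v0)) ` {0..1}"
        then have "x \<in> closed_segment v0 s" using real_segment_memI by blast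
        then show "x \<in> {a..b}" using closed_segment_subset[OF v0ab s] by auto
      qed
      have "((\<lambda>t. (s - v0) *\<^sub>R f (v0 + t * (s - v0))) has_integral (G (v0 + 1 * (s - v0)) - G (v0 + 0 * (s - v0)))) {0..1}"
      proof (rule fundamental_theorem_of_calculus)
        fix t :: real assume t: "t \<in> {0..1}"
        have "((\<lambda>t. v0 + t * (s - v0)) has_vector_derivative (s - v0)) (at t within {0..1})"
          unfolding has_real_derivative_iff_has_vector_derivative[symmetric] by (auto intro!: derivative_eq_intros)
        moreover have "(G has_vector_derivative f (v0 + t * (s - v0))) (at (v0 + t * (s - v0)) within (\<lambda>t. v0 + t * (s - v0)) ` {0..1})"
          using G im t by (meson has_vector_derivative_within_subset image_eqI subsetD)
        ultimately show "((\<lambda>t. G (v0 + t * (s - v0))) has_vector_derivative (s - v0) *\<^sub>R f (v0 + t * (s - v0))) (at t within {0..1})"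
          using vector_diff_chain_within unfolding o_def by blast
      qed simp
      from integral_unique[OF this] have "(s - v0) *\<^sub>R integral {0..1} (\<lambda>t. f (v0 + t * (s - v0))) = G s - G v0"
        by simp
      then show ?thesis using int_eq[OF ab[OF s]] by (simp add: f_def l_def)
    qed
    have "((\<lambda>s. c u + (G s - G v0)) has_vector_derivative f v) (at v within {a..b})"
      using G[of v] vab by (auto intro!: derivative_eq_intros)
    then have "((\<lambda>s. y (u, s)) has_vector_derivative f v) (at v within {a..b})"
      by (rule has_vector_derivative_weaken[where S="{a..b}"]) (use yG vab in auto)
    then show ?thesis using vab by (simp add: has_pd_dv_iff p f_def at_within_Icc_at)
  qed
  moreover have "y (u, v0) = c u" if "(u, v0) \<in> D" for u
    using int_eq[OF that] by simp
  ultimately show ?thesis using conty by blast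
qed

lemma has_pd_dv_segment:
  assumes "has_pd dv f f' (x, v0 + t * (v - v0))"
  shows "((\<lambda>t. f (x, v0 + t * (v - v0))) has_vector_derivative (v - v0) *\<^sub>R f') (at t within S)"
proof -
  have "((\<lambda>t. v0 + t * (v - v0)) has_vector_derivative (v - v0)) (at t)"
    unfolding has_real_derivative_iff_has_vector_derivative[symmetric] by (auto intro!: derivative_eq_intros)
  moreover have "((\<lambda>s. f (x, s)) has_vector_derivative f') (at (v0 + t * (v - v0)))"
    using assms by (simp add: has_pd_dv_iff)
  ultimately show ?thesis
    using vector_diff_chain_at has_vector_derivative_at_within unfolding o_def by blast
qed

lemma has_pd_du_segment:
  assumes "has_pd du f f' (u0 + t * (u - u0), y)"
  shows "((\<lambda>t. f (u0 + t * (u - u0), y)) has_vector_derivative (u - u0) *\<^sub>R f') (at t within S)"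
proof -
  have "((\<lambda>t. u0 + t * (u - u0)) has_vector_derivative (u - u0)) (at t)"
    unfolding has_real_derivative_iff_has_vector_derivative[symmetric] by (auto intro!: derivative_eq_intros)
  moreover have "((\<lambda>s. f (s, y)) has_vector_derivative f') (at (u0 + t * (u - u0)))"
    using assms by (simp add: has_pd_du_iff)
  ultimately show ?thesis
    using vector_diff_chain_at has_vector_derivative_at_within unfolding o_def by blast
qed

section \<open>Total differential systems\<close>

text \<open>The solution is constructed along the line \<open>v = v0\<close> and then along the lines \<open>u = const\<close>. Its
  derivative in \<open>u\<close> is the expected one because \<open>y(u + h) - y(u) - h A y(u)\<close> solves, by the
  compatibility condition, the linear equation in \<open>v\<close> up to an inhomogeneity of order \<open>o(h)\<close>.\<close>

lemma frobenius_linear: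
  fixes pr :: "'a::real_normed_vector \<Rightarrow> 'b::euclidean_space \<Rightarrow> 'b"
  assumes bil: "bounded_bilinear pr" and base: "base_domain u0 v0 D"
    and A: "Ck_on (Suc 0) D A" and B: "Ck_on (Suc 0) D B"
    and flat: "\<And>p w. p \<in> D \<Longrightarrow>
      pr (pdv A p) w + pr (A p) (pr (B p) w) = pr (pdu B p) w + pr (B p) (pr (A p) w)"
  shows "\<exists>y. y (u0, v0) = w0 \<and> continuous_on D y \<and>
    (\<forall>p\<in>D. has_pd du y (pr (A p) (y p)) p \<and> has_pd dv y (pr (B p) (y p)) p)"
proof -
  interpret bounded_bilinear pr by (rule bil)
  have openD: "open D" and uv0: "(u0, v0) \<in> D" using base by (auto simp: base_domain_def)
  have star: "(u, t) \<in> D" if "(u, v) \<in> D" "t \<in> closed_segment v0 v" for u v t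
    using base_domainD[OF base that(1) _ that(2)] by simp
  have contA: "continuous_on D A" and contB: "continuous_on D B" and contBu: "continuous_on D (pdu B)"
    using A B Ck_on_imp_continuous_on by (blast, blast, simp)
  \<comment> \<open>A dummy first coordinate turns the single equation along the line v = v0 into a
    family of equations on vertical lines, so that \<open>linear_ode_with_parameter\<close> applies;
    \<open>c\<close> is its solution for the dummy value 0.\<close>
  define D1 :: "(real \<times> real) set" where "D1 = (\<lambda>q. (snd q, v0)) -` D"
  have D1: "open D1" unfolding D1_def by (intro continuous_open_vimage openD) (intro continuous_intros)
  have "\<exists>y. continuous_on D1 y \<and> (\<forall>r. (r, u0) \<in> D1 \<longrightarrow> y (r, u0) = w0) \<and>
    (\<forall>q\<in>D1. has_pd dv y (pr (A (snd q, v0)) (y q)) q)"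
  proof (rule linear_ode_with_parameter[OF bil D1])
    show "(r, t) \<in> D1" if "(r, u) \<in> D1" "t \<in> closed_segment u0 u" for r u t
      using base_domainD[OF base] that by (simp add: D1_def)
    show "continuous_on D1 (\<lambda>q. A (snd q, v0))"
      by (intro continuous_on_compose2[OF contA]) (auto simp: D1_def intro!: continuous_intros)
  qed simp
  then obtain y1 where y1: "continuous_on D1 y1" "\<And>r. (r, u0) \<in> D1 \<Longrightarrow> y1 (r, u0) = w0"
    "\<And>q. q \<in> D1 \<Longrightarrow> has_pd dv y1 (pr (A (snd q, v0)) (y1 q)) q" by blast
  define c where "c = (\<lambda>u. y1 (0, u))"
  have c0: "c u0 = w0" using y1(2)[of 0] uv0 by (simp add: c_def D1_def)
  have dc: "(c has_vector_derivative pr (A (u, v0)) (c u)) (at u)" if "(u, v0) \<in> D" for u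
    using y1(3)[of "(0, u)"] that by (simp add: c_def D1_def has_pd_dv_iff)
  have contc: "continuous_on {u. (u, v0) \<in> D} c"
    unfolding c_def by (intro continuous_on_compose2[OF y1(1)]) (auto simp: D1_def intro!: continuous_intros)
  obtain y where conty: "continuous_on D y" and yc: "\<And>u. (u, v0) \<in> D \<Longrightarrow> y (u, v0) = c u"
    and yv: "\<And>p. p \<in> D \<Longrightarrow> has_pd dv y (pr (B p) (y p)) p"
  proof -
    have "\<exists>y. continuous_on D y \<and> (\<forall>u. (u, v0) \<in> D \<longrightarrow> y (u, v0) = c u) \<and>
      (\<forall>p\<in>D. has_pd dv y (pr (B p) (y p)) p)"
      by (rule linear_ode_with_parameter[OF bil openD _ contB contc]) (rule star)
    then show thesis using that by blast
  qed
  obtain K where K: "K > 0" "\<And>a b. norm (pr a b) \<le> norm a * norm b * K" using pos_bounded by blast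
  have "has_pd du y (pr (A p) (y p)) p" if pD: "p \<in> D" for p
  proof -
    obtain u v where p: "p = (u, v)" by (cases p)
    obtain d where d: "d > 0" and dD: "{u - d..u + d} \<times> {v - d..v + d} \<subseteq> D"
      using open_contains_rectangle[OF openD] pD p by blast
    \<comment> \<open>Compact because only u varies around the point while v runs over the segment
      back to v0; boundedness and uniform continuity of the coefficients and of \<open>y\<close> are
      used on this set.\<close>
    define R where "R = {u - d..u + d} \<times> closed_segment v0 v"
    have RD: "R \<subseteq> D"
    proof
      fix q assume "q \<in> R"
      then have "(fst q, v) \<in> D" "snd q \<in> closed_segment v0 v" using dD d by (auto simp: R_def)
      then show "q \<in> D" using star by (metis prod.collapse)
    qed
    have cR: "compact R" unfolding R_def by (intro compact_Times) auto
    have bnd: "\<exists>C\<ge>0. \<forall>q\<in>R. norm (f q) \<le> C" if "continuous_on D f" for f :: "real \<times> real \<Rightarrow> 'c::real_normed_vector"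
    proof -
      have "bounded (f ` R)"
        using that cR RD by (meson compact_continuous_image compact_imp_bounded continuous_on_subset)
      then obtain C where "\<forall>q\<in>R. norm (f q) \<le> C" by (auto simp: bounded_iff)
      then show ?thesis by (intro exI[of _ "\<bar>C\<bar>"]) fastforce
    qed
    obtain M where M: "M \<ge> 0" "\<And>q. q \<in> R \<Longrightarrow> norm (B q) \<le> M" using bnd[OF contB] by blast
    obtain C1 where C1: "C1 \<ge> 0" "\<And>q. q \<in> R \<Longrightarrow> norm (pdu B q) \<le> C1" using bnd[OF contBu] by blast
    obtain C2 where C2: "C2 \<ge> 0" "\<And>q. q \<in> R \<Longrightarrow> norm (y q) \<le> C2" using bnd[OF conty] by blast
    \<comment> \<open>Chosen for the remainder \<open>w\<close> below: |w'| \<le> M' |w| +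
      \<epsilon> Q |h| and |w 0| \<le> \<epsilon> |h|, so Gronwall yields |w 1|^2 \<le> E
      \<epsilon>^2 h^2.\<close>
    define M' Q E where "M' = \<bar>v - v0\<bar> * (M * K)" and "Q = \<bar>v - v0\<bar> * (K * (C1 + 1 + C2))"
      and "E = exp (2 * M' + 1) * (1 + Q\<^sup>2)"
    have M': "M' \<ge> 0" and Q: "Q \<ge> 0" using M(1) K(1) C1(1) C2(1) by (auto simp: M'_def Q_def)
    have E: "E > 0" by (auto simp: E_def intro!: mult_pos_pos add_pos_nonneg)
    have uc: "\<exists>\<delta>>0. \<forall>q\<in>R. \<forall>q'\<in>R. dist q' q < \<delta> \<longrightarrow> norm (f q' - f q) < \<epsilon>"
      if "continuous_on D f" "\<epsilon> > 0" for f :: "real \<times> real \<Rightarrow> 'c::real_normed_vector" and \<epsilon> :: real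
    proof -
      have "uniformly_continuous_on R f"
        using that(1) cR RD compact_uniformly_continuous continuous_on_subset by blast
      then show ?thesis using that(2) unfolding uniformly_continuous_on_def dist_norm[where 'a='c] by blast
    qed
    have uR: "(u, s) \<in> R" if "s \<in> closed_segment v0 v" for s using that d by (auto simp: R_def)
    let ?X = "pr (A p) (y p)"
    have "\<exists>\<delta>>0. \<forall>x. norm (x - u) < \<delta> \<longrightarrow> norm (y (x, v) - y (u, v) - (x - u) *\<^sub>R ?X) \<le> e * norm (x - u)"
      if e: "e > 0" for e :: real
    proof -
      \<comment> \<open>The factor sqrt E is the loss in Gronwall's estimate; the bound by 1 lets
        the increment of \<open>B\<close> be estimated by (C1 + 1) |h| independently of
        \<epsilon>.\<close>
      define \<epsilon> where "\<epsilon> = min 1 (e / sqrt E)"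
      have \<epsilon>: "\<epsilon> > 0" "\<epsilon> \<le> 1" "\<epsilon> * sqrt E \<le> e" using e E by (auto simp: \<epsilon>_def min_def field_simps)
      obtain \<delta>1 where \<delta>1: "\<delta>1 > 0" "\<And>q q'. q \<in> R \<Longrightarrow> q' \<in> R \<Longrightarrow> dist q' q < \<delta>1 \<Longrightarrow> norm (y q' - y q) < \<epsilon>"
        using uc[OF conty \<epsilon>(1)] by blast
      obtain \<delta>2 where \<delta>2: "\<delta>2 > 0" "\<And>q q'. q \<in> R \<Longrightarrow> q' \<in> R \<Longrightarrow> dist q' q < \<delta>2 \<Longrightarrow> norm (pdu B q' - pdu B q) < \<epsilon>"
        using uc[OF contBu \<epsilon>(1)] by blast
      have "(u, v0) \<in> D" using RD uR by blast
      from dc[OF this] obtain \<delta>3 where \<delta>3: "\<delta>3 > 0"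
        "\<And>x. norm (x - u) < \<delta>3 \<Longrightarrow> norm (c x - c u - (x - u) *\<^sub>R pr (A (u, v0)) (c u)) \<le> \<epsilon> * norm (x - u)"
        unfolding has_vector_derivative_def has_derivative_at_alt using \<epsilon>(1) by blast
      define \<delta> where "\<delta> = min (min \<delta>1 \<delta>2) (min \<delta>3 d)"
      have "norm (y (x, v) - y (u, v) - (x - u) *\<^sub>R ?X) \<le> e * norm (x - u)" if x: "norm (x - u) < \<delta>" for x
      proof -
        define h where "h = x - u"
        have xR: "(x', s) \<in> R" if "s \<in> closed_segment v0 v" "x' \<in> closed_segment u x" for s x'
          using that x by (auto simp: R_def \<delta>_def closed_segment_eq_real_ivl split: if_splits)
        define \<Delta> where "\<Delta> = (\<lambda>s. B (x, s) - B (u, s))"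
        have lin: "norm (\<Delta> s - h *\<^sub>R pdu B (u, s)) \<le> \<epsilon> * \<bar>h\<bar>" if s: "s \<in> closed_segment v0 v" for s
        proof -
          have "norm (B (x, s) - B (u, s) - (x - u) *\<^sub>R pdu B (u, s)) \<le> norm (x - u) * \<epsilon>"
          proof (rule vector_differentiable_bound_linearization[where S="closed_segment u x" and f'="\<lambda>t. pdu B (t, s)"])
            fix t assume t: "t \<in> closed_segment u x"
            have "(t, s) \<in> D" using xR[OF s t] RD by blast
            from Ck_on_Suc_has_pd(1)[OF openD B this]
            show "((\<lambda>t. B (t, s)) has_vector_derivative pdu B (t, s)) (at t within closed_segment u x)"
              by (simp add: has_pd_du_iff has_vector_derivative_at_within)
            have "\<bar>t - u\<bar> \<le> \<bar>x - u\<bar>" using t by (auto simp: closed_segment_eq_real_ivl split: if_splits)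
            then have "dist (t, s) (u, s) < \<delta>2" using x by (simp add: \<delta>_def dist_Pair_Pair dist_real_def)
            then show "norm (pdu B (t, s) - pdu B (u, s)) \<le> \<epsilon>"
              using \<delta>2(2)[OF uR[OF s] xR[OF s t]] by simp
          qed auto
          then show ?thesis by (simp add: h_def \<Delta>_def mult.commute)
        qed
        define l where "l = (\<lambda>t. v0 + t * (v - v0))"
        have l: "l t \<in> closed_segment v0 v" if "t \<in> {0..1}" for t
          unfolding l_def using that by (rule real_segment_memI)
        define w where "w = (\<lambda>t. y (x, l t) - y (u, l t) - h *\<^sub>R pr (A (u, l t)) (y (u, l t)))"
        define w' where "w' = (\<lambda>t. (v - v0) *\<^sub>R (pr (B (x, l t)) (y (x, l t)) - pr (B (u, l t)) (y (u, l t))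
            - h *\<^sub>R (pr (A (u, l t)) (pr (B (u, l t)) (y (u, l t))) + pr (pdv A (u, l t)) (y (u, l t)))))"
        have "(norm (w 1))\<^sup>2 \<le> exp (2 * M' + 1) * ((norm (w 0))\<^sup>2 + (\<epsilon> * Q * \<bar>h\<bar>)\<^sup>2)"
        proof (rule gronwall_squared[OF M', where w'=w'])
          show "0 \<le> \<epsilon> * Q * \<bar>h\<bar>" using \<epsilon>(1) Q by simp
          fix t :: real assume t: "t \<in> {0..1}"
          define s where "s = l t"
          have s: "s \<in> closed_segment v0 v" using l[OF t] by (simp add: s_def)
          have xs: "(x, s) \<in> R" and us: "(u, s) \<in> R" using xR[OF s] uR[OF s] by auto
          have 1: "has_pd dv y (pr (B (x, l t)) (y (x, l t))) (x, l t)"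
            and 2: "has_pd dv y (pr (B (u, l t)) (y (u, l t))) (u, l t)"
            and 3: "has_pd dv A (pdv A (u, l t)) (u, l t)"
            using yv Ck_on_Suc_has_pd(2)[OF openD A] xs us RD by (auto simp: s_def)
          have "((\<lambda>t. y (x, l t) - y (u, l t) - h *\<^sub>R pr (A (u, l t)) (y (u, l t))) has_vector_derivative
              (v - v0) *\<^sub>R pr (B (x, l t)) (y (x, l t)) - (v - v0) *\<^sub>R pr (B (u, l t)) (y (u, l t))
              - h *\<^sub>R ((v - v0) *\<^sub>R (pr (A (u, l t)) (pr (B (u, l t)) (y (u, l t))) + pr (pdv A (u, l t)) (y (u, l t)))))
              (at t within {0..1})"
            unfolding l_def
            by (intro has_vector_derivative_diff bounded_linear.has_vector_derivative[OF bounded_linear_scaleR_right]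
                has_pd_dv_segment[OF 1[unfolded l_def]] has_pd_dv_segment[OF 2[unfolded l_def]]
                has_pd_dv_segment[OF has_pd_bilinear[OF bil 3 2, unfolded l_def]])
          then show "(w has_vector_derivative w' t) (at t within {0..1})"
            unfolding w_def w'_def by (simp add: algebra_simps)
          \<comment> \<open>The compatibility condition trades the v-derivative of A y for B_u y + B
            A y. The terms of first order in h then cancel, leaving B w, a product of two small
            increments, and the linearization error of \<open>B\<close> applied to y.\<close>
          have "pr (A (u, s)) (pr (B (u, s)) (y (u, s))) + pr (pdv A (u, s)) (y (u, s))
              = pr (pdu B (u, s)) (y (u, s)) + pr (B (u, s)) (pr (A (u, s)) (y (u, s)))"
            using flat[of "(u, s)" "y (u, s)"] us RD by (auto simp: add.commute)
          then have w't: "w' t = (v - v0) *\<^sub>R (pr (B (u, s)) (w t) + pr (\<Delta> s) (y (x, s) - y (u, s)) +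
              pr (\<Delta> s - h *\<^sub>R pdu B (u, s)) (y (u, s)))"
            unfolding w'_def w_def s_def[symmetric] \<Delta>_def
            by (simp add: diff_left diff_right add_right add_left scaleR_left scaleR_right algebra_simps)
          have n\<Delta>: "norm (\<Delta> s) \<le> (C1 + 1) * \<bar>h\<bar>"
          proof -
            have "norm (\<Delta> s) \<le> norm (\<Delta> s - h *\<^sub>R pdu B (u, s)) + norm (h *\<^sub>R pdu B (u, s))"
              by (metis diff_add_cancel norm_triangle_ineq)
            also have "\<dots> \<le> \<epsilon> * \<bar>h\<bar> + \<bar>h\<bar> * C1"
              using lin[OF s] C1(2)[OF us] by (intro add_mono) (auto intro: mult_left_mono)
            also have "\<dots> \<le> 1 * \<bar>h\<bar> + \<bar>h\<bar> * C1"
              using mult_right_mono[OF \<epsilon>(2), of "\<bar>h\<bar>"] by simp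
            finally show ?thesis by (simp add: algebra_simps)
          qed
          have ny: "norm (y (x, s) - y (u, s)) \<le> \<epsilon>"
            using \<delta>1(2)[OF us xs] x by (simp add: \<delta>_def dist_Pair_Pair dist_real_def less_imp_le)
          have "norm (pr (B (u, s)) (w t) + pr (\<Delta> s) (y (x, s) - y (u, s)) + pr (\<Delta> s - h *\<^sub>R pdu B (u, s)) (y (u, s)))
            \<le> norm (pr (B (u, s)) (w t)) + norm (pr (\<Delta> s) (y (x, s) - y (u, s))) + norm (pr (\<Delta> s - h *\<^sub>R pdu B (u, s)) (y (u, s)))"
            by (intro order_trans[OF norm_triangle_ineq] add_mono order_refl norm_triangle_ineq)
          also have "\<dots> \<le> M * norm (w t) * K + ((C1 + 1) * \<bar>h\<bar>) * \<epsilon> * K + (\<epsilon> * \<bar>h\<bar>) * C2 * K"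
            using K(1) M C1(1) C2 n\<Delta> ny lin[OF s] us \<epsilon>(1)
            by (intro add_mono order_trans[OF K(2)] mult_right_mono mult_mono) auto
          finally have "norm (w' t) \<le> \<bar>v - v0\<bar> * (M * norm (w t) * K + ((C1 + 1) * \<bar>h\<bar>) * \<epsilon> * K + (\<epsilon> * \<bar>h\<bar>) * C2 * K)"
            unfolding w't norm_scaleR real_norm_def by (rule mult_left_mono) simp
          then show "norm (w' t) \<le> M' * norm (w t) + \<epsilon> * Q * \<bar>h\<bar>"
            unfolding M'_def Q_def by (simp add: algebra_simps)
        qed simp
        also have "norm (w 0) \<le> \<epsilon> * \<bar>h\<bar>"
        proof -
          have "(x, v0) \<in> D" "(u, v0) \<in> D" using xR[of v0 x] uR[of v0] RD by auto
          then show ?thesis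
            using \<delta>3(2)[of x] x yc[of x] yc[of u] by (simp add: w_def l_def h_def \<delta>_def)
        qed
        then have "exp (2 * M' + 1) * ((norm (w 0))\<^sup>2 + (\<epsilon> * Q * \<bar>h\<bar>)\<^sup>2) \<le> exp (2 * M' + 1) * ((\<epsilon> * \<bar>h\<bar>)\<^sup>2 + (\<epsilon> * Q * \<bar>h\<bar>)\<^sup>2)"
          by (intro mult_left_mono add_right_mono power_mono) auto
        also have "\<dots> = E * \<epsilon>\<^sup>2 * h\<^sup>2" by (simp add: E_def power_mult_distrib algebra_simps)
        also have "\<dots> = (sqrt E * \<epsilon> * \<bar>h\<bar>)\<^sup>2" using E by (simp add: power_mult_distrib)
        finally have "norm (w 1) \<le> sqrt E * \<epsilon> * \<bar>h\<bar>"
          by (rule power2_le_imp_le) (use E \<epsilon>(1) in auto)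
        also have "\<dots> \<le> e * \<bar>h\<bar>" using \<epsilon>(3) by (intro mult_right_mono) (auto simp: mult.commute)
        finally show ?thesis by (simp add: w_def l_def h_def p)
      qed
      moreover have "\<delta> > 0" using \<delta>1 \<delta>2 \<delta>3 d by (simp add: \<delta>_def)
      ultimately show ?thesis by blast
    qed
    then have "((\<lambda>x. y (x, v)) has_vector_derivative ?X) (at u)"
      unfolding has_vector_derivative_def has_derivative_at_alt by (auto intro: bounded_linear_scaleR_left)
    then show ?thesis by (simp add: has_pd_du_iff p)
  qed
  moreover have "y (u0, v0) = w0" using yc[OF uv0] c0 by simp
  ultimately show ?thesis using conty yv by blast
qed

section \<open>Uniqueness for the characteristic problem\<close>

text \<open>Integrating an exponential of rate L gains a factor 1/L. The shift \<open>k\<close>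
  carries the coordinate that is held fixed in the application.\<close>

lemma exp_weighted_bound:
  fixes h :: "real \<Rightarrow> real"
  assumes "L > 0" "C \<ge> 0" "h 0 = 0" "t \<in> {0..1}"
    and deriv: "\<And>s. s \<in> {0..1} \<Longrightarrow> (h has_vector_derivative h' s) (at s)"
    and bound: "\<And>s. s \<in> {0..1} \<Longrightarrow> \<bar>h' s\<bar> \<le> C * exp (L * (k + s))"
  shows "\<bar>h t\<bar> \<le> C / L * exp (L * (k + t))"
proof (cases "t = 0")
  case True
  then show ?thesis using assms(1-3) by simp
next
  case False
  define \<phi> where "\<phi> = (\<lambda>s. C / L * exp (L * (k + s)))"
  have "norm (h t - h 0) \<le> \<phi> t - \<phi> 0"
  proof (rule differentiable_bound_general)
    show "0 < t" using False assms(4) by simp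
    show "continuous_on {0..t} h"
    proof (intro continuous_at_imp_continuous_on ballI)
      fix x assume "x \<in> {0..t}"
      then show "isCont h x" using has_vector_derivative_continuous[OF deriv] assms(4) by simp
    qed
    show "continuous_on {0..t} \<phi>" unfolding \<phi>_def by (intro continuous_intros)
    fix s assume s: "0 < s" "s < t"
    show "(h has_vector_derivative h' s) (at s)" using deriv s assms(4) by simp
    show "(\<phi> has_vector_derivative C * exp (L * (k + s))) (at s)"
      unfolding \<phi>_def has_real_derivative_iff_has_vector_derivative[symmetric]
      using assms(1) by (auto intro!: derivative_eq_intros)
    show "norm (h' s) \<le> C * exp (L * (k + s))" using bound s assms(4) by simp
  qed
  moreover have "\<phi> 0 \<ge> 0" using assms(1,2) by (simp add: \<phi>_def)
  ultimately show ?thesis using assms(3) by (simp add: \<phi>_def)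
qed

text \<open>A contraction argument in an exponentially weighted sup norm. If N is the maximum of
  exp(-L(s+t)) (|f| + |g|) over the rescaled rectangle, integrating both equations from the axes
  gives N \<le> (2M/L) N, which forces N = 0 once L > 2M.\<close>

lemma characteristic_problem_zero:
  fixes f g a1 a2 a3 a4 :: "real \<times> real \<Rightarrow> real"
  assumes base: "base_domain u0 v0 D"
    and cont: "continuous_on D f" "continuous_on D g" "continuous_on D a1" "continuous_on D a2"
      "continuous_on D a3" "continuous_on D a4"
    and fv: "\<And>p. p \<in> D \<Longrightarrow> has_pd dv f (a1 p * f p + a2 p * g p) p"
    and gu: "\<And>p. p \<in> D \<Longrightarrow> has_pd du g (a3 p * f p + a4 p * g p) p"
    and f0: "\<And>u. (u, v0) \<in> D \<Longrightarrow> f (u, v0) = 0" and g0: "\<And>v. (u0, v) \<in> D \<Longrightarrow> g (u0, v) = 0"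
    and "p \<in> D"
  shows "f p = 0 \<and> g p = 0"
proof -
  obtain u v where p: "p = (u, v)" by (cases p)
  \<comment> \<open>Mapping the unit square onto the rectangle between base point and
    \<open>p\<close> removes the dependence on the signs of u - u0 and v - v0.\<close>
  define r where "r = (\<lambda>q. (u0 + fst q * (u - u0), v0 + snd q * (v - v0)) :: real \<times> real)"
  define Q where "Q = {0..1::real} \<times> {0..1::real}"
  have rD: "r q \<in> D" if "q \<in> Q" for q
    using base_domainD[OF base \<open>p \<in> D\<close>[unfolded p] real_segment_memI real_segment_memI] that
    by (auto simp: r_def Q_def)
  have cQ: "compact Q" unfolding Q_def by (intro compact_Times) auto
  have cont_r: "continuous_on Q (\<lambda>q. k (r q))" if "continuous_on D k" for k :: "real \<times> real \<Rightarrow> real"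
    using rD by (intro continuous_on_compose2[OF that]) (auto simp: r_def intro!: continuous_intros)
  have bnd: "\<exists>C\<ge>0. \<forall>q\<in>Q. \<bar>k (r q)\<bar> \<le> C" if "continuous_on D k" for k :: "real \<times> real \<Rightarrow> real"
  proof -
    have "bounded ((\<lambda>q. k (r q)) ` Q)"
      using cont_r[OF that] cQ by (meson compact_continuous_image compact_imp_bounded)
    then obtain C where "\<forall>q\<in>Q. \<bar>k (r q)\<bar> \<le> C" by (auto simp: bounded_iff)
    then show ?thesis by (intro exI[of _ "\<bar>C\<bar>"]) fastforce
  qed
  obtain C1 C2 C3 C4 where C: "C1 \<ge> 0" "\<And>q. q \<in> Q \<Longrightarrow> \<bar>a1 (r q)\<bar> \<le> C1"
    "C2 \<ge> 0" "\<And>q. q \<in> Q \<Longrightarrow> \<bar>a2 (r q)\<bar> \<le> C2" "C3 \<ge> 0" "\<And>q. q \<in> Q \<Longrightarrow> \<bar>a3 (r q)\<bar> \<le> C3"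
    "C4 \<ge> 0" "\<And>q. q \<in> Q \<Longrightarrow> \<bar>a4 (r q)\<bar> \<le> C4"
    using bnd[OF cont(3)] bnd[OF cont(4)] bnd[OF cont(5)] bnd[OF cont(6)] by metis
  \<comment> \<open>\<open>M\<close> bounds each coefficient times the side length introduced by the
    rescaling; L = 2M + 1 makes the contraction factor smaller than 1.\<close>
  define M L where "M = (\<bar>u - u0\<bar> + \<bar>v - v0\<bar>) * (C1 + C2 + C3 + C4)" and "L = 2 * M + 1"
  have M: "M \<ge> 0" using C by (simp add: M_def)
  have L: "L > 0" using M by (simp add: L_def)
  define m where "m = (\<lambda>q. exp (- (L * (fst q + snd q))) * (\<bar>f (r q)\<bar> + \<bar>g (r q)\<bar>))"
  have "continuous_on Q m" unfolding m_def by (intro continuous_intros cont_r cont)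
  then obtain qm where qm: "qm \<in> Q" "\<And>q. q \<in> Q \<Longrightarrow> m q \<le> m qm"
    using continuous_attains_sup[OF cQ] unfolding Q_def by (metis SigmaI atLeastAtMost_iff empty_iff order_refl zero_le_one)
  define N where "N = m qm"
  have N: "N \<ge> 0" by (simp add: N_def m_def)
  have sum_le: "\<bar>f (r q)\<bar> + \<bar>g (r q)\<bar> \<le> N * exp (L * (fst q + snd q))" if "q \<in> Q" for q
  proof -
    have "exp (- (L * (fst q + snd q))) * (\<bar>f (r q)\<bar> + \<bar>g (r q)\<bar>) \<le> N" using qm(2)[OF that] by (simp add: N_def m_def)
    then have "exp (L * (fst q + snd q)) * (exp (- (L * (fst q + snd q))) * (\<bar>f (r q)\<bar> + \<bar>g (r q)\<bar>)) \<le> exp (L * (fst q + snd q)) * N"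
      by (rule mult_left_mono) simp
    then show ?thesis by (simp add: mult.assoc[symmetric] exp_add[symmetric] mult.commute)
  qed
  have rhs: "\<bar>k * (b1 * f (r q) + b2 * g (r q))\<bar> \<le> M * N * exp (L * (fst q + snd q))"
    if q: "q \<in> Q" and b: "\<bar>b1\<bar> \<le> C1 + C2 + C3 + C4" "\<bar>b2\<bar> \<le> C1 + C2 + C3 + C4" and k: "\<bar>k\<bar> \<le> \<bar>u - u0\<bar> + \<bar>v - v0\<bar>" for q b1 b2 k
  proof -
    have "\<bar>b1 * f (r q) + b2 * g (r q)\<bar> \<le> \<bar>b1\<bar> * \<bar>f (r q)\<bar> + \<bar>b2\<bar> * \<bar>g (r q)\<bar>"
      by (metis abs_mult abs_triangle_ineq)
    also have "\<dots> \<le> (C1 + C2 + C3 + C4) * \<bar>f (r q)\<bar> + (C1 + C2 + C3 + C4) * \<bar>g (r q)\<bar>"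
      using b by (intro add_mono mult_right_mono) auto
    also have "\<dots> = (C1 + C2 + C3 + C4) * (\<bar>f (r q)\<bar> + \<bar>g (r q)\<bar>)" by (simp add: algebra_simps)
    finally have "\<bar>k * (b1 * f (r q) + b2 * g (r q))\<bar> \<le> (\<bar>u - u0\<bar> + \<bar>v - v0\<bar>) * ((C1 + C2 + C3 + C4) * (\<bar>f (r q)\<bar> + \<bar>g (r q)\<bar>))"
      unfolding abs_mult using k by (intro mult_mono) auto
    also have "\<dots> = M * (\<bar>f (r q)\<bar> + \<bar>g (r q)\<bar>)" by (simp add: M_def)
    also have "\<dots> \<le> M * (N * exp (L * (fst q + snd q)))" using M sum_le[OF q] by (intro mult_left_mono) auto
    finally show ?thesis by simp
  qed
  obtain \<sigma> \<tau> where qm_eq: "qm = (\<sigma>, \<tau>)" and st: "\<sigma> \<in> {0..1}" "\<tau> \<in> {0..1}" using qm(1) by (auto simp: Q_def)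
  have "\<bar>f (r (\<sigma>, \<tau>))\<bar> \<le> M * N / L * exp (L * (\<sigma> + \<tau>))"
  proof (rule exp_weighted_bound[OF L, of _ "\<lambda>t. f (r (\<sigma>, t))" _ "\<lambda>s. (v - v0) * (a1 (r (\<sigma>, s)) * f (r (\<sigma>, s)) + a2 (r (\<sigma>, s)) * g (r (\<sigma>, s)))"])
    show "f (r (\<sigma>, 0)) = 0" using f0 rD[of "(\<sigma>, 0)"] st by (simp add: r_def Q_def)
    fix s :: real assume s: "s \<in> {0..1}"
    then have q: "(\<sigma>, s) \<in> Q" using st by (simp add: Q_def)
    show "((\<lambda>t. f (r (\<sigma>, t))) has_vector_derivative (v - v0) * (a1 (r (\<sigma>, s)) * f (r (\<sigma>, s)) + a2 (r (\<sigma>, s)) * g (r (\<sigma>, s)))) (at s)"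
      using has_pd_dv_segment[OF fv[OF rD[OF q], unfolded r_def fst_conv snd_conv], of UNIV] by (simp add: r_def)
    show "\<bar>(v - v0) * (a1 (r (\<sigma>, s)) * f (r (\<sigma>, s)) + a2 (r (\<sigma>, s)) * g (r (\<sigma>, s)))\<bar> \<le> M * N * exp (L * (\<sigma> + s))"
      using rhs[OF q, of "a1 (r (\<sigma>, s))" "a2 (r (\<sigma>, s))" "v - v0"] C(1,3,5,7) C(2)[OF q] C(4)[OF q] by simp
  qed (use M N st in auto)
  moreover have "\<bar>g (r (\<sigma>, \<tau>))\<bar> \<le> M * N / L * exp (L * (\<tau> + \<sigma>))"
  proof (rule exp_weighted_bound[OF L, of _ "\<lambda>t. g (r (t, \<tau>))" _ "\<lambda>s. (u - u0) * (a3 (r (s, \<tau>)) * f (r (s, \<tau>)) + a4 (r (s, \<tau>)) * g (r (s, \<tau>)))"])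
    show "g (r (0, \<tau>)) = 0" using g0 rD[of "(0, \<tau>)"] st by (simp add: r_def Q_def)
    fix s :: real assume s: "s \<in> {0..1}"
    then have q: "(s, \<tau>) \<in> Q" using st by (simp add: Q_def)
    show "((\<lambda>t. g (r (t, \<tau>))) has_vector_derivative (u - u0) * (a3 (r (s, \<tau>)) * f (r (s, \<tau>)) + a4 (r (s, \<tau>)) * g (r (s, \<tau>)))) (at s)"
      using has_pd_du_segment[OF gu[OF rD[OF q], unfolded r_def fst_conv snd_conv], of UNIV] by (simp add: r_def)
    show "\<bar>(u - u0) * (a3 (r (s, \<tau>)) * f (r (s, \<tau>)) + a4 (r (s, \<tau>)) * g (r (s, \<tau>)))\<bar> \<le> M * N * exp (L * (\<tau> + s))"
      using rhs[OF q, of "a3 (r (s, \<tau>))" "a4 (r (s, \<tau>))" "u - u0"] C(1,3,5,7) C(6)[OF q] C(8)[OF q] by (simp add: add.commute)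
  qed (use M N st in auto)
  ultimately have "\<bar>f (r qm)\<bar> + \<bar>g (r qm)\<bar> \<le> 2 * (M * N / L) * exp (L * (\<sigma> + \<tau>))"
    by (simp add: qm_eq add.commute)
  then have "m qm \<le> exp (- (L * (\<sigma> + \<tau>))) * (2 * (M * N / L) * exp (L * (\<sigma> + \<tau>)))"
    unfolding m_def qm_eq fst_conv snd_conv by (intro mult_left_mono) auto
  also have "\<dots> = 2 * (M * N / L) * (exp (L * (\<sigma> + \<tau>)) * exp (- (L * (\<sigma> + \<tau>))))" by (simp only: ac_simps)
  also have "\<dots> = 2 * (M * N / L)" by (simp only: exp_minus_inverse mult_1_right)
  finally have "N \<le> 2 * (M * N / L)" by (simp add: N_def)
  then have "N * L \<le> 2 * M * N" using L by (simp add: field_simps)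
  then have "N \<le> 0" by (simp add: L_def algebra_simps)
  then have "m (1, 1) \<le> 0" using qm(2)[of "(1, 1)"] by (simp add: N_def Q_def)
  then have "\<bar>f (r (1, 1))\<bar> + \<bar>g (r (1, 1))\<bar> \<le> 0" unfolding m_def by (simp add: mult_le_0_iff)
  then have "f (r (1, 1)) = 0 \<and> g (r (1, 1)) = 0" by linarith
  then show ?thesis by (simp add: r_def p)
qed

section \<open>Null frames\<close>

definition null_frame :: "real^4 \<Rightarrow> real^4 \<Rightarrow> real^4 \<Rightarrow> real^4 \<Rightarrow> bool" where
  "null_frame x y n m \<longleftrightarrow> mink x x = 1 \<and> mink y y = 1 \<and> mink x y = 0 \<and> mink x n = 0 \<and> mink x m = 0 \<and>
     mink y n = 0 \<and> mink y m = 0 \<and> mink n n = 0 \<and> mink m m = 0 \<and> mink n m = - 1"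

lemma null_frameD:
  assumes "null_frame x y n m"
  shows "mink x x = 1" "mink y y = 1" "mink x y = 0" "mink y x = 0" "mink x n = 0" "mink n x = 0"
    "mink x m = 0" "mink m x = 0" "mink y n = 0" "mink n y = 0" "mink y m = 0" "mink m y = 0"
    "mink n n = 0" "mink m m = 0" "mink n m = - 1" "mink m n = - 1"
  using assms mink_commute[of y x] mink_commute[of n x] mink_commute[of m x] mink_commute[of n y]
    mink_commute[of m y] mink_commute[of m n] by (auto simp: null_frame_def)

lemma vector_4:
  "(vector [r, s, t, w] :: 'a::zero^4) $ 1 = r" "(vector [r, s, t, w] :: 'a^4) $ 2 = s"
  "(vector [r, s, t, w] :: 'a^4) $ 3 = t" "(vector [r, s, t, w] :: 'a^4) $ 4 = w"
  unfolding vector_def by simp_all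

text \<open>With \<open>L\<close> taking coordinates and \<open>S\<close> forming combinations, the
  Gram relations say L S = 1 and the expansion says S L = 1; for linear maps of a finite-dimensional
  space to itself these are equivalent. In this form the frame property is an identity of operators
  and can be propagated by constancy.\<close>

lemma null_frame_iff_expansion:
  "null_frame x y n m \<longleftrightarrow>
    (\<forall>w. mink x w *\<^sub>R x + mink y w *\<^sub>R y - mink m w *\<^sub>R n - mink n w *\<^sub>R m = w)"
proof -
  define L :: "real^4 \<Rightarrow> real^4" where "L = (\<lambda>w. vector [mink x w, mink y w, - mink m w, - mink n w])"
  define S :: "real^4 \<Rightarrow> real^4" where "S = (\<lambda>c. c$1 *\<^sub>R x + c$2 *\<^sub>R y + c$3 *\<^sub>R n + c$4 *\<^sub>R m)"
  have "linear L"
    by (rule linearI) (auto simp: L_def vec_eq_iff forall_4 vector_4 mink_simps)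
  moreover have "linear S"
    by (rule linearI) (auto simp: S_def algebra_simps)
  ultimately have LS: "L \<circ> S = id \<longleftrightarrow> S \<circ> L = id" by (rule linear_inverse_left)
  have SL: "S (L w) = mink x w *\<^sub>R x + mink y w *\<^sub>R y - mink m w *\<^sub>R n - mink n w *\<^sub>R m" for w
    by (simp add: S_def L_def vector_4)
  have "null_frame x y n m \<longleftrightarrow> L \<circ> S = id"
  proof
    assume "null_frame x y n m"
    note f = null_frameD[OF this]
    show "L \<circ> S = id"
      by (rule ext) (simp add: S_def L_def vec_eq_iff forall_4 vector_4 mink_simps f)
  next
    assume "L \<circ> S = id"
    then have id: "L (S c) = c" for c by (metis comp_apply id_apply)
    have "S (vector [1, 0, 0, 0]) = x" "S (vector [0, 1, 0, 0]) = y"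
      "S (vector [0, 0, 1, 0]) = n" "S (vector [0, 0, 0, 1]) = m"
      by (simp_all add: S_def vector_4)
    then have "L x = vector [1, 0, 0, 0]" "L y = vector [0, 1, 0, 0]"
      "L n = vector [0, 0, 1, 0]" "L m = vector [0, 0, 0, 1]"
      using id by metis+
    then show "null_frame x y n m"
      unfolding null_frame_def L_def by (simp add: vec_eq_iff forall_4 vector_4 mink_commute)
  qed
  then show ?thesis using SL LS by (auto simp: fun_eq_iff)
qed

lemmas null_frame_expansion = null_frame_iff_expansion[THEN iffD1, rule_format]

text \<open>\<open>n2\<close> is a definite description. Any competitor has the form m - c n, and
  its square 2c must vanish.\<close>

lemma n2_eqI:
  assumes f: "null_frame x y n m" and z: "pdu z p = \<alpha> *\<^sub>R x" "pdv z p = \<beta> *\<^sub>R y" "\<alpha> \<noteq> 0" "\<beta> \<noteq> 0"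
    and n: "mean_curv z p = n"
  shows "n2 z p = m"
  unfolding n2_def n
proof (rule the_equality)
  show "normal_vector z p m \<and> mink m m = 0 \<and> mink n m = - 1"
    using null_frameD[OF f] z by (simp add: normal_vector_def mink_simps)
  fix k assume k: "normal_vector z p k \<and> mink k k = 0 \<and> mink n k = - 1"
  then have xy: "mink x k = 0" "mink y k = 0"
    using z mink_commute by (auto simp: normal_vector_def mink_simps)
  define c where "c = mink m k"
  have k_eq: "k = m - c *\<^sub>R n" using null_frame_expansion[OF f, of k] k xy by (simp add: c_def)
  have "mink (m - c *\<^sub>R n) (m - c *\<^sub>R n) = 2 * c" by (simp add: mink_simps null_frameD[OF f])
  then have "c = 0" using k unfolding k_eq by simp
  then show "k = m" using k_eq by simp
qed

section \<open>The structure equations\<close>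

text \<open>The analytic data without any surface, shared by existence and uniqueness.
  \<open>P\<close> and \<open>Q\<close> are the prospective values of sqrt E and sqrt G, hence
  positive.\<close>

locale structure_data =
  fixes D :: "(real \<times> real) set" and u0 v0 :: real and \<nu> lam \<mu> P Q :: "real \<times> real \<Rightarrow> real"
  assumes base: "base_domain u0 v0 D"
    and smooth_data: "smooth_on D \<nu>" "smooth_on D lam" "smooth_on D \<mu>" "smooth_on D P" "smooth_on D Q"
    and mu_nz: "\<And>p. p \<in> D \<Longrightarrow> \<mu> p \<noteq> 0"
    and disc_nz: "\<And>p. p \<in> D \<Longrightarrow> 4 * (\<nu> p)\<^sup>2 + 4 * (lam p)\<^sup>2 - 1 \<noteq> 0"
    and P_pos: "\<And>p. p \<in> D \<Longrightarrow> P p > 0" and Q_pos: "\<And>p. p \<in> D \<Longrightarrow> Q p > 0"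
    and P_v: "\<And>p. p \<in> D \<Longrightarrow> pdv P p = phi1 \<nu> lam \<mu> p * P p + phi2 \<nu> lam \<mu> p * Q p"
    and Q_u: "\<And>p. p \<in> D \<Longrightarrow> pdu Q p = phi3 \<nu> lam \<mu> p * P p + phi4 \<nu> lam \<mu> p * Q p"
    and gauss: "\<And>p. p \<in> D \<Longrightarrow> 2 * lam p * \<mu> p =
           - (1 / (P p * Q p)) * (pdv (\<lambda>q. pdv P q / Q q) p + pdu (\<lambda>q. pdu Q q / P q) p)"
    and ricci: "\<And>p. p \<in> D \<Longrightarrow> 2 * \<nu> p * \<mu> p =
           2 / (P p * Q p) * pdv (pdu (\<lambda>q. ln (\<bar>Q q\<bar> / \<bar>P q\<bar>))) p"
begin

lemma open_D: "open D" and base_in_D: "(u0, v0) \<in> D"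
  using base by (auto simp: base_domain_def)

text \<open>Connection coefficients of the frame to come: \<open>a\<close> is <y_u, x>,
  \<open>b\<close> is <x_v, y>, and \<open>k1\<close>, \<open>k2\<close> are the coefficients of
  \<open>n\<close> in n_u and n_v. The latter two are logarithmic derivatives: of Q^2 |\<mu>| in u
  and of P^2 |\<mu>| in v.\<close>

definition "a p = pdv P p / Q p"
definition "b p = pdu Q p / P p"
definition "k1 p = 2 * (pdu Q p / Q p) + pdu \<mu> p / \<mu> p"
definition "k2 p = 2 * (pdv P p / P p) + pdv \<mu> p / \<mu> p"

lemma P_nz: "p \<in> D \<Longrightarrow> P p \<noteq> 0" and Q_nz: "p \<in> D \<Longrightarrow> Q p \<noteq> 0"
  using P_pos Q_pos by (auto simp: less_le)

lemma smooth_coeffs: "smooth_on D a" "smooth_on D b" "smooth_on D k1" "smooth_on D k2"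
  unfolding a_def[abs_def] b_def[abs_def] k1_def[abs_def] k2_def[abs_def]
  by (intro smooth_intros open_D smooth_data P_nz Q_nz mu_nz; assumption)+

lemmas data_du = smooth_data[THEN smooth_on_has_pdu[OF open_D]] smooth_coeffs[THEN smooth_on_has_pdu[OF open_D]]
lemmas data_dv = smooth_data[THEN smooth_on_has_pdv[OF open_D]] smooth_coeffs[THEN smooth_on_has_pdv[OF open_D]]

lemma P_v_eq: "p \<in> D \<Longrightarrow> pdv P p = a p * Q p" and Q_u_eq: "p \<in> D \<Longrightarrow> pdu Q p = b p * P p"
  using P_nz Q_nz by (simp_all add: a_def b_def)

lemma k1_eq: "p \<in> D \<Longrightarrow> Q p * \<mu> p * k1 p = 2 * b p * P p * \<mu> p + Q p * pdu \<mu> p"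
  and k2_eq: "p \<in> D \<Longrightarrow> P p * \<mu> p * k2 p = 2 * a p * Q p * \<mu> p + P p * pdv \<mu> p"
  using P_nz Q_nz mu_nz by (simp_all add: k1_def k2_def a_def b_def field_simps)

lemma gauss_eq: "p \<in> D \<Longrightarrow> pdv a p + pdu b p = - 2 * lam p * \<mu> p * P p * Q p"
  using gauss[of p] P_nz[of p] Q_nz[of p] unfolding a_def[abs_def] b_def[abs_def] by (simp add: field_simps)

text \<open>The first order equations cleared of denominators, a polynomial form fit for
  elimination.\<close>

lemma phi_eqs:
  assumes p: "p \<in> D"
  shows "pdv P p * (2 * \<mu> p * (4 * (\<nu> p)\<^sup>2 + 4 * (lam p)\<^sup>2 - 1)) =
      - (\<mu> p * (2 * lam p * pdv lam p + 2 * \<nu> p * pdv \<nu> p - pdv \<nu> p) + (2 * ((lam p)\<^sup>2 + (\<nu> p)\<^sup>2) + \<nu> p - 1) * pdv \<mu> p) * P p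
      + (2 * \<mu> p * (pdu lam p * \<nu> p - lam p * pdu \<nu> p) + lam p * pdu \<mu> p - pdu lam p * \<mu> p) * Q p"
    and "pdu Q p * (2 * \<mu> p * (4 * (\<nu> p)\<^sup>2 + 4 * (lam p)\<^sup>2 - 1)) =
      (2 * \<mu> p * (lam p * pdv \<nu> p - pdv lam p * \<nu> p) + lam p * pdv \<mu> p - pdv lam p * \<mu> p) * P p
      - (\<mu> p * (2 * lam p * pdu lam p + 2 * \<nu> p * pdu \<nu> p + pdu \<nu> p) + (2 * ((lam p)\<^sup>2 + (\<nu> p)\<^sup>2) - \<nu> p - 1) * pdu \<mu> p) * Q p"
proof -
  have 1: "pdv (\<lambda>q. (lam q)\<^sup>2 + (\<nu> q)\<^sup>2 - \<nu> q) p = 2 * lam p * pdv lam p + 2 * \<nu> p * pdv \<nu> p - pdv \<nu> p"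
    by (intro pdv_eqI pd_intros data_dv p)
  have 2: "pdu (\<lambda>q. (lam q)\<^sup>2 + (\<nu> q)\<^sup>2 + \<nu> q) p = 2 * lam p * pdu lam p + 2 * \<nu> p * pdu \<nu> p + pdu \<nu> p"
    by (intro pdu_eqI pd_intros data_du p)
  have eq: "(r / X * s + t / X * w) * X = r * s + t * w" if "X \<noteq> 0" for r s t w X :: real
    using that by (simp add: field_simps)
  have nz: "2 * \<mu> p * (4 * (\<nu> p)\<^sup>2 + 4 * (lam p)\<^sup>2 - 1) \<noteq> 0" using mu_nz[OF p] disc_nz[OF p] by simp
  show "pdv P p * (2 * \<mu> p * (4 * (\<nu> p)\<^sup>2 + 4 * (lam p)\<^sup>2 - 1)) =
      - (\<mu> p * (2 * lam p * pdv lam p + 2 * \<nu> p * pdv \<nu> p - pdv \<nu> p) + (2 * ((lam p)\<^sup>2 + (\<nu> p)\<^sup>2) + \<nu> p - 1) * pdv \<mu> p) * P p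
      + (2 * \<mu> p * (pdu lam p * \<nu> p - lam p * pdu \<nu> p) + lam p * pdu \<mu> p - pdu lam p * \<mu> p) * Q p"
    unfolding P_v[OF p] phi1_def phi2_def 1 by (rule eq[OF nz])
  show "pdu Q p * (2 * \<mu> p * (4 * (\<nu> p)\<^sup>2 + 4 * (lam p)\<^sup>2 - 1)) =
      (2 * \<mu> p * (lam p * pdv \<nu> p - pdv lam p * \<nu> p) + lam p * pdv \<mu> p - pdv lam p * \<mu> p) * P p
      - (\<mu> p * (2 * lam p * pdu lam p + 2 * \<nu> p * pdu \<nu> p + pdu \<nu> p) + (2 * ((lam p)\<^sup>2 + (\<nu> p)\<^sup>2) - \<nu> p - 1) * pdu \<mu> p) * Q p"
    unfolding Q_u[OF p] phi3_def phi4_def 2 by (subst eq[OF nz]) (simp add: algebra_simps)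
qed

text \<open>Inserting \<open>k1\<close> and \<open>k2\<close> leaves a linear system for P_v = a Q
  and Q_u = b P with rows (2 + 4\<nu>, -4\<lambda>) and (-4\<lambda>, 2 - 4\<nu>);
  \<open>phi_eqs\<close> is its solved form. Multiplied by 2\<mu> times 4\<nu>^2 + 4\<lambda>^2 - 1,
  each equation is a polynomial consequence of that form, and the nonzero factor is
  cancelled.\<close>

lemma codazzi_eqs:
  assumes p: "p \<in> D"
  shows "2 * \<nu> p * (a p * Q p) + P p * pdv \<nu> p + P p * (1 + \<nu> p) * k2 p =
      2 * lam p * (b p * P p) + Q p * pdu lam p + Q p * lam p * k1 p"
    and "- 2 * \<nu> p * (b p * P p) - Q p * pdu \<nu> p + Q p * (1 - \<nu> p) * k1 p =
      2 * lam p * (a p * Q p) + P p * pdv lam p + P p * lam p * k2 p"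
proof -
  have nz: "2 * (4 * (\<nu> p)\<^sup>2 + 4 * (lam p)\<^sup>2 - 1) * \<mu> p \<noteq> 0" using mu_nz[OF p] disc_nz[OF p] by simp
  note f = phi_eqs[OF p, unfolded P_v_eq[OF p] Q_u_eq[OF p]] k1_eq[OF p] k2_eq[OF p]
  have "2 * (4 * (\<nu> p)\<^sup>2 + 4 * (lam p)\<^sup>2 - 1) * \<mu> p * (2 * \<nu> p * (a p * Q p) + P p * pdv \<nu> p + P p * (1 + \<nu> p) * k2 p) =
     2 * (4 * (\<nu> p)\<^sup>2 + 4 * (lam p)\<^sup>2 - 1) * \<mu> p * (2 * lam p * (b p * P p) + Q p * pdu lam p + Q p * lam p * k1 p)"
    using f by algebra
  then show "2 * \<nu> p * (a p * Q p) + P p * pdv \<nu> p + P p * (1 + \<nu> p) * k2 p =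
      2 * lam p * (b p * P p) + Q p * pdu lam p + Q p * lam p * k1 p"
    using nz by (metis mult_cancel_left)
  have "2 * (4 * (\<nu> p)\<^sup>2 + 4 * (lam p)\<^sup>2 - 1) * \<mu> p * (- 2 * \<nu> p * (b p * P p) - Q p * pdu \<nu> p + Q p * (1 - \<nu> p) * k1 p) =
     2 * (4 * (\<nu> p)\<^sup>2 + 4 * (lam p)\<^sup>2 - 1) * \<mu> p * (2 * lam p * (a p * Q p) + P p * pdv lam p + P p * lam p * k2 p)"
    using f by algebra
  then show "- 2 * \<nu> p * (b p * P p) - Q p * pdu \<nu> p + Q p * (1 - \<nu> p) * k1 p =
      2 * lam p * (a p * Q p) + P p * pdv lam p + P p * lam p * k2 p"
    using nz by (metis mult_cancel_left)
qed

text \<open>The contributions of \<mu> to k1_v and k2_u agree by symmetry of mixed derivatives, so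
  the difference is 2 (ln Q - ln P)_uv, which the hypothesis \<open>ricci\<close> evaluates.\<close>

lemma ricci_eq:
  assumes p: "p \<in> D"
  shows "pdv k1 p - pdu k2 p = 2 * P p * Q p * \<mu> p * \<nu> p"
proof -
  have ln_u: "pdu (\<lambda>q. ln (\<bar>Q q\<bar> / \<bar>P q\<bar>)) q = pdu Q q / Q q - pdu P q / P q" if q: "q \<in> D" for q
  proof (rule pdu_eqI)
    have "has_pd du (\<lambda>q. ln (Q q) - ln (P q)) (1 / Q q * pdu Q q - 1 / P q * pdu P q) q"
      using P_pos[OF q] Q_pos[OF q] by (intro pd_intros has_pd_real_chain DERIV_ln_divide data_du q)
    then have "has_pd du (\<lambda>q. ln (\<bar>Q q\<bar> / \<bar>P q\<bar>)) (1 / Q q * pdu Q q - 1 / P q * pdu P q) q"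
      by (rule has_pd_cong[OF open_D q, rotated]) (use P_pos Q_pos in \<open>simp add: ln_div P_nz Q_nz abs_of_pos\<close>)
    then show "has_pd du (\<lambda>q. ln (\<bar>Q q\<bar> / \<bar>P q\<bar>)) (pdu Q q / Q q - pdu P q / P q) q" by simp
  qed
  note uv = smooth_data[THEN smooth_on_pdu, THEN smooth_on_has_pdv[OF open_D _ p]]
  note vu = smooth_data[THEN smooth_on_pdv, THEN smooth_on_has_pdu[OF open_D _ p]]
  note dv = data_dv[OF p] and du = data_du[OF p]
  note nz = P_nz[OF p] Q_nz[OF p] mu_nz[OF p]
  have "pdv (pdu (\<lambda>q. ln (\<bar>Q q\<bar> / \<bar>P q\<bar>))) p = pdv (\<lambda>q. pdu Q q / Q q - pdu P q / P q) p"
    by (rule pdv_cong[OF open_D p ln_u])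
  also have "\<dots> = (pdv (pdu Q) p * Q p - pdu Q p * pdv Q p) / (Q p)\<^sup>2 - (pdv (pdu P) p * P p - pdu P p * pdv P p) / (P p)\<^sup>2"
    by (intro pdv_eqI pd_intros uv dv nz)
  finally have 1: "P p * Q p * \<nu> p * \<mu> p = (pdv (pdu Q) p * Q p - pdu Q p * pdv Q p) / (Q p)\<^sup>2 - (pdv (pdu P) p * P p - pdu P p * pdv P p) / (P p)\<^sup>2"
    using ricci[OF p] nz by (simp add: field_simps)
  have "has_pd dv k1 (2 * ((pdv (pdu Q) p * Q p - pdu Q p * pdv Q p) / (Q p)\<^sup>2) + 0 * (pdu Q p / Q p) +
      (pdv (pdu \<mu>) p * \<mu> p - pdu \<mu> p * pdv \<mu> p) / (\<mu> p)\<^sup>2) p"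
    unfolding k1_def[abs_def] by (intro pd_intros uv dv nz)
  moreover have "has_pd du k2 (2 * ((pdu (pdv P) p * P p - pdv P p * pdu P p) / (P p)\<^sup>2) + 0 * (pdv P p / P p) +
      (pdu (pdv \<mu>) p * \<mu> p - pdv \<mu> p * pdu \<mu> p) / (\<mu> p)\<^sup>2) p"
    unfolding k2_def[abs_def] by (intro pd_intros vu du nz)
  ultimately have e1: "pdv k1 p = 2 * ((pdv (pdu Q) p * Q p - pdu Q p * pdv Q p) / (Q p)\<^sup>2) +
      (pdv (pdu \<mu>) p * \<mu> p - pdu \<mu> p * pdv \<mu> p) / (\<mu> p)\<^sup>2"
    and "pdu k2 p = 2 * ((pdu (pdv P) p * P p - pdv P p * pdu P p) / (P p)\<^sup>2) +
      (pdu (pdv \<mu>) p * \<mu> p - pdv \<mu> p * pdu \<mu> p) / (\<mu> p)\<^sup>2"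
    by (metis pdu_eqI pdv_eqI mult_zero_left add_0_right)+
  moreover have "pdu (pdv P) p = pdv (pdu P) p" "pdu (pdv \<mu>) p = pdv (pdu \<mu>) p"
    using smooth_on_pdv_pdu[OF open_D _ p] smooth_data by metis+
  ultimately have e2: "pdu k2 p = 2 * ((pdv (pdu P) p * P p - pdu P p * pdv P p) / (P p)\<^sup>2) +
      (pdv (pdu \<mu>) p * \<mu> p - pdu \<mu> p * pdv \<mu> p) / (\<mu> p)\<^sup>2"
    by (simp only: mult.commute[of "pdv P p"] mult.commute[of "pdv \<mu> p"])
  have "k - k' = 2 * P p * Q p * \<mu> p * \<nu> p"
    if "k = 2 * A + C" "k' = 2 * B + C" "P p * Q p * \<nu> p * \<mu> p = A - B" for k k' A B C
    using that by (simp add: algebra_simps)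
  then show ?thesis using e1 e2 1 .
qed

text \<open>The Gauss and Weingarten formulas. The coefficients of the derivatives of
  \<open>n\<close> and \<open>m\<close> are forced by those of \<open>x\<close> and \<open>y\<close>
  through the Gram relations with <n, m> = -1.\<close>

definition frame_eqs ::
  "(real \<times> real \<Rightarrow> real^4) \<Rightarrow> (real \<times> real \<Rightarrow> real^4) \<Rightarrow> (real \<times> real \<Rightarrow> real^4) \<Rightarrow> (real \<times> real \<Rightarrow> real^4) \<Rightarrow> bool"
  where "frame_eqs x y n m \<longleftrightarrow> (\<forall>p\<in>D.
    has_pd du x (- a p *\<^sub>R y p + (P p * (1 + \<nu> p)) *\<^sub>R n p) p \<and>
    has_pd dv x (b p *\<^sub>R y p + (Q p * lam p) *\<^sub>R n p + (Q p * \<mu> p) *\<^sub>R m p) p \<and>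
    has_pd du y (a p *\<^sub>R x p + (P p * lam p) *\<^sub>R n p + (P p * \<mu> p) *\<^sub>R m p) p \<and>
    has_pd dv y (- b p *\<^sub>R x p + (Q p * (1 - \<nu> p)) *\<^sub>R n p) p \<and>
    has_pd du n ((P p * \<mu> p) *\<^sub>R y p + k1 p *\<^sub>R n p) p \<and>
    has_pd dv n ((Q p * \<mu> p) *\<^sub>R x p + k2 p *\<^sub>R n p) p \<and>
    has_pd du m ((P p * (1 + \<nu> p)) *\<^sub>R x p + (P p * lam p) *\<^sub>R y p - k1 p *\<^sub>R m p) p \<and>
    has_pd dv m ((Q p * lam p) *\<^sub>R x p + (Q p * (1 - \<nu> p)) *\<^sub>R y p - k2 p *\<^sub>R m p) p)"

lemma frame_eqsD:
  assumes "frame_eqs x y n m" "p \<in> D"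
  shows "has_pd du x (- a p *\<^sub>R y p + (P p * (1 + \<nu> p)) *\<^sub>R n p) p"
    "has_pd du y (a p *\<^sub>R x p + (P p * lam p) *\<^sub>R n p + (P p * \<mu> p) *\<^sub>R m p) p"
    "has_pd du n ((P p * \<mu> p) *\<^sub>R y p + k1 p *\<^sub>R n p) p"
    "has_pd du m ((P p * (1 + \<nu> p)) *\<^sub>R x p + (P p * lam p) *\<^sub>R y p - k1 p *\<^sub>R m p) p"
    "has_pd dv x (b p *\<^sub>R y p + (Q p * lam p) *\<^sub>R n p + (Q p * \<mu> p) *\<^sub>R m p) p"
    "has_pd dv y (- b p *\<^sub>R x p + (Q p * (1 - \<nu> p)) *\<^sub>R n p) p"
    "has_pd dv n ((Q p * \<mu> p) *\<^sub>R x p + k2 p *\<^sub>R n p) p"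
    "has_pd dv m ((Q p * lam p) *\<^sub>R x p + (Q p * (1 - \<nu> p)) *\<^sub>R y p - k2 p *\<^sub>R m p) p"
  using assms by (auto simp: frame_eqs_def)

text \<open>The coefficient matrices lie in the Lie algebra of the group of the Gram matrix of a null
  frame, hence the operator that maps one solution frame to another one is constant.\<close>

lemma frame_transition_constant:
  assumes f: "frame_eqs x y n m" and f': "frame_eqs x' y' n' m'" and p: "p \<in> D"
  shows "mink (x p) w *\<^sub>R x' p + mink (y p) w *\<^sub>R y' p - mink (m p) w *\<^sub>R n' p - mink (n p) w *\<^sub>R m' p =
    mink (x (u0, v0)) w *\<^sub>R x' (u0, v0) + mink (y (u0, v0)) w *\<^sub>R y' (u0, v0)
    - mink (m (u0, v0)) w *\<^sub>R n' (u0, v0) - mink (n (u0, v0)) w *\<^sub>R m' (u0, v0)"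
proof (rule has_pd_zero_imp_constant[OF base _ _ p,
    where f="\<lambda>p. mink (x p) w *\<^sub>R x' p + mink (y p) w *\<^sub>R y' p - mink (m p) w *\<^sub>R n' p - mink (n p) w *\<^sub>R m' p"])
  fix q assume q: "q \<in> D"
  have *: "has_pd d (\<lambda>q. mink (k q) w) (mink k' w) q" if "has_pd d k k' q" for d k k'
    using has_pd_mink[OF that has_pd_const] by (simp add: mink_simps)
  note d = frame_eqsD[OF f q] and d' = frame_eqsD[OF f' q]
  let ?T = "\<lambda>p. mink (x p) w *\<^sub>R x' p + mink (y p) w *\<^sub>R y' p - mink (m p) w *\<^sub>R n' p - mink (n p) w *\<^sub>R m' p"
  \<comment> \<open>The null vectors are dual to each other up to sign, so the derivative of
    \<open>m\<close> goes with \<open>n'\<close> and that of \<open>n\<close> with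
    \<open>m'\<close>; all terms then cancel in pairs.\<close>
  show "has_pd du ?T 0 q"
    by (rule back_subst[of "\<lambda>r. has_pd du ?T r q", OF has_pd_diff[OF has_pd_diff[OF has_pd_add[OF
          has_pd_scaleR[OF *[OF d(1)] d'(1)] has_pd_scaleR[OF *[OF d(2)] d'(2)]]
          has_pd_scaleR[OF *[OF d(4)] d'(3)]] has_pd_scaleR[OF *[OF d(3)] d'(4)]]])
      (simp add: mink_simps vec_eq_iff algebra_simps)
  show "has_pd dv ?T 0 q"
    by (rule back_subst[of "\<lambda>r. has_pd dv ?T r q", OF has_pd_diff[OF has_pd_diff[OF has_pd_add[OF
          has_pd_scaleR[OF *[OF d(5)] d'(5)] has_pd_scaleR[OF *[OF d(6)] d'(6)]]
          has_pd_scaleR[OF *[OF d(8)] d'(7)]] has_pd_scaleR[OF *[OF d(7)] d'(8)]]])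
      (simp add: mink_simps vec_eq_iff algebra_simps)
qed

end

section \<open>Matrix-valued functions\<close>

lemma has_pd_eq_rhs: "has_pd d f f' p \<Longrightarrow> f' = g' \<Longrightarrow> has_pd d f g' p"
  by simp

lemma bounded_bilinear_matrix_matrix_mult:
  "bounded_bilinear ((**) :: real^'n^'m \<Rightarrow> real^'k^'n \<Rightarrow> real^'k^'m)"
  unfolding bilinear_conv_bounded_bilinear[symmetric] bilinear_def
  by (auto intro!: linearI simp: vec_eq_iff matrix_matrix_mult_def sum.distrib sum_distrib_left algebra_simps)

lemma matrix_matrix_mult_row:
  fixes A :: "real^'n^'m" and W :: "real^'k^'n"
  shows "(A ** W) $ i = (\<Sum>j\<in>UNIV. A $ i $ j *\<^sub>R W $ j)"
  by (simp add: vec_eq_iff matrix_matrix_mult_def)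

lemma smooth_on_vec_lambda:
  fixes f :: "real \<times> real \<Rightarrow> 'n::finite \<Rightarrow> 'b::euclidean_space"
  assumes "open D" "\<And>i. smooth_on D (\<lambda>p. f p i)"
  shows "smooth_on D (\<lambda>p. \<chi> i. f p i)"
proof -
  have "bounded_linear (axis i :: 'b \<Rightarrow> 'b^'n)" for i
    unfolding linear_conv_bounded_linear[symmetric] by (rule linearI) (auto simp: axis_def vec_eq_iff)
  then have "smooth_on D (\<lambda>p. \<Sum>i\<in>UNIV. axis i (f p i))"
    using assms by (intro smooth_intros smooth_on_bounded_linear[of "axis _"]) auto
  moreover have "(\<Sum>i\<in>UNIV. axis i (f p i)) = (\<chi> i. f p i)" for p
    by (simp add: vec_eq_iff axis_def if_distrib cong: if_cong)
  ultimately show ?thesis by simp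
qed

lemma smooth_on_vec_nth: "open D \<Longrightarrow> smooth_on D f \<Longrightarrow> smooth_on D (\<lambda>p. f p $ i)"
  by (rule smooth_on_bounded_linear[OF bounded_linear_vec_nth])

lemma has_pd_vec_nth: "has_pd d f f' p \<Longrightarrow> has_pd d (\<lambda>q. f q $ i) (f' $ i) p"
  by (rule has_pd_bounded_linear[OF bounded_linear_vec_nth])

lemma pdv_vec_nth:
  "open D \<Longrightarrow> smooth_on D f \<Longrightarrow> p \<in> D \<Longrightarrow> pdv f p $ i = pdv (\<lambda>q. f q $ i) p"
  using pdv_eqI[OF has_pd_vec_nth[OF smooth_on_has_pdv]] by metis

lemma pdu_vec_nth:
  "open D \<Longrightarrow> smooth_on D f \<Longrightarrow> p \<in> D \<Longrightarrow> pdu f p $ i = pdu (\<lambda>q. f q $ i) p"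
  using pdu_eqI[OF has_pd_vec_nth[OF smooth_on_has_pdu]] by metis

text \<open>Bootstrapping: if y is C^k, the right-hand sides are C^k, so y is C^(k+1); continuity
  starts the induction.\<close>

lemma smooth_on_linear_solution:
  assumes "open D" "bounded_bilinear pr" "smooth_on D A" "smooth_on D B" "continuous_on D y"
    and "\<And>p. p \<in> D \<Longrightarrow> has_pd du y (pr (A p) (y p)) p" "\<And>p. p \<in> D \<Longrightarrow> has_pd dv y (pr (B p) (y p)) p"
  shows "smooth_on D y"
  unfolding smooth_on_def
proof
  fix k show "Ck_on k D y"
  proof (induction k)
    case (Suc k)
    show ?case
      by (rule Ck_on_SucI_has_pd[OF assms(1,6,7)])
        (use assms(3,4) Suc in \<open>auto simp: smooth_on_def intro!: Ck_on_bilinear[OF assms(1,2)]\<close>)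
  qed (use assms(5) in simp)
qed

section \<open>Existence of the surface\<close>

text \<open>The rows of the total differential system: the frame \<open>x, y, n, m\<close> and the position vector.\<close>

datatype frame_index = IX | IY | IN | IM | IZ

lemma UNIV_frame_index: "UNIV = {IX, IY, IN, IM, IZ}"
  using frame_index.exhaust by blast

instance frame_index :: finite
  by standard (simp add: UNIV_frame_index)

lemma sum_frame_index: "(\<Sum>i\<in>UNIV. f i) = f IX + f IY + f IN + f IM + f IZ"
  by (simp add: UNIV_frame_index ac_simps)

context structure_data
begin

text \<open>The coefficients of \<open>frame_eqs\<close> in the u-direction, row by row, with z_u =
  P x as last row. The column \<open>IZ\<close> vanishes because no derivative involves the position
  itself.\<close>

definition MU :: "real \<times> real \<Rightarrow> real^frame_index^frame_index" where
  "MU p = (\<chi> i j. case i of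
      IX \<Rightarrow> (case j of IY \<Rightarrow> - a p | IN \<Rightarrow> P p * (1 + \<nu> p) | _ \<Rightarrow> 0)
    | IY \<Rightarrow> (case j of IX \<Rightarrow> a p | IN \<Rightarrow> P p * lam p | IM \<Rightarrow> P p * \<mu> p | _ \<Rightarrow> 0)
    | IN \<Rightarrow> (case j of IY \<Rightarrow> P p * \<mu> p | IN \<Rightarrow> k1 p | _ \<Rightarrow> 0)
    | IM \<Rightarrow> (case j of IX \<Rightarrow> P p * (1 + \<nu> p) | IY \<Rightarrow> P p * lam p | IM \<Rightarrow> - k1 p | _ \<Rightarrow> 0)
    | IZ \<Rightarrow> (case j of IX \<Rightarrow> P p | _ \<Rightarrow> 0))"

definition MV :: "real \<times> real \<Rightarrow> real^frame_index^frame_index" where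
  "MV p = (\<chi> i j. case i of
      IX \<Rightarrow> (case j of IY \<Rightarrow> b p | IN \<Rightarrow> Q p * lam p | IM \<Rightarrow> Q p * \<mu> p | _ \<Rightarrow> 0)
    | IY \<Rightarrow> (case j of IX \<Rightarrow> - b p | IN \<Rightarrow> Q p * (1 - \<nu> p) | _ \<Rightarrow> 0)
    | IN \<Rightarrow> (case j of IX \<Rightarrow> Q p * \<mu> p | IN \<Rightarrow> k2 p | _ \<Rightarrow> 0)
    | IM \<Rightarrow> (case j of IX \<Rightarrow> Q p * lam p | IY \<Rightarrow> Q p * (1 - \<nu> p) | IM \<Rightarrow> - k2 p | _ \<Rightarrow> 0)
    | IZ \<Rightarrow> (case j of IY \<Rightarrow> Q p | _ \<Rightarrow> 0))"

lemma smooth_MU: "smooth_on D MU"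
  unfolding MU_def[abs_def]
proof (intro smooth_on_vec_lambda open_D)
  show "smooth_on D (\<lambda>p. case i of
      IX \<Rightarrow> (case j of IY \<Rightarrow> - a p | IN \<Rightarrow> P p * (1 + \<nu> p) | _ \<Rightarrow> 0)
    | IY \<Rightarrow> (case j of IX \<Rightarrow> a p | IN \<Rightarrow> P p * lam p | IM \<Rightarrow> P p * \<mu> p | _ \<Rightarrow> 0)
    | IN \<Rightarrow> (case j of IY \<Rightarrow> P p * \<mu> p | IN \<Rightarrow> k1 p | _ \<Rightarrow> 0)
    | IM \<Rightarrow> (case j of IX \<Rightarrow> P p * (1 + \<nu> p) | IY \<Rightarrow> P p * lam p | IM \<Rightarrow> - k1 p | _ \<Rightarrow> 0)
    | IZ \<Rightarrow> (case j of IX \<Rightarrow> P p | _ \<Rightarrow> 0))" for i j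
    by (cases i; cases j; simp; intro smooth_intros open_D smooth_data smooth_coeffs)
qed

lemma smooth_MV: "smooth_on D MV"
  unfolding MV_def[abs_def]
proof (intro smooth_on_vec_lambda open_D)
  show "smooth_on D (\<lambda>p. case i of
      IX \<Rightarrow> (case j of IY \<Rightarrow> b p | IN \<Rightarrow> Q p * lam p | IM \<Rightarrow> Q p * \<mu> p | _ \<Rightarrow> 0)
    | IY \<Rightarrow> (case j of IX \<Rightarrow> - b p | IN \<Rightarrow> Q p * (1 - \<nu> p) | _ \<Rightarrow> 0)
    | IN \<Rightarrow> (case j of IX \<Rightarrow> Q p * \<mu> p | IN \<Rightarrow> k2 p | _ \<Rightarrow> 0)
    | IM \<Rightarrow> (case j of IX \<Rightarrow> Q p * lam p | IY \<Rightarrow> Q p * (1 - \<nu> p) | IM \<Rightarrow> - k2 p | _ \<Rightarrow> 0)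
    | IZ \<Rightarrow> (case j of IY \<Rightarrow> Q p | _ \<Rightarrow> 0))" for i j
    by (cases i; cases j; simp; intro smooth_intros open_D smooth_data smooth_coeffs)
qed

text \<open>Entry by entry, this is the integrability of the surface equations: (\<open>IX\<close>,
  \<open>IY\<close>) is Gauss, (\<open>IN\<close>, \<open>IN\<close>) is Ricci, (\<open>IX\<close>,
  \<open>IN\<close>) and (\<open>IY\<close>, \<open>IN\<close>) are the Codazzi equations,
  (\<open>IX\<close>, \<open>IM\<close>) and (\<open>IY\<close>, \<open>IM\<close>) the formulas for
  \<open>k1\<close> and \<open>k2\<close>, and the row \<open>IZ\<close> gives P_v = a Q and Q_u = b
  P. The other entries repeat these or are trivial.\<close>

lemma flat:
  assumes p: "p \<in> D"
  shows "pdv MU p + MU p ** MV p = pdu MV p + MV p ** MU p"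
proof -
  have 1: "pdv MU p $ i $ j = pdv (\<lambda>q. MU q $ i $ j) p" "pdu MV p $ i $ j = pdu (\<lambda>q. MV q $ i $ j) p" for i j
    by (simp_all only: pdv_vec_nth[OF open_D smooth_MU p] pdv_vec_nth[OF open_D smooth_on_vec_nth[OF open_D smooth_MU] p]
      pdu_vec_nth[OF open_D smooth_MV p] pdu_vec_nth[OF open_D smooth_on_vec_nth[OF open_D smooth_MV] p])
  note dv = data_dv[OF p] and du = data_du[OF p]
  have V: "pdv (\<lambda>q. - a q) p = - pdv a p" "pdv (\<lambda>q. - k1 q) p = - pdv k1 p" "pdv (\<lambda>q. 0) p = (0::real)"
    "pdv (\<lambda>q. P q * lam q) p = P p * pdv lam p + a p * Q p * lam p"
    "pdv (\<lambda>q. P q * \<mu> q) p = P p * pdv \<mu> p + a p * Q p * \<mu> p"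
    "pdv (\<lambda>q. P q * (1 + \<nu> q)) p = P p * (0 + pdv \<nu> p) + a p * Q p * (1 + \<nu> p)"
    unfolding P_v_eq[OF p, symmetric] by (intro pdv_eqI pd_intros dv)+
  have U: "pdu (\<lambda>q. - b q) p = - pdu b p" "pdu (\<lambda>q. - k2 q) p = - pdu k2 p" "pdu (\<lambda>q. 0) p = (0::real)"
    "pdu (\<lambda>q. Q q * lam q) p = Q p * pdu lam p + b p * P p * lam p"
    "pdu (\<lambda>q. Q q * \<mu> q) p = Q p * pdu \<mu> p + b p * P p * \<mu> p"
    "pdu (\<lambda>q. Q q * (1 - \<nu> q)) p = Q p * (0 - pdu \<nu> p) + b p * P p * (1 - \<nu> p)"
    unfolding Q_u_eq[OF p, symmetric] by (intro pdu_eqI pd_intros du)+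
  note F = gauss_eq[OF p] ricci_eq[OF p] codazzi_eqs[OF p] k1_eq[OF p] k2_eq[OF p]
  have "(pdv MU p + MU p ** MV p) $ i $ j = (pdu MV p + MV p ** MU p) $ i $ j" for i j
    unfolding vector_add_component 1 matrix_matrix_mult_def vec_lambda_beta sum_frame_index
    using F by (cases i; cases j; simp add: MU_def MV_def U V P_v_eq[OF p] Q_u_eq[OF p]; simp add: algebra_simps)
  then show ?thesis by (simp add: vec_eq_iff)
qed

lemma frame_and_surface_exist:
  obtains x y n m z where "frame_eqs x y n m"
    and "smooth_on D x" "smooth_on D y" "smooth_on D n" "smooth_on D m" "smooth_on D z"
    and "\<And>p. p \<in> D \<Longrightarrow> null_frame (x p) (y p) (n p) (m p)"
    and "\<And>p. p \<in> D \<Longrightarrow> has_pd du z (P p *\<^sub>R x p) p" "\<And>p. p \<in> D \<Longrightarrow> has_pd dv z (Q p *\<^sub>R y p) p"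
proof -
  \<comment> \<open>A concrete null frame: the two null vectors span the plane of the last two
    coordinates, and the halves give <n, m> = -1. The surface starts at the origin.\<close>
  define w0 :: "real^4^frame_index" where "w0 = (\<chi> i. case i of
      IX \<Rightarrow> vector [1, 0, 0, 0] | IY \<Rightarrow> vector [0, 1, 0, 0] | IN \<Rightarrow> vector [0, 0, 1, 1]
    | IM \<Rightarrow> vector [0, 0, - 1 / 2, 1 / 2] | IZ \<Rightarrow> 0)"
  note bil = bounded_bilinear_matrix_matrix_mult[where 'n=frame_index and 'm=frame_index and 'k=4]
  have C1: "Ck_on (Suc 0) D MU" "Ck_on (Suc 0) D MV" using smooth_MU smooth_MV unfolding smooth_on_def by blast+
  have "pdv MU p ** w + MU p ** (MV p ** w) = pdu MV p ** w + MV p ** (MU p ** w)" if "p \<in> D" for p and w :: "real^4^frame_index"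
    using flat[OF that] by (simp add: matrix_mul_assoc bounded_bilinear.add_left[OF bil, symmetric])
  from frobenius_linear[OF bil base C1 this, of w0]
  obtain W where W0: "W (u0, v0) = w0" and contW: "continuous_on D W"
    and Wu: "\<And>p. p \<in> D \<Longrightarrow> has_pd du W (MU p ** W p) p" and Wv: "\<And>p. p \<in> D \<Longrightarrow> has_pd dv W (MV p ** W p) p"
    by blast
  have smW: "smooth_on D W"
    by (rule smooth_on_linear_solution[OF open_D bil smooth_MU smooth_MV contW Wu Wv])
  define x y n m z where "x = (\<lambda>p. W p $ IX)" and "y = (\<lambda>p. W p $ IY)" and "n = (\<lambda>p. W p $ IN)"
    and "m = (\<lambda>p. W p $ IM)" and "z = (\<lambda>p. W p $ IZ)"
  have smooth: "smooth_on D x" "smooth_on D y" "smooth_on D n" "smooth_on D m" "smooth_on D z"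
    unfolding x_def y_def n_def m_def z_def by (intro smooth_on_vec_nth open_D smW)+
  note rows = has_pd_vec_nth[OF Wu, unfolded matrix_matrix_mult_row sum_frame_index]
    has_pd_vec_nth[OF Wv, unfolded matrix_matrix_mult_row sum_frame_index]
  have eqs: "frame_eqs x y n m"
    unfolding frame_eqs_def
  proof (intro ballI conjI)
    fix p assume p: "p \<in> D"
    show "has_pd du x (- a p *\<^sub>R y p + (P p * (1 + \<nu> p)) *\<^sub>R n p) p"
      "has_pd du y (a p *\<^sub>R x p + (P p * lam p) *\<^sub>R n p + (P p * \<mu> p) *\<^sub>R m p) p"
      "has_pd du n ((P p * \<mu> p) *\<^sub>R y p + k1 p *\<^sub>R n p) p"
      "has_pd du m ((P p * (1 + \<nu> p)) *\<^sub>R x p + (P p * lam p) *\<^sub>R y p - k1 p *\<^sub>R m p) p"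
      using rows(1)[OF p, of IX] rows(1)[OF p, of IY] rows(1)[OF p, of IN] rows(1)[OF p, of IM]
      by (simp_all add: MU_def x_def y_def n_def m_def)
    show "has_pd dv x (b p *\<^sub>R y p + (Q p * lam p) *\<^sub>R n p + (Q p * \<mu> p) *\<^sub>R m p) p"
      "has_pd dv y (- b p *\<^sub>R x p + (Q p * (1 - \<nu> p)) *\<^sub>R n p) p"
      "has_pd dv n ((Q p * \<mu> p) *\<^sub>R x p + k2 p *\<^sub>R n p) p"
      "has_pd dv m ((Q p * lam p) *\<^sub>R x p + (Q p * (1 - \<nu> p)) *\<^sub>R y p - k2 p *\<^sub>R m p) p"
      using rows(2)[OF p, of IX] rows(2)[OF p, of IY] rows(2)[OF p, of IN] rows(2)[OF p, of IM]
      by (simp_all add: MV_def x_def y_def n_def m_def)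
  qed
  have z: "has_pd du z (P p *\<^sub>R x p) p" "has_pd dv z (Q p *\<^sub>R y p) p" if "p \<in> D" for p
    using rows(1)[OF that, of IZ] rows(2)[OF that, of IZ] by (simp_all add: MU_def MV_def z_def x_def y_def)
  have "null_frame (x (u0, v0)) (y (u0, v0)) (n (u0, v0)) (m (u0, v0))"
    by (simp add: x_def y_def n_def m_def W0 w0_def null_frame_def mink_def vector_4)
  \<comment> \<open>The transition operator from the frame to itself is the expansion operator. It
    is the identity at the base point and constant, hence the identity everywhere, which is the
    frame property.\<close>
  then have "null_frame (x p) (y p) (n p) (m p)" if "p \<in> D" for p
    unfolding null_frame_iff_expansion frame_transition_constant[OF eqs eqs that] .
  then show thesis using that eqs smooth z by blast
qed

end

section \<open>Invariants of a surface carrying an adapted frame\<close>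

text \<open>Meeting point of both halves: existence produces such a frame, uniqueness extracts one
  from any given canonical surface.\<close>

locale adapted_frame = structure_data +
  fixes x y n m z :: "real \<times> real \<Rightarrow> real^4"
  assumes eqs: "frame_eqs x y n m"
    and smooth_frame: "smooth_on D x" "smooth_on D y" "smooth_on D n" "smooth_on D m" "smooth_on D z"
    and frame: "\<And>p. p \<in> D \<Longrightarrow> null_frame (x p) (y p) (n p) (m p)"
    and z_u: "\<And>p. p \<in> D \<Longrightarrow> has_pd du z (P p *\<^sub>R x p) p" and z_v: "\<And>p. p \<in> D \<Longrightarrow> has_pd dv z (Q p *\<^sub>R y p) p"
begin

lemma pdu_z: "p \<in> D \<Longrightarrow> pdu z p = P p *\<^sub>R x p" and pdv_z: "p \<in> D \<Longrightarrow> pdv z p = Q p *\<^sub>R y p"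
  using z_u z_v pdu_eqI pdv_eqI by blast+

lemma fundamental_form:
  assumes "p \<in> D"
  shows "fE z p = (P p)\<^sup>2" "fF z p = 0" "fG z p = (Q p)\<^sup>2"
  using null_frameD[OF frame[OF assms]]
  by (simp_all add: fE_def fF_def fG_def pdu_z pdv_z assms mink_simps power2_eq_square)

lemma tangent_part_eq:
  assumes p: "p \<in> D"
  shows "tangent_part z p w = mink w (x p) *\<^sub>R x p + mink w (y p) *\<^sub>R y p"
  using P_nz[OF p] Q_nz[OF p]
  by (simp add: tangent_part_def fundamental_form p pdu_z pdv_z mink_simps power2_eq_square)

lemmas d_u = frame_eqsD(1-4)[OF eqs] and d_v = frame_eqsD(5-8)[OF eqs]

lemma second_derivatives:
  assumes p: "p \<in> D"
  shows "pdu (pdu z) p = pdu P p *\<^sub>R x p - (P p * a p) *\<^sub>R y p + ((P p)\<^sup>2 * (1 + \<nu> p)) *\<^sub>R n p"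
    and "pdv (pdu z) p = pdv P p *\<^sub>R x p + pdu Q p *\<^sub>R y p + (P p * Q p * lam p) *\<^sub>R n p + (P p * Q p * \<mu> p) *\<^sub>R m p"
    and "pdv (pdv z) p = pdv Q p *\<^sub>R y p - (Q p * b p) *\<^sub>R x p + ((Q p)\<^sup>2 * (1 - \<nu> p)) *\<^sub>R n p"
proof -
  have "pdu (pdu z) p = pdu (\<lambda>q. P q *\<^sub>R x q) p" "pdv (pdu z) p = pdv (\<lambda>q. P q *\<^sub>R x q) p"
    "pdv (pdv z) p = pdv (\<lambda>q. Q q *\<^sub>R y q) p"
    using pdu_cong[OF open_D p, of "pdu z" "\<lambda>q. P q *\<^sub>R x q"] pdv_cong[OF open_D p, of "pdu z" "\<lambda>q. P q *\<^sub>R x q"]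
      pdv_cong[OF open_D p, of "pdv z" "\<lambda>q. Q q *\<^sub>R y q"] pdu_z pdv_z by auto
  then show "pdu (pdu z) p = pdu P p *\<^sub>R x p - (P p * a p) *\<^sub>R y p + ((P p)\<^sup>2 * (1 + \<nu> p)) *\<^sub>R n p"
    and "pdv (pdu z) p = pdv P p *\<^sub>R x p + pdu Q p *\<^sub>R y p + (P p * Q p * lam p) *\<^sub>R n p + (P p * Q p * \<mu> p) *\<^sub>R m p"
    and "pdv (pdv z) p = pdv Q p *\<^sub>R y p - (Q p * b p) *\<^sub>R x p + ((Q p)\<^sup>2 * (1 - \<nu> p)) *\<^sub>R n p"
    using pdu_eqI[OF has_pd_scaleR[OF data_du(4)[OF p] d_u(1)[OF p]]]
      pdv_eqI[OF has_pd_scaleR[OF data_dv(4)[OF p] d_v(1)[OF p]]]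
      pdv_eqI[OF has_pd_scaleR[OF data_dv(5)[OF p] d_v(2)[OF p]]]
    by (simp_all add: Q_u_eq[OF p] power2_eq_square algebra_simps)
qed

lemma normal_second_derivatives:
  assumes p: "p \<in> D"
  shows "normal_part z p (pdu (pdu z) p) = ((P p)\<^sup>2 * (1 + \<nu> p)) *\<^sub>R n p"
    and "normal_part z p (pdv (pdu z) p) = (P p * Q p) *\<^sub>R (lam p *\<^sub>R n p + \<mu> p *\<^sub>R m p)"
    and "normal_part z p (pdv (pdv z) p) = ((Q p)\<^sup>2 * (1 - \<nu> p)) *\<^sub>R n p"
  unfolding normal_part_def tangent_part_eq[OF p] second_derivatives[OF p]
  by (simp_all add: mink_simps null_frameD[OF frame[OF p]] scaleR_add_right)

text \<open>In the trace the factors 1 + \<nu> and 1 - \<nu> add up to 2, which the factor 1/2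
  removes.\<close>

lemma mean_curv_eq:
  assumes p: "p \<in> D"
  shows "mean_curv z p = n p"
proof -
  have "(P p * Q p)\<^sup>2 \<noteq> 0" using P_nz[OF p] Q_nz[OF p] by simp
  moreover have "(Q p)\<^sup>2 *\<^sub>R (((P p)\<^sup>2 * (1 + \<nu> p)) *\<^sub>R n p) + (P p)\<^sup>2 *\<^sub>R (((Q p)\<^sup>2 * (1 - \<nu> p)) *\<^sub>R n p)
      = (2 * (P p * Q p)\<^sup>2) *\<^sub>R n p"
    unfolding scaleR_scaleR scaleR_add_left[symmetric] by (rule arg_cong[where f="\<lambda>r. r *\<^sub>R n p"]) algebra
  ultimately show ?thesis
    unfolding mean_curv_def sigma_def normal_second_derivatives[OF p] fundamental_form[OF p]
    by (simp add: power_mult_distrib)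
qed

lemma n2_eq: "p \<in> D \<Longrightarrow> n2 z p = m p"
  using n2_eqI[OF frame pdu_z pdv_z P_nz Q_nz mean_curv_eq] .

lemma marginally_trapped: "marginally_trapped D z"
  unfolding marginally_trapped_def spacelike_surface_def
proof (intro conjI ballI allI impI open_D smooth_frame)
  fix p and r s :: real assume p: "p \<in> D" and rs: "(r, s) \<noteq> (0, 0)"
  have "mink (r *\<^sub>R pdu z p + s *\<^sub>R pdv z p) (r *\<^sub>R pdu z p + s *\<^sub>R pdv z p) = (r * P p)\<^sup>2 + (s * Q p)\<^sup>2"
    by (simp add: pdu_z pdv_z p mink_simps null_frameD[OF frame[OF p]] power2_eq_square)
  also have "\<dots> > 0" using rs P_nz[OF p] Q_nz[OF p] by (auto simp: sum_power2_gt_zero_iff)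
  finally show "mink (r *\<^sub>R pdu z p + s *\<^sub>R pdv z p) (r *\<^sub>R pdu z p + s *\<^sub>R pdv z p) > 0" .
next
  fix p assume p: "p \<in> D"
  show "mean_curv z p \<noteq> 0" "mink (mean_curv z p) (mean_curv z p) = 0"
    using null_frameD(13,15)[OF frame[OF p]] by (auto simp: mean_curv_eq p mink_simps)
qed

lemma principal: "principal_parameters D z \<nu> lam \<mu>"
  unfolding principal_parameters_def Let_def
proof (intro ballI conjI)
  fix p assume p: "p \<in> D"
  have sq: "sqrt (fE z p) = P p" "sqrt (fG z p) = Q p"
    using P_pos[OF p] Q_pos[OF p] by (simp_all add: fundamental_form p)
  note nz = P_nz[OF p] Q_nz[OF p]
  show "fF z p = 0" "\<mu> p \<noteq> 0" using fundamental_form(2) mu_nz p by auto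
  show "sigma z p (1 / sqrt (fE z p), 0) (1 / sqrt (fE z p), 0) = (1 + \<nu> p) *\<^sub>R mean_curv z p"
    "sigma z p (1 / sqrt (fE z p), 0) (0, 1 / sqrt (fG z p)) = lam p *\<^sub>R mean_curv z p + \<mu> p *\<^sub>R n2 z p"
    "sigma z p (0, 1 / sqrt (fG z p)) (0, 1 / sqrt (fG z p)) = (1 - \<nu> p) *\<^sub>R mean_curv z p"
    unfolding sigma_def normal_second_derivatives[OF p] mean_curv_eq[OF p] n2_eq[OF p] sq
    using nz by (simp_all add: power2_eq_square)
qed

text \<open>After the normal components are dropped, the commutator paired with z_u is -P Q (a_v +
  b_u), and \<open>gauss_eq\<close> evaluates it.\<close>

lemma gauss_curv_eq:
  assumes p: "p \<in> D"
  shows "gauss_curv z p = 2 * lam p * \<mu> p"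
proof -
  have t: "tan_conn_v z (pdv z) q = pdv Q q *\<^sub>R y q - (Q q * b q) *\<^sub>R x q"
    "tan_conn_u z (pdv z) q = (a q * Q q) *\<^sub>R x q + pdu Q q *\<^sub>R y q" if q: "q \<in> D" for q
    using null_frameD[OF frame[OF q]]
    by (simp_all add: tan_conn_v_def tan_conn_u_def tangent_part_eq[OF q] second_derivatives[OF q]
      smooth_on_pdv_pdu[OF open_D smooth_frame(5) q, symmetric] mink_simps P_v_eq[OF q])
  note uv = smooth_data(5)[THEN smooth_on_pdv, THEN smooth_on_has_pdu[OF open_D _ p]]
    smooth_data(5)[THEN smooth_on_pdu, THEN smooth_on_has_pdv[OF open_D _ p]]
  have "pdu (tan_conn_v z (pdv z)) p = pdu (\<lambda>q. pdv Q q *\<^sub>R y q - (Q q * b q) *\<^sub>R x q) p"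
    "pdv (tan_conn_u z (pdv z)) p = pdv (\<lambda>q. (a q * Q q) *\<^sub>R x q + pdu Q q *\<^sub>R y q) p"
    using pdu_cong[OF open_D p t(1)] pdv_cong[OF open_D p t(2)] by auto
  moreover have "has_pd du (\<lambda>q. pdv Q q *\<^sub>R y q - (Q q * b q) *\<^sub>R x q)
      (pdv Q p *\<^sub>R (a p *\<^sub>R x p + (P p * lam p) *\<^sub>R n p + (P p * \<mu> p) *\<^sub>R m p) + pdu (pdv Q) p *\<^sub>R y p
       - ((Q p * b p) *\<^sub>R (- a p *\<^sub>R y p + (P p * (1 + \<nu> p)) *\<^sub>R n p) + (Q p * pdu b p + pdu Q p * b p) *\<^sub>R x p)) p"
    by (intro pd_intros uv data_du p d_u)
  moreover have "has_pd dv (\<lambda>q. (a q * Q q) *\<^sub>R x q + pdu Q q *\<^sub>R y q)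
      ((a p * Q p) *\<^sub>R (b p *\<^sub>R y p + (Q p * lam p) *\<^sub>R n p + (Q p * \<mu> p) *\<^sub>R m p) + (a p * pdv Q p + pdv a p * Q p) *\<^sub>R x p
       + (pdu Q p *\<^sub>R (- b p *\<^sub>R x p + (Q p * (1 - \<nu> p)) *\<^sub>R n p) + pdv (pdu Q) p *\<^sub>R y p)) p"
    by (intro pd_intros uv data_dv p d_v)
  ultimately have "mink (tan_conn_u z (tan_conn_v z (pdv z)) p - tan_conn_v z (tan_conn_u z (pdv z)) p) (pdu z p)
      = - (P p * Q p * (pdv a p + pdu b p))"
    unfolding tan_conn_u_def[of z "tan_conn_v z (pdv z)"] tan_conn_v_def[of z "tan_conn_u z (pdv z)"]
    by (simp only: pdu_eqI pdv_eqI tangent_part_eq[OF p] pdu_z[OF p])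
      (simp add: mink_simps null_frameD[OF frame[OF p]] algebra_simps)
  then show ?thesis
    unfolding gauss_curv_def fundamental_form[OF p] gauss_eq[OF p]
    using P_nz[OF p] Q_nz[OF p] by (simp add: field_simps power2_eq_square)
qed

text \<open>The normal derivatives of \<open>n2\<close> are -k1 m and -k2 m. The products of
  \<open>k1\<close> and \<open>k2\<close> cancel in the commutator and leave k1_v - k2_u, known from
  \<open>ricci_eq\<close>.\<close>

lemma normal_curv_eq:
  assumes p: "p \<in> D"
  shows "normal_curv z p = - 2 * \<mu> p * \<nu> p"
proof -
  have "pdu (n2 z) q = pdu m q" "pdv (n2 z) q = pdv m q" if "q \<in> D" for q
    using pdu_cong[OF open_D that n2_eq] pdv_cong[OF open_D that n2_eq] by auto
  then have t: "nor_conn_v z (n2 z) q = - k2 q *\<^sub>R m q" "nor_conn_u z (n2 z) q = - k1 q *\<^sub>R m q" if q: "q \<in> D" for q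
    using null_frameD[OF frame[OF q]] pdu_eqI[OF d_u(4)[OF q]] pdv_eqI[OF d_v(4)[OF q]] q
    by (simp_all add: nor_conn_v_def nor_conn_u_def normal_part_def tangent_part_eq[OF q] mink_simps)
  have "pdu (nor_conn_v z (n2 z)) p = pdu (\<lambda>q. - k2 q *\<^sub>R m q) p"
    "pdv (nor_conn_u z (n2 z)) p = pdv (\<lambda>q. - k1 q *\<^sub>R m q) p"
    using pdu_cong[OF open_D p t(1)] pdv_cong[OF open_D p t(2)] by auto
  moreover have "has_pd du (\<lambda>q. - k2 q *\<^sub>R m q)
      (- k2 p *\<^sub>R ((P p * (1 + \<nu> p)) *\<^sub>R x p + (P p * lam p) *\<^sub>R y p - k1 p *\<^sub>R m p) + (- pdu k2 p) *\<^sub>R m p) p"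
    by (intro pd_intros data_du p d_u)
  moreover have "has_pd dv (\<lambda>q. - k1 q *\<^sub>R m q)
      (- k1 p *\<^sub>R ((Q p * lam p) *\<^sub>R x p + (Q p * (1 - \<nu> p)) *\<^sub>R y p - k2 p *\<^sub>R m p) + (- pdv k1 p) *\<^sub>R m p) p"
    by (intro pd_intros data_dv p d_v)
  ultimately have "mink (nor_conn_u z (nor_conn_v z (n2 z)) p - nor_conn_v z (nor_conn_u z (n2 z)) p) (mean_curv z p)
      = - (pdv k1 p - pdu k2 p)"
    unfolding nor_conn_u_def[of z "nor_conn_v z (n2 z)"] nor_conn_v_def[of z "nor_conn_u z (n2 z)"]
    by (simp only: pdu_eqI pdv_eqI normal_part_def tangent_part_eq[OF p] mean_curv_eq[OF p])
      (simp add: mink_simps null_frameD[OF frame[OF p]] algebra_simps)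
  moreover have "sqrt ((P p)\<^sup>2 * (Q p)\<^sup>2 - 0\<^sup>2) = P p * Q p"
    using P_pos[OF p] Q_pos[OF p] by (simp add: real_sqrt_mult)
  ultimately show ?thesis
    unfolding normal_curv_def fundamental_form[OF p] ricci_eq[OF p]
    using P_nz[OF p] Q_nz[OF p] by (simp add: field_simps)
qed

lemma general_type: "general_type D z \<mu>"
  unfolding general_type_def
proof
  fix p assume p: "p \<in> D"
  have "(gauss_curv z p)\<^sup>2 + (normal_curv z p)\<^sup>2 - (\<mu> p)\<^sup>2 = (\<mu> p)\<^sup>2 * (4 * (\<nu> p)\<^sup>2 + 4 * (lam p)\<^sup>2 - 1)"
    by (simp add: gauss_curv_eq normal_curv_eq p power2_eq_square algebra_simps)
  also have "\<dots> \<noteq> 0" using mu_nz[OF p] disc_nz[OF p] by simp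
  finally show "(gauss_curv z p)\<^sup>2 + (normal_curv z p)\<^sup>2 \<noteq> (\<mu> p)\<^sup>2" by simp
qed

end

section \<open>The canonical normalization\<close>

lemma LBINT_has_real_derivative:
  fixes f :: "real \<Rightarrow> real"
  assumes "open S" "continuous_on S f" "closed_segment c x \<subseteq> S"
  shows "((\<lambda>u. LBINT y=ereal c..ereal u. f y) has_real_derivative f x) (at x)"
proof -
  have "x \<in> S" using assms(3) by auto
  then obtain d where d: "d > 0" "cball x d \<subseteq> S" using assms(1) open_contains_cball by blast
  \<comment> \<open>The interval holds both the lower limit and a neighbourhood of x, so the
    oriented integral can be differentiated on either side of \<open>c\<close>.\<close>
  define l r where "l = min c (x - d)" and "r = max c (x + d)"
  have "{l..r} \<subseteq> closed_segment c x \<union> cball x d"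
    using d(1) by (auto simp: l_def r_def closed_segment_eq_real_ivl cball_eq_atLeastAtMost split: if_splits)
  then have "continuous_on {l..r} f" using assms(2,3) d(2) by (meson continuous_on_subset le_sup_iff subset_trans)
  moreover have lr: "l \<le> c" "c \<le> r" "l < x" "x < r" using d(1) by (auto simp: l_def r_def)
  ultimately have "((\<lambda>u. LBINT y=ereal c..ereal u. f y) has_vector_derivative f x) (at x within {l..r})"
    by (intro interval_integral_FTC2) auto
  then show ?thesis
    using lr by (simp add: at_within_Icc_at has_real_derivative_iff_has_vector_derivative)
qed

lemma LBINT_log_derivative:
  fixes f h h' :: "real \<Rightarrow> real"
  assumes "\<And>s. s \<in> closed_segment a b \<Longrightarrow> h s > 0"
    and "\<And>s. s \<in> closed_segment a b \<Longrightarrow> (h has_real_derivative h' s) (at s)"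
    and "\<And>s. s \<in> closed_segment a b \<Longrightarrow> f s = h' s / h s"
    and "continuous_on (closed_segment a b) h'"
  shows "(LBINT s=ereal a..ereal b. f s) = ln (h b) - ln (h a)"
proof -
  have seg: "closed_segment a b = {min a b..max a b}"
    by (auto simp: closed_segment_eq_real_ivl)
  show ?thesis
  proof (rule interval_integral_FTC_finite)
    have "continuous_on (closed_segment a b) h"
      using assms(2) DERIV_isCont continuous_at_imp_continuous_on by blast
    then have "continuous_on (closed_segment a b) (\<lambda>s. h' s / h s)"
      using assms(1,4) by (intro continuous_on_divide) (auto simp: less_imp_neq[symmetric])
    then show "continuous_on {min a b..max a b} f"
      using assms(3) unfolding seg[symmetric] by (simp cong: continuous_on_cong)
    fix s assume "min a b \<le> s" "s \<le> max a b"
    then have s: "s \<in> closed_segment a b" by (simp add: seg)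
    have "((\<lambda>s. ln (h s)) has_real_derivative f s) (at s)"
      using DERIV_chain2[OF DERIV_ln_divide[OF assms(1)[OF s]] assms(2)[OF s]] assms(3)[OF s] by simp
    then show "((\<lambda>s. ln (h s)) has_vector_derivative f s) (at s within {min a b..max a b})"
      by (simp add: has_real_derivative_iff_has_vector_derivative has_vector_derivative_at_within)
  qed
qed

text \<open>Turns the integrated form of the axis data and of the canonical normalization back into
  the differential equation h' = f h.\<close>

lemma has_pd_exp_LBINT:
  fixes f :: "real \<Rightarrow> real"
  assumes "open S" "continuous_on S f" "closed_segment c x \<subseteq> S"
    and "\<And>t. t \<in> S \<Longrightarrow> h t = exp ((LBINT s=ereal c..ereal t. f s) + k)"
  shows "(h has_vector_derivative f x * h x) (at x)"
proof -
  have x: "x \<in> S" using assms(3) by auto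
  have "((\<lambda>t. exp ((LBINT s=ereal c..ereal t. f s) + k)) has_real_derivative
      exp ((LBINT s=ereal c..ereal x. f s) + k) * (f x + 0)) (at x)"
    by (intro DERIV_fun_exp DERIV_add DERIV_const LBINT_has_real_derivative[OF assms(1-3)])
  then have "(h has_real_derivative exp ((LBINT s=ereal c..ereal x. f s) + k) * (f x + 0)) (at x)"
    by (rule has_field_derivative_transform_within_open[OF _ assms(1) x]) (simp add: assms(4))
  then show ?thesis
    using assms(4)[OF x] by (simp add: has_real_derivative_iff_has_vector_derivative mult.commute)
qed

context structure_data
begin

lemma smooth_phi:
  "smooth_on D (phi1 \<nu> lam \<mu>)" "smooth_on D (phi2 \<nu> lam \<mu>)"
  "smooth_on D (phi3 \<nu> lam \<mu>)" "smooth_on D (phi4 \<nu> lam \<mu>)"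
proof -
  have nz: "2 * \<mu> p * (4 * (\<nu> p)\<^sup>2 + 4 * (lam p)\<^sup>2 - 1) \<noteq> 0" if "p \<in> D" for p
    using mu_nz[OF that] disc_nz[OF that] by simp
  show "smooth_on D (phi1 \<nu> lam \<mu>)" "smooth_on D (phi2 \<nu> lam \<mu>)"
    "smooth_on D (phi3 \<nu> lam \<mu>)" "smooth_on D (phi4 \<nu> lam \<mu>)"
    unfolding phi1_def[abs_def] phi2_def[abs_def] phi3_def[abs_def] phi4_def[abs_def]
    by (rule smooth_on_divide[OF open_D nz], assumption; intro smooth_intros open_D smooth_data)+
qed

lemmas cont_phi = smooth_phi[THEN smooth_on_imp_continuous_on]

lemma axis_in_D: "(u, v) \<in> D \<Longrightarrow> (u, v0) \<in> D" "(u, v) \<in> D \<Longrightarrow> (u0, v) \<in> D"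
  using base_domainD[OF base] by auto

lemma open_axes: "open {t. (t, v) \<in> D}" "open {t. (u, t) \<in> D}"
proof -
  have "open ((\<lambda>t. (t, v)) -` D)" "open ((\<lambda>t. (u, t)) -` D)"
    by (intro continuous_open_vimage open_D continuous_intros)+
  then show "open {t. (t, v) \<in> D}" "open {t. (u, t) \<in> D}" by (simp_all add: vimage_def)
qed

lemma segments_in_D:
  assumes "(u, v) \<in> D"
  shows "closed_segment u0 u \<subseteq> {t. (t, v) \<in> D}" "closed_segment v0 v \<subseteq> {t. (u, t) \<in> D}"
  using base_domainD[OF base assms] by auto

lemma cont_lines:
  fixes f :: "real \<times> real \<Rightarrow> real"
  assumes "continuous_on D f"
  shows "continuous_on {t. (t, v) \<in> D} (\<lambda>t. f (t, v))" "continuous_on {t. (u, t) \<in> D} (\<lambda>t. f (u, t))"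
  by (intro continuous_on_compose2[OF assms]; auto intro!: continuous_intros)+

end

section \<open>Axis data and the canonical normalization\<close>

text \<open>\<open>P_axis\<close> and \<open>Q_axis\<close> are the initial conditions with g_1 and
  g_2. They give P/Q = exp(c2 - c1) = c at the base point, which explains the value of
  \<open>c\<close>.\<close>

locale canonical_data = structure_data +
  fixes c1 c2 c :: real
  assumes c: "c = exp (c2 - c1)"
    and P_axis: "\<And>u. (u, v0) \<in> D \<Longrightarrow> P (u, v0) = exp ((LBINT t=ereal u0..ereal u.
            c * phi3 \<nu> lam \<mu> (t, v0) + phi4 \<nu> lam \<mu> (t, v0)) - c1)"
    and Q_axis: "\<And>v. (u0, v) \<in> D \<Longrightarrow> Q (u0, v) = exp ((LBINT s=ereal v0..ereal v.
            phi1 \<nu> lam \<mu> (u0, s) + 1 / c * phi2 \<nu> lam \<mu> (u0, s)) - c2)"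
begin

abbreviation "\<phi>1 \<equiv> phi1 \<nu> lam \<mu>"
abbreviation "\<phi>2 \<equiv> phi2 \<nu> lam \<mu>"
abbreviation "\<phi>3 \<equiv> phi3 \<nu> lam \<mu>"
abbreviation "\<phi>4 \<equiv> phi4 \<nu> lam \<mu>"

lemma c_pos: "c > 0" using c by simp

lemma base_values: "P (u0, v0) = exp (- c1)" "Q (u0, v0) = exp (- c2)"
  using P_axis[OF base_in_D] Q_axis[OF base_in_D] by (simp_all add: interval_integral_endpoints_same)

text \<open>On this axis P_u = (c \<phi>3 + \<phi>4) P by the choice of g_1 and Q_u = \<phi>3 P +
  \<phi>4 Q, so P - c Q satisfies a homogeneous equation with coefficient \<phi>4 and vanishes at
  the base point.\<close>

lemma P_eq_on_u_axis:
  assumes "(u, v0) \<in> D"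
  shows "P (u, v0) = c * Q (u, v0)"
proof -
  \<comment> \<open>Extended constantly in v, the function of one variable becomes a degenerate
    characteristic problem whose first unknown is zero.\<close>
  define g :: "real \<times> real \<Rightarrow> real" where "g = (\<lambda>p. P (fst p, v0) - c * Q (fst p, v0))"
  have inD: "(fst p, v0) \<in> D" if "p \<in> D" for p
    using axis_in_D(1)[of "fst p" "snd p"] that by simp
  have on_axis: "continuous_on D (\<lambda>p. k (fst p, v0))" if "continuous_on D k" for k :: "real \<times> real \<Rightarrow> real"
    by (intro continuous_on_compose2[OF that]) (use inD in \<open>auto intro!: continuous_intros\<close>)
  note cont = smooth_data[THEN smooth_on_imp_continuous_on]
  have "(\<lambda>p. 0::real) (u, v0) = 0 \<and> g (u, v0) = 0"
  proof (rule characteristic_problem_zero[OF base, where ?a1.0="\<lambda>p. 0" and ?a2.0="\<lambda>p. 0" and ?a3.0="\<lambda>p. 0" and ?a4.0="\<lambda>p. \<phi>4 (fst p, v0)"])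
    show "continuous_on D g" unfolding g_def by (intro continuous_intros on_axis cont)
    show "continuous_on D (\<lambda>p. \<phi>4 (fst p, v0))" by (intro on_axis cont_phi)
    show "has_pd dv (\<lambda>p. 0) (0 * 0 + 0 * g p) p" for p using has_pd_const[of dv 0 p] by simp
    show "has_pd du g (0 * 0 + \<phi>4 (fst p, v0) * g p) p" if p: "p \<in> D" for p
    proof -
      let ?u = "fst p"
      have P': "((\<lambda>u. P (u, v0)) has_vector_derivative (c * \<phi>3 (?u, v0) + \<phi>4 (?u, v0)) * P (?u, v0)) (at ?u)"
        by (rule has_pd_exp_LBINT[OF open_axes(1) _ segments_in_D(1)[OF inD[OF p]], where k="- c1"])
          (auto intro!: continuous_intros cont_lines cont_phi simp: P_axis)
      have Q': "((\<lambda>u. Q (u, v0)) has_vector_derivative pdu Q (?u, v0)) (at ?u)"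
        using data_du(5)[OF inD[OF p]] by (simp add: has_pd_du_iff)
      have "((\<lambda>u. P (u, v0) - c * Q (u, v0)) has_vector_derivative
        (c * \<phi>3 (?u, v0) + \<phi>4 (?u, v0)) * P (?u, v0) - c * pdu Q (?u, v0)) (at ?u)"
        by (intro has_vector_derivative_diff has_vector_derivative_mult_right P' Q')
      then show ?thesis
        unfolding has_pd_du_iff g_def Q_u[OF inD[OF p]] by (simp add: algebra_simps)
    qed
    show "g (u0, v) = 0" for v by (simp add: g_def base_values c exp_add[symmetric])
  qed (use assms in auto)
  then show ?thesis by (simp add: g_def)
qed

text \<open>Here P_v comes from the system and Q_v from g_2; the terms with \<phi>2 cancel in P - c
  Q, leaving a homogeneous equation with coefficient \<phi>1.\<close>

lemma P_eq_on_v_axis: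
  assumes "(u0, v) \<in> D"
  shows "P (u0, v) = c * Q (u0, v)"
proof -
  define f :: "real \<times> real \<Rightarrow> real" where "f = (\<lambda>p. P (u0, snd p) - c * Q (u0, snd p))"
  have inD: "(u0, snd p) \<in> D" if "p \<in> D" for p
    using axis_in_D(2)[of "fst p" "snd p"] that by simp
  have on_axis: "continuous_on D (\<lambda>p. k (u0, snd p))" if "continuous_on D k" for k :: "real \<times> real \<Rightarrow> real"
    by (intro continuous_on_compose2[OF that]) (use inD in \<open>auto intro!: continuous_intros\<close>)
  note cont = smooth_data[THEN smooth_on_imp_continuous_on]
  have "f (u0, v) = 0 \<and> (\<lambda>p. 0::real) (u0, v) = 0"
  proof (rule characteristic_problem_zero[OF base, where ?a1.0="\<lambda>p. \<phi>1 (u0, snd p)" and ?a2.0="\<lambda>p. 0" and ?a3.0="\<lambda>p. 0" and ?a4.0="\<lambda>p. 0"])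
    show "continuous_on D f" unfolding f_def by (intro continuous_intros on_axis cont)
    show "continuous_on D (\<lambda>p. \<phi>1 (u0, snd p))" by (intro on_axis cont_phi)
    show "has_pd du (\<lambda>p. 0) (0 * f p + 0 * 0) p" for p using has_pd_const[of du 0 p] by simp
    show "has_pd dv f (\<phi>1 (u0, snd p) * f p + 0 * 0) p" if p: "p \<in> D" for p
    proof -
      let ?v = "snd p"
      have Q': "((\<lambda>v. Q (u0, v)) has_vector_derivative (\<phi>1 (u0, ?v) + 1 / c * \<phi>2 (u0, ?v)) * Q (u0, ?v)) (at ?v)"
        by (rule has_pd_exp_LBINT[OF open_axes(2) _ segments_in_D(2)[OF inD[OF p]], where k="- c2"])
          (use c_pos in \<open>auto intro!: continuous_intros cont_lines cont_phi simp: Q_axis\<close>)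
      have P': "((\<lambda>v. P (u0, v)) has_vector_derivative pdv P (u0, ?v)) (at ?v)"
        using data_dv(4)[OF inD[OF p]] by (simp add: has_pd_dv_iff)
      have "((\<lambda>v. P (u0, v) - c * Q (u0, v)) has_vector_derivative
        pdv P (u0, ?v) - c * ((\<phi>1 (u0, ?v) + 1 / c * \<phi>2 (u0, ?v)) * Q (u0, ?v))) (at ?v)"
        by (intro has_vector_derivative_diff has_vector_derivative_mult_right P' Q')
      then show ?thesis
        unfolding has_pd_dv_iff f_def P_v[OF inD[OF p]] using c_pos by (simp add: algebra_simps)
    qed
    show "f (u, v0) = 0" for u by (simp add: f_def base_values c exp_add[symmetric])
  qed (use assms in auto)
  then show ?thesis by (simp add: f_def)
qed

text \<open>The integrands are (ln P)_v and (ln Q)_u, so each integral is a difference of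
  logarithms. The two integrals meet at a corner on an axis, where P = c Q converts one logarithm
  into the other, and the base values absorb c1 and c2.\<close>

lemma canonical_integrals:
  assumes E: "\<And>p. p \<in> D \<Longrightarrow> fE z p = (P p)\<^sup>2" and G: "\<And>p. p \<in> D \<Longrightarrow> fG z p = (Q p)\<^sup>2" and p: "p \<in> D"
  shows "canon_u z \<nu> lam \<mu> u0 v0 c1 p = 1" "canon_v z \<nu> lam \<mu> u0 v0 c2 p = 1"
proof -
  obtain u v where p_eq: "p = (u, v)" by (cases p)
  then have uv: "(u, v) \<in> D" "(u, v0) \<in> D" "(u0, v) \<in> D" using p axis_in_D by auto
  have sq: "sqrt (fE z q) = P q" "sqrt (fG z q) = Q q" if "q \<in> D" for q
    using P_pos[OF that] Q_pos[OF that] E G that by auto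
  define A B where "A = (\<lambda>q. \<phi>1 q + \<phi>2 q * (sqrt (fG z q) / sqrt (fE z q)))"
    and "B = (\<lambda>q. \<phi>3 q * (sqrt (fE z q) / sqrt (fG z q)) + \<phi>4 q)"
  have A: "A q = pdv P q / P q" and B: "B q = pdu Q q / Q q" if q: "q \<in> D" for q
    using P_nz[OF q] Q_nz[OF q] by (simp_all add: A_def B_def sq q P_v Q_u field_simps)
  note cont_uv = smooth_on_imp_continuous_on[OF smooth_on_pdv[OF smooth_data(4)]]
    smooth_on_imp_continuous_on[OF smooth_on_pdu[OF smooth_data(5)]]
  have IA: "(LBINT s=ereal v0..ereal y. A (x, s)) = ln (P (x, y)) - ln (P (x, v0))" if xy: "(x, y) \<in> D" for x y
  proof (rule LBINT_log_derivative[where h="\<lambda>s. P (x, s)" and h'="\<lambda>s. pdv P (x, s)"])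
    fix s assume "s \<in> closed_segment v0 y"
    then have "(x, s) \<in> D" using segments_in_D(2)[OF xy] by auto
    then show "P (x, s) > 0" "A (x, s) = pdv P (x, s) / P (x, s)"
      "((\<lambda>s. P (x, s)) has_real_derivative pdv P (x, s)) (at s)"
      using P_pos A data_dv(4) by (auto simp: has_pd_dv_iff has_real_derivative_iff_has_vector_derivative)
  qed (rule continuous_on_subset[OF cont_lines(2)[OF cont_uv(1)] segments_in_D(2)[OF xy]])
  have IB: "(LBINT t=ereal u0..ereal x. B (t, y)) = ln (Q (x, y)) - ln (Q (u0, y))" if xy: "(x, y) \<in> D" for x y
  proof (rule LBINT_log_derivative[where h="\<lambda>t. Q (t, y)" and h'="\<lambda>t. pdu Q (t, y)"])
    fix t assume "t \<in> closed_segment u0 x"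
    then have "(t, y) \<in> D" using segments_in_D(1)[OF xy] by auto
    then show "Q (t, y) > 0" "B (t, y) = pdu Q (t, y) / Q (t, y)"
      "((\<lambda>t. Q (t, y)) has_real_derivative pdu Q (t, y)) (at t)"
      using Q_pos B data_du(5) by (auto simp: has_pd_du_iff has_real_derivative_iff_has_vector_derivative)
  qed (rule continuous_on_subset[OF cont_lines(1)[OF cont_uv(2)] segments_in_D(1)[OF xy]])
  note pos = P_pos[OF uv(1)] P_pos[OF uv(2)] P_pos[OF uv(3)] Q_pos[OF uv(1)] Q_pos[OF uv(2)] Q_pos[OF uv(3)] c_pos
  have lnc: "ln c = c2 - c1" by (simp add: c)
  have "ln (P (u, v0)) = ln c + ln (Q (u, v0))" "ln (P (u0, v)) = ln c + ln (Q (u0, v))"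
    using pos by (simp_all add: P_eq_on_u_axis P_eq_on_v_axis uv ln_mult)
  then have ax: "ln (P (u, v0)) = c2 - c1 + ln (Q (u, v0))" "ln (P (u0, v)) = c2 - c1 + ln (Q (u0, v))"
    by (simp_all add: lnc)
  have bv: "ln (P (u0, v0)) = - c1" "ln (Q (u0, v0)) = - c2" by (simp_all add: base_values)
  have "canon_u z \<nu> lam \<mu> u0 v0 c1 p = P (u, v) * exp (- ln (P (u, v)))"
    unfolding canon_u_def Let_def p_eq fst_conv snd_conv A_def[symmetric] B_def[symmetric] IA[OF uv(1)] IB[OF uv(2)] sq[OF uv(1)]
    by (simp add: ax bv)
  then show "canon_u z \<nu> lam \<mu> u0 v0 c1 p = 1" using pos by (simp add: exp_minus)
  have "canon_v z \<nu> lam \<mu> u0 v0 c2 p = Q (u, v) * exp (- ln (Q (u, v)))"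
    unfolding canon_v_def Let_def p_eq fst_conv snd_conv A_def[symmetric] B_def[symmetric] IA[OF uv(3)] IB[OF uv(1)] sq[OF uv(1)]
    by (simp add: ax bv)
  then show "canon_v z \<nu> lam \<mu> u0 v0 c2 p = 1" using pos by (simp add: exp_minus)
qed

text \<open>Solved for P' = sqrt E and Q' = sqrt G, the normalization expresses them by their own
  integrals. Differentiating the integral with moving endpoint gives the equations of
  \<open>P\<close> and \<open>Q\<close>, and on the axes the data agree, so the differences solve a
  characteristic problem with zero data.\<close>

lemma fundamental_form_determined:
  assumes trapped: "marginally_trapped D z"
    and canon_u: "\<And>p. p \<in> D \<Longrightarrow> canon_u z \<nu> lam \<mu> u0 v0 c1 p = 1"
    and canon_v: "\<And>p. p \<in> D \<Longrightarrow> canon_v z \<nu> lam \<mu> u0 v0 c2 p = 1"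
    and p: "p \<in> D"
  shows "fE z p = (P p)\<^sup>2" "fG z p = (Q p)\<^sup>2"
proof -
  have smz: "smooth_on D z" and
    pos: "\<And>q r s. q \<in> D \<Longrightarrow> (r, s) \<noteq> (0, 0) \<Longrightarrow> mink (r *\<^sub>R pdu z q + s *\<^sub>R pdv z q) (r *\<^sub>R pdu z q + s *\<^sub>R pdv z q) > 0"
    using trapped unfolding marginally_trapped_def spacelike_surface_def by blast+
  have Epos: "fE z q > 0" and Gpos: "fG z q > 0" if "q \<in> D" for q
    using pos[OF that, of 1 0] pos[OF that, of 0 1] by (simp_all add: fE_def fG_def)
  define P' Q' where "P' = (\<lambda>q. sqrt (fE z q))" and "Q' = (\<lambda>q. sqrt (fG z q))"
  have P'_pos: "P' q > 0" and Q'_pos: "Q' q > 0" if "q \<in> D" for q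
    using Epos[OF that] Gpos[OF that] by (simp_all add: P'_def Q'_def)
  have "continuous_on D (fE z)" "continuous_on D (fG z)"
    unfolding fE_def[abs_def] fG_def[abs_def]
    by (intro smooth_on_imp_continuous_on smooth_intros open_D smz)+
  then have cont: "continuous_on D P'" "continuous_on D Q'"
    unfolding P'_def Q'_def by (auto intro!: continuous_intros)
  define A B where "A = (\<lambda>q. \<phi>1 q + \<phi>2 q * (Q' q / P' q))" and "B = (\<lambda>q. \<phi>3 q * (P' q / Q' q) + \<phi>4 q)"
  have contA: "continuous_on D A" and contB: "continuous_on D B"
    unfolding A_def B_def using P'_pos Q'_pos
    by (intro continuous_intros cont cont_phi; simp add: less_imp_neq[symmetric])+
  have solve: "x = exp (- k)" if "x * exp k = 1" for x k :: real
    using that by (simp add: exp_minus field_simps)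
  have P'_eq: "P' (u, v) = exp ((LBINT s=ereal v0..ereal v. A (u, s)) + ((LBINT t=ereal u0..ereal u. B (t, v0)) - c1))"
    and Q'_eq: "Q' (u, v) = exp ((LBINT t=ereal u0..ereal u. B (t, v)) + ((LBINT s=ereal v0..ereal v. A (u0, s)) - c2))"
    if "(u, v) \<in> D" for u v
    using solve[OF canon_u[OF that, unfolded canon_u_def Let_def]] solve[OF canon_v[OF that, unfolded canon_v_def Let_def]]
    by (simp_all add: P'_def Q'_def A_def B_def algebra_simps)
  have P'_axis: "P' (u, v0) = exp ((LBINT t=ereal u0..ereal u. B (t, v0)) - c1)"
    and Q'_uaxis: "Q' (u, v0) = exp ((LBINT t=ereal u0..ereal u. B (t, v0)) - c2)" if "(u, v0) \<in> D" for u
    using P'_eq[OF that] Q'_eq[OF that] by (simp_all add: interval_integral_endpoints_same)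
  have Q'_axis: "Q' (u0, v) = exp ((LBINT s=ereal v0..ereal v. A (u0, s)) - c2)"
    and P'_vaxis: "P' (u0, v) = exp ((LBINT s=ereal v0..ereal v. A (u0, s)) - c1)" if "(u0, v) \<in> D" for v
    using P'_eq[OF that] Q'_eq[OF that] by (simp_all add: interval_integral_endpoints_same)
  \<comment> \<open>On an axis both formulas contain the same remaining integral, so it drops out of
    the quotient. The integrands there become those of g_1 and g_2.\<close>
  have ratio_u: "P' (u, v0) / Q' (u, v0) = c" if "(u, v0) \<in> D" for u
    unfolding P'_axis[OF that] Q'_uaxis[OF that] c by (simp add: exp_diff)
  have ratio_v: "Q' (u0, v) / P' (u0, v) = 1 / c" if "(u0, v) \<in> D" for v
    unfolding Q'_axis[OF that] P'_vaxis[OF that] c by (simp add: exp_diff)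
  have in_seg: "x \<in> closed_segment a b" if "x \<in> einterval (min (ereal a) (ereal b)) (max (ereal a) (ereal b))" for x a b
    using that by (auto simp: einterval_def closed_segment_eq_real_ivl min_def max_def split: if_splits)
  have P'_P: "P' (u, v0) = P (u, v0)" if u: "(u, v0) \<in> D" for u
  proof -
    have "(LBINT t=ereal u0..ereal u. B (t, v0)) = (LBINT t=ereal u0..ereal u. c * \<phi>3 (t, v0) + \<phi>4 (t, v0))"
    proof (rule interval_integral_cong)
      fix t assume "t \<in> einterval (min (ereal u0) (ereal u)) (max (ereal u0) (ereal u))"
      then have "(t, v0) \<in> D" using in_seg segments_in_D(1)[OF u] by blast
      then show "B (t, v0) = c * \<phi>3 (t, v0) + \<phi>4 (t, v0)" unfolding B_def by (subst ratio_u) simp_all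
    qed
    then show ?thesis using P'_axis[OF u] P_axis[OF u] by simp
  qed
  have Q'_Q: "Q' (u0, v) = Q (u0, v)" if v: "(u0, v) \<in> D" for v
  proof -
    have "(LBINT s=ereal v0..ereal v. A (u0, s)) = (LBINT s=ereal v0..ereal v. \<phi>1 (u0, s) + 1 / c * \<phi>2 (u0, s))"
    proof (rule interval_integral_cong)
      fix s assume "s \<in> einterval (min (ereal v0) (ereal v)) (max (ereal v0) (ereal v))"
      then have "(u0, s) \<in> D" using in_seg segments_in_D(2)[OF v] by blast
      then show "A (u0, s) = \<phi>1 (u0, s) + 1 / c * \<phi>2 (u0, s)" unfolding A_def by (subst ratio_v) simp_all
    qed
    then show ?thesis using Q'_axis[OF v] Q_axis[OF v] by simp
  qed
  have "(\<lambda>q. P' q - P q) p = 0 \<and> (\<lambda>q. Q' q - Q q) p = 0"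
  proof (rule characteristic_problem_zero[OF base _ _ cont_phi _ _ _ _ p])
    show "continuous_on D (\<lambda>q. P' q - P q)" "continuous_on D (\<lambda>q. Q' q - Q q)"
      by (intro continuous_intros cont smooth_on_imp_continuous_on smooth_data)+
    fix q assume q: "q \<in> D"
    obtain u v where uv: "q = (u, v)" by (cases q)
    have "((\<lambda>s. P' (u, s)) has_vector_derivative A (u, v) * P' (u, v)) (at v)"
      by (rule has_pd_exp_LBINT[OF open_axes(2) cont_lines(2)[OF contA] segments_in_D(2)]) (use q uv P'_eq in auto)
    then have "has_pd dv P' (A q * P' q) q" by (simp add: has_pd_dv_iff uv)
    from has_pd_diff[OF this data_dv(4)[OF q]]
    show "has_pd dv (\<lambda>q. P' q - P q) (\<phi>1 q * (P' q - P q) + \<phi>2 q * (Q' q - Q q)) q"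
      by (rule has_pd_eq_rhs) (use P'_pos[OF q] in \<open>simp add: A_def P_v[OF q] field_simps\<close>)
    have "((\<lambda>t. Q' (t, v)) has_vector_derivative B (u, v) * Q' (u, v)) (at u)"
      by (rule has_pd_exp_LBINT[OF open_axes(1) cont_lines(1)[OF contB] segments_in_D(1)]) (use q uv Q'_eq in auto)
    then have "has_pd du Q' (B q * Q' q) q" by (simp add: has_pd_du_iff uv)
    from has_pd_diff[OF this data_du(5)[OF q]]
    show "has_pd du (\<lambda>q. Q' q - Q q) (\<phi>3 q * (P' q - P q) + \<phi>4 q * (Q' q - Q q)) q"
      by (rule has_pd_eq_rhs) (use Q'_pos[OF q] in \<open>simp add: B_def Q_u[OF q] field_simps\<close>)
  qed (use P'_P Q'_Q in auto)
  then have "P p = sqrt (fE z p)" "Q p = sqrt (fG z p)" by (auto simp: P'_def Q'_def)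
  then show "fE z p = (P p)\<^sup>2" "fG z p = (Q p)\<^sup>2"
    using Epos[OF p] Gpos[OF p] by simp_all
qed

end

section \<open>Uniqueness of the surface\<close>

text \<open>A vector not orthogonal to \<open>n\<close> exists by nondegeneracy; removing its
  tangential part and scaling gives \<open>k\<close> orthogonal to x and y with <n, k> = -1.\<close>

lemma null_frame_completion:
  assumes "mink x x = 1" "mink y y = 1" "mink x y = 0" "mink x n = 0" "mink y n = 0" "mink n n = 0" "n \<noteq> 0"
  shows "\<exists>m. null_frame x y n m"
proof -
  have "\<exists>w. mink n w \<noteq> 0"
  proof (rule ccontr)
    assume "\<not> (\<exists>w. mink n w \<noteq> 0)"
    then have "mink n (axis i 1) = 0" for i by blast
    from this[of 1] this[of 2] this[of 3] this[of 4] have "n = 0"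
      by (simp add: mink_def axis_def vec_eq_iff forall_4)
    then show False using assms(7) by blast
  qed
  then obtain w where w: "mink n w \<noteq> 0" by blast
  define k where "k = (- 1 / mink n w) *\<^sub>R (w - mink x w *\<^sub>R x - mink y w *\<^sub>R y)"
  note f = assms(1-6) mink_commute[of y x] mink_commute[of n x] mink_commute[of n y]
  have k: "mink x k = 0" "mink y k = 0" "mink n k = - 1" "mink k n = - 1"
    using w by (simp_all add: k_def mink_simps f mink_commute[of w])
  \<comment> \<open>The square of k + t n is <k, k> - 2t, so t = <k, k>/2 makes it null.\<close>
  have "null_frame x y n (k + (mink k k / 2) *\<^sub>R n)"
    by (simp add: null_frame_def mink_simps f k)
  then show ?thesis by blast
qed

locale principal_surface = structure_data +
  fixes z :: "real \<times> real \<Rightarrow> real^4"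
  assumes trapped: "marginally_trapped D z" and principal: "principal_parameters D z \<nu> lam \<mu>"
    and E: "\<And>p. p \<in> D \<Longrightarrow> fE z p = (P p)\<^sup>2" and G: "\<And>p. p \<in> D \<Longrightarrow> fG z p = (Q p)\<^sup>2"
begin

definition "x p = inverse (P p) *\<^sub>R pdu z p"
definition "y p = inverse (Q p) *\<^sub>R pdv z p"
definition "n p = mean_curv z p"
definition "m p = n2 z p"

lemma smooth_z: "smooth_on D z"
  using trapped by (simp add: marginally_trapped_def spacelike_surface_def)

lemma smooth_xy: "smooth_on D x" "smooth_on D y"
  unfolding x_def[abs_def] y_def[abs_def] by (intro smooth_intros open_D smooth_data smooth_z P_nz Q_nz; assumption)+

lemma pd_z: "p \<in> D \<Longrightarrow> pdu z p = P p *\<^sub>R x p" "p \<in> D \<Longrightarrow> pdv z p = Q p *\<^sub>R y p"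
  using P_nz Q_nz by (simp_all add: x_def y_def)

lemma F: "p \<in> D \<Longrightarrow> fF z p = 0"
  using principal by (simp add: principal_parameters_def Let_def)

lemma xy_orthonormal:
  assumes "p \<in> D"
  shows "mink (x p) (x p) = 1" "mink (y p) (y p) = 1" "mink (x p) (y p) = 0" "mink (y p) (x p) = 0"
  using E[OF assms] G[OF assms] F[OF assms] P_nz[OF assms] Q_nz[OF assms] mink_commute[of "pdv z p" "pdu z p"]
  by (simp_all add: x_def y_def mink_simps fE_def fG_def fF_def power2_eq_square field_simps)

lemma normal_part_eq:
  assumes p: "p \<in> D"
  shows "normal_part z p w = w - mink w (x p) *\<^sub>R x p - mink w (y p) *\<^sub>R y p"
  using P_nz[OF p] Q_nz[OF p]
  by (simp add: normal_part_def tangent_part_def E F G p pd_z mink_simps power2_eq_square)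

lemma normal_part_orthogonal:
  "p \<in> D \<Longrightarrow> mink (normal_part z p w) (x p) = 0" "p \<in> D \<Longrightarrow> mink (normal_part z p w) (y p) = 0"
  by (simp_all add: normal_part_eq mink_simps xy_orthonormal)

lemma normal_second_derivatives:
  assumes p: "p \<in> D"
  shows "normal_part z p (pdu (pdu z) p) = ((P p)\<^sup>2 * (1 + \<nu> p)) *\<^sub>R n p"
    and "normal_part z p (pdv (pdu z) p) = (P p * Q p) *\<^sub>R (lam p *\<^sub>R n p + \<mu> p *\<^sub>R m p)"
    and "normal_part z p (pdv (pdv z) p) = ((Q p)\<^sup>2 * (1 - \<nu> p)) *\<^sub>R n p"
proof -
  have sq: "sqrt (fE z p) = P p" "sqrt (fG z p) = Q p"
    using P_pos[OF p] Q_pos[OF p] by (simp_all add: E G p)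
  have pr: "sigma z p (1 / P p, 0) (1 / P p, 0) = (1 + \<nu> p) *\<^sub>R n p"
    "sigma z p (1 / P p, 0) (0, 1 / Q p) = lam p *\<^sub>R n p + \<mu> p *\<^sub>R m p"
    "sigma z p (0, 1 / Q p) (0, 1 / Q p) = (1 - \<nu> p) *\<^sub>R n p"
    using principal p by (auto simp: principal_parameters_def Let_def sq n_def m_def)
  have solve: "w = k *\<^sub>R w'" if "(1 / k) *\<^sub>R w = w'" "k \<noteq> 0" for k and w w' :: "real^4"
    using that by auto
  show "normal_part z p (pdu (pdu z) p) = ((P p)\<^sup>2 * (1 + \<nu> p)) *\<^sub>R n p"
    unfolding scaleR_scaleR[symmetric]
    by (rule solve) (use pr(1) P_nz[OF p] in \<open>simp_all add: sigma_def power2_eq_square\<close>)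
  show "normal_part z p (pdv (pdu z) p) = (P p * Q p) *\<^sub>R (lam p *\<^sub>R n p + \<mu> p *\<^sub>R m p)"
    by (rule solve) (use pr(2) P_nz[OF p] Q_nz[OF p] in \<open>simp_all add: sigma_def\<close>)
  show "normal_part z p (pdv (pdv z) p) = ((Q p)\<^sup>2 * (1 - \<nu> p)) *\<^sub>R n p"
    unfolding scaleR_scaleR[symmetric]
    by (rule solve) (use pr(3) Q_nz[OF p] in \<open>simp_all add: sigma_def power2_eq_square\<close>)
qed

text \<open>The description \<open>n2\<close> says nothing until a suitable vector is known to
  exist, so a completing null vector is constructed and then identified with
  \<open>n2\<close>.\<close>

lemma frame:
  assumes p: "p \<in> D"
  shows "null_frame (x p) (y p) (n p) (m p)"
proof -
  have n: "n p = (1 / 2) *\<^sub>R (1 / ((P p)\<^sup>2 * (Q p)\<^sup>2)) *\<^sub>R ((Q p)\<^sup>2 *\<^sub>R normal_part z p (pdu (pdu z) p) + (P p)\<^sup>2 *\<^sub>R normal_part z p (pdv (pdv z) p))"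
    by (simp add: n_def mean_curv_def sigma_def E G F p)
  have "mink (n p) (x p) = 0" "mink (n p) (y p) = 0"
    by (simp_all add: n mink_simps normal_part_orthogonal p)
  then have "mink (x p) (n p) = 0" "mink (y p) (n p) = 0" using mink_commute by metis+
  moreover have "n p \<noteq> 0" "mink (n p) (n p) = 0"
    using trapped p by (auto simp: n_def marginally_trapped_def)
  ultimately obtain k where k: "null_frame (x p) (y p) (n p) k"
    using null_frame_completion xy_orthonormal[OF p] by metis
  then have "m p = k"
    unfolding m_def using n2_eqI[OF k pd_z(1)[OF p] pd_z(2)[OF p] P_nz[OF p] Q_nz[OF p]] by (simp add: n_def)
  then show ?thesis using k by simp
qed

text \<open>Being a definite description, \<open>n2\<close> gives no direct access to regularity. It
  is recovered from the normal part of z_uv, which is P Q (\<lambda> n + \<mu> m), by division by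
  \<mu>.\<close>

lemma smooth_nm: "smooth_on D n" "smooth_on D m"
proof -
  define N where "N = (\<lambda>w q. w q - mink (w q) (x q) *\<^sub>R x q - mink (w q) (y q) *\<^sub>R y q)"
  have N: "smooth_on D (N w)" if "smooth_on D w" for w
    unfolding N_def by (intro smooth_intros open_D smooth_xy that)
  have "smooth_on D (\<lambda>p. ((1 / 2) * (1 / ((P p)\<^sup>2 * (Q p)\<^sup>2))) *\<^sub>R ((Q p)\<^sup>2 *\<^sub>R N (pdu (pdu z)) p + (P p)\<^sup>2 *\<^sub>R N (pdv (pdv z)) p))"
    using P_nz Q_nz by (intro smooth_intros open_D smooth_data N smooth_z) auto
  then show n: "smooth_on D n"
    by (rule smooth_on_cong[OF open_D, rotated])
      (simp add: n_def mean_curv_def sigma_def E G F N_def normal_part_eq)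
  have "smooth_on D (\<lambda>p. (1 / \<mu> p) *\<^sub>R ((1 / (P p * Q p)) *\<^sub>R N (pdv (pdu z)) p - lam p *\<^sub>R n p))"
    using P_nz Q_nz mu_nz by (intro smooth_intros open_D smooth_data N smooth_z n) auto
  then show "smooth_on D m"
  proof (rule smooth_on_cong[OF open_D, rotated])
    fix p assume p: "p \<in> D"
    have "N (pdv (pdu z)) p = (P p * Q p) *\<^sub>R (lam p *\<^sub>R n p + \<mu> p *\<^sub>R m p)"
      using normal_second_derivatives(2)[OF p] by (simp add: N_def normal_part_eq p)
    then show "(1 / \<mu> p) *\<^sub>R ((1 / (P p * Q p)) *\<^sub>R N (pdv (pdu z)) p - lam p *\<^sub>R n p) = m p"
      using P_nz[OF p] Q_nz[OF p] mu_nz[OF p] by simp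
  qed
qed

lemma second_derivatives:
  assumes p: "p \<in> D"
  shows "pdu (pdu z) p = P p *\<^sub>R pdu x p + pdu P p *\<^sub>R x p"
    and "pdv (pdu z) p = P p *\<^sub>R pdv x p + pdv P p *\<^sub>R x p"
    and "pdv (pdu z) p = Q p *\<^sub>R pdu y p + pdu Q p *\<^sub>R y p"
    and "pdv (pdv z) p = Q p *\<^sub>R pdv y p + pdv Q p *\<^sub>R y p"
proof -
  note dx = smooth_on_has_pdu[OF open_D smooth_xy(1) p] smooth_on_has_pdv[OF open_D smooth_xy(1) p]
    and dy = smooth_on_has_pdu[OF open_D smooth_xy(2) p] smooth_on_has_pdv[OF open_D smooth_xy(2) p]
  have "pdu (pdu z) p = pdu (\<lambda>q. P q *\<^sub>R x q) p" "pdv (pdu z) p = pdv (\<lambda>q. P q *\<^sub>R x q) p"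
    "pdu (pdv z) p = pdu (\<lambda>q. Q q *\<^sub>R y q) p" "pdv (pdv z) p = pdv (\<lambda>q. Q q *\<^sub>R y q) p"
    using pdu_cong[OF open_D p, of "pdu z"] pdv_cong[OF open_D p, of "pdu z"]
      pdu_cong[OF open_D p, of "pdv z"] pdv_cong[OF open_D p, of "pdv z"] pd_z by auto
  then show "pdu (pdu z) p = P p *\<^sub>R pdu x p + pdu P p *\<^sub>R x p"
    "pdv (pdu z) p = P p *\<^sub>R pdv x p + pdv P p *\<^sub>R x p"
    "pdv (pdu z) p = Q p *\<^sub>R pdu y p + pdu Q p *\<^sub>R y p"
    "pdv (pdv z) p = Q p *\<^sub>R pdv y p + pdv Q p *\<^sub>R y p"
    using pdu_eqI[OF has_pd_scaleR[OF data_du(4)[OF p] dx(1)]] pdv_eqI[OF has_pd_scaleR[OF data_dv(4)[OF p] dx(2)]]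
      pdu_eqI[OF has_pd_scaleR[OF data_du(5)[OF p] dy(1)]] pdv_eqI[OF has_pd_scaleR[OF data_dv(5)[OF p] dy(2)]]
      smooth_on_pdv_pdu[OF open_D smooth_z p] by simp_all
qed

lemma mink_const_derivatives:
  assumes "smooth_on D f" "smooth_on D g" and const: "\<And>q. q \<in> D \<Longrightarrow> mink (f q) (g q) = k" and p: "p \<in> D"
  shows "mink (pdu f p) (g p) + mink (f p) (pdu g p) = 0" "mink (pdv f p) (g p) + mink (f p) (pdv g p) = 0"
proof -
  have "has_pd du (\<lambda>q. k) (mink (f p) (pdu g p) + mink (pdu f p) (g p)) p"
    by (rule has_pd_cong[OF open_D p const has_pd_mink]) (simp_all add: smooth_on_has_pdu[OF open_D] assms(1,2) p)
  then show "mink (pdu f p) (g p) + mink (f p) (pdu g p) = 0"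
    using has_pd_unique[OF has_pd_const] by (metis add.commute)
  have "has_pd dv (\<lambda>q. k) (mink (f p) (pdv g p) + mink (pdv f p) (g p)) p"
    by (rule has_pd_cong[OF open_D p const has_pd_mink]) (simp_all add: smooth_on_has_pdv[OF open_D] assms(1,2) p)
  then show "mink (pdv f p) (g p) + mink (f p) (pdv g p) = 0"
    using has_pd_unique[OF has_pd_const] by (metis add.commute)
qed

text \<open>Since <n, m> = -1 and both are null, pairing with \<open>n\<close> reads off minus the
  coefficient of \<open>m\<close>, and conversely.\<close>

lemma normal_components:
  assumes p: "p \<in> D"
  shows "mink (pdu x p) (n p) = 0" "mink (pdu x p) (m p) = - (P p * (1 + \<nu> p))"
    and "mink (pdv x p) (n p) = - (Q p * \<mu> p)" "mink (pdv x p) (m p) = - (Q p * lam p)"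
    and "mink (pdu y p) (n p) = - (P p * \<mu> p)" "mink (pdu y p) (m p) = - (P p * lam p)"
    and "mink (pdv y p) (n p) = 0" "mink (pdv y p) (m p) = - (Q p * (1 - \<nu> p))"
proof -
  note f = null_frameD[OF frame[OF p]]
  have nor: "mink (normal_part z p w) k = mink w k" if "k = n p \<or> k = m p" for w k
    using that by (auto simp: normal_part_eq[OF p] mink_simps f)
  note sd = second_derivatives[OF p] and ns = normal_second_derivatives[OF p]
  have "P p * mink (pdu x p) k = mink (normal_part z p (pdu (pdu z) p)) k"
    "P p * mink (pdv x p) k = mink (normal_part z p (pdv (pdu z) p)) k"
    "Q p * mink (pdu y p) k = mink (normal_part z p (pdv (pdu z) p)) k"
    "Q p * mink (pdv y p) k = mink (normal_part z p (pdv (pdv z) p)) k"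
    if "k = n p \<or> k = m p" for k
  proof -
    have k: "mink (x p) k = 0" "mink (y p) k = 0" using that by (auto simp: f)
    show "P p * mink (pdu x p) k = mink (normal_part z p (pdu (pdu z) p)) k"
      unfolding nor[OF that] sd(1) by (simp add: mink_simps k)
    show "P p * mink (pdv x p) k = mink (normal_part z p (pdv (pdu z) p)) k"
      unfolding nor[OF that] sd(2) by (simp add: mink_simps k)
    show "Q p * mink (pdu y p) k = mink (normal_part z p (pdv (pdu z) p)) k"
      unfolding nor[OF that] sd(3) by (simp add: mink_simps k)
    show "Q p * mink (pdv y p) k = mink (normal_part z p (pdv (pdv z) p)) k"
      unfolding nor[OF that] sd(4) by (simp add: mink_simps k)
  qed
  note eqs = this[unfolded ns]
  note cP = mult_left_cancel[THEN iffD1, OF P_nz[OF p]] and cQ = mult_left_cancel[THEN iffD1, OF Q_nz[OF p]]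
  show "mink (pdu x p) (n p) = 0"
    by (rule cP) (simp add: eqs(1)[of "n p"] mink_simps f power2_eq_square ac_simps)
  show "mink (pdu x p) (m p) = - (P p * (1 + \<nu> p))"
    by (rule cP) (simp add: eqs(1)[of "m p"] mink_simps f power2_eq_square ac_simps)
  show "mink (pdv x p) (n p) = - (Q p * \<mu> p)"
    by (rule cP) (simp add: eqs(2)[of "n p"] mink_simps f power2_eq_square ac_simps)
  show "mink (pdv x p) (m p) = - (Q p * lam p)"
    by (rule cP) (simp add: eqs(2)[of "m p"] mink_simps f power2_eq_square ac_simps)
  show "mink (pdu y p) (n p) = - (P p * \<mu> p)"
    by (rule cQ) (simp add: eqs(3)[of "n p"] mink_simps f power2_eq_square ac_simps)
  show "mink (pdu y p) (m p) = - (P p * lam p)"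
    by (rule cQ) (simp add: eqs(3)[of "m p"] mink_simps f power2_eq_square ac_simps)
  show "mink (pdv y p) (n p) = 0"
    by (rule cQ) (simp add: eqs(4)[of "n p"] mink_simps f power2_eq_square ac_simps)
  show "mink (pdv y p) (m p) = - (Q p * (1 - \<nu> p))"
    by (rule cQ) (simp add: eqs(4)[of "m p"] mink_simps f power2_eq_square ac_simps)
qed

lemma smooth_frame: "smooth_on D x" "smooth_on D y" "smooth_on D n" "smooth_on D m"
  using smooth_xy smooth_nm by auto

lemma gram_derivatives:
  assumes p: "p \<in> D"
  shows "mink (pdu x p) (x p) = 0" "mink (pdv x p) (x p) = 0" "mink (pdu y p) (y p) = 0" "mink (pdv y p) (y p) = 0"
    and "mink (pdu n p) (n p) = 0" "mink (pdv n p) (n p) = 0" "mink (pdu m p) (m p) = 0" "mink (pdv m p) (m p) = 0"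
    and "mink (pdu x p) (y p) = - mink (pdu y p) (x p)" "mink (pdv y p) (x p) = - mink (pdv x p) (y p)"
    and "mink (pdu n p) (x p) = - mink (pdu x p) (n p)" "mink (pdv n p) (x p) = - mink (pdv x p) (n p)"
    and "mink (pdu n p) (y p) = - mink (pdu y p) (n p)" "mink (pdv n p) (y p) = - mink (pdv y p) (n p)"
    and "mink (pdu m p) (x p) = - mink (pdu x p) (m p)" "mink (pdv m p) (x p) = - mink (pdv x p) (m p)"
    and "mink (pdu m p) (y p) = - mink (pdu y p) (m p)" "mink (pdv m p) (y p) = - mink (pdv y p) (m p)"
    and "mink (pdu m p) (n p) = - mink (pdu n p) (m p)" "mink (pdv m p) (n p) = - mink (pdv n p) (m p)"
proof -
  note const = mink_const_derivatives[OF _ _ _ p] and sm = smooth_frame and f = null_frameD[OF frame]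
  note swap = mink_commute[of "x p"] mink_commute[of "y p"] mink_commute[of "n p"] mink_commute[of "m p"]
  show "mink (pdu x p) (x p) = 0" "mink (pdv x p) (x p) = 0"
    using const[OF sm(1,1) f(1)] unfolding swap by simp_all
  show "mink (pdu y p) (y p) = 0" "mink (pdv y p) (y p) = 0"
    using const[OF sm(2,2) f(2)] unfolding swap by simp_all
  show "mink (pdu n p) (n p) = 0" "mink (pdv n p) (n p) = 0"
    using const[OF sm(3,3) f(13)] unfolding swap by simp_all
  show "mink (pdu m p) (m p) = 0" "mink (pdv m p) (m p) = 0"
    using const[OF sm(4,4) f(14)] unfolding swap by simp_all
  show "mink (pdu x p) (y p) = - mink (pdu y p) (x p)" "mink (pdv y p) (x p) = - mink (pdv x p) (y p)"
    using const[OF sm(1,2) f(3)] unfolding swap by simp_all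
  show "mink (pdu n p) (x p) = - mink (pdu x p) (n p)" "mink (pdv n p) (x p) = - mink (pdv x p) (n p)"
    using const[OF sm(1,3) f(5)] unfolding swap by simp_all
  show "mink (pdu n p) (y p) = - mink (pdu y p) (n p)" "mink (pdv n p) (y p) = - mink (pdv y p) (n p)"
    using const[OF sm(2,3) f(9)] unfolding swap by simp_all
  show "mink (pdu m p) (x p) = - mink (pdu x p) (m p)" "mink (pdv m p) (x p) = - mink (pdv x p) (m p)"
    using const[OF sm(1,4) f(7)] unfolding swap by simp_all
  show "mink (pdu m p) (y p) = - mink (pdu y p) (m p)" "mink (pdv m p) (y p) = - mink (pdv y p) (m p)"
    using const[OF sm(2,4) f(11)] unfolding swap by simp_all
  show "mink (pdu m p) (n p) = - mink (pdu n p) (m p)" "mink (pdv m p) (n p) = - mink (pdv n p) (m p)"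
    using const[OF sm(3,4) f(15)] unfolding swap by simp_all
qed

text \<open>The mixed derivative z_uv is computed both as (P x)_v and as (Q y)_u; pairing the two
  with y and x isolates the tangential coefficients.\<close>

lemma connection_components:
  assumes p: "p \<in> D"
  shows "mink (pdv x p) (y p) = b p" "mink (pdu y p) (x p) = a p"
proof -
  note f = null_frameD[OF frame[OF p]] and g = gram_derivatives[OF p]
  have "P p *\<^sub>R pdv x p + pdv P p *\<^sub>R x p = Q p *\<^sub>R pdu y p + pdu Q p *\<^sub>R y p"
    using second_derivatives(2,3)[OF p] by simp
  then have "mink (P p *\<^sub>R pdv x p + pdv P p *\<^sub>R x p) k = mink (Q p *\<^sub>R pdu y p + pdu Q p *\<^sub>R y p) k" for k
    by simp
  from this[of "y p"] this[of "x p"] show "mink (pdv x p) (y p) = b p" "mink (pdu y p) (x p) = a p"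
    using P_nz[OF p] Q_nz[OF p] by (simp_all add: mink_simps f g P_v_eq[OF p] Q_u_eq[OF p])
qed

lemma expand:
  assumes "p \<in> D"
  shows "w = mink w (x p) *\<^sub>R x p + mink w (y p) *\<^sub>R y p - mink w (m p) *\<^sub>R n p - mink w (n p) *\<^sub>R m p"
  using null_frame_expansion[OF frame[OF assms], of w] mink_commute by metis

lemma tangent_derivatives:
  assumes p: "p \<in> D"
  shows "pdu x p = - a p *\<^sub>R y p + (P p * (1 + \<nu> p)) *\<^sub>R n p"
    "pdv x p = b p *\<^sub>R y p + (Q p * lam p) *\<^sub>R n p + (Q p * \<mu> p) *\<^sub>R m p"
    "pdu y p = a p *\<^sub>R x p + (P p * lam p) *\<^sub>R n p + (P p * \<mu> p) *\<^sub>R m p"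
    "pdv y p = - b p *\<^sub>R x p + (Q p * (1 - \<nu> p)) *\<^sub>R n p"
proof -
  note comps = gram_derivatives[OF p] connection_components[OF p] normal_components[OF p]
  show "pdu x p = - a p *\<^sub>R y p + (P p * (1 + \<nu> p)) *\<^sub>R n p"
    using expand[OF p, of "pdu x p"] by (simp add: comps)
  show "pdv x p = b p *\<^sub>R y p + (Q p * lam p) *\<^sub>R n p + (Q p * \<mu> p) *\<^sub>R m p"
    using expand[OF p, of "pdv x p"] by (simp add: comps)
  show "pdu y p = a p *\<^sub>R x p + (P p * lam p) *\<^sub>R n p + (P p * \<mu> p) *\<^sub>R m p"
    using expand[OF p, of "pdu y p"] by (simp add: comps)
  show "pdv y p = - b p *\<^sub>R x p + (Q p * (1 - \<nu> p)) *\<^sub>R n p"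
    using expand[OF p, of "pdv y p"] by (simp add: comps)
qed

text \<open>The component along the null direction \<open>n\<close> of the Codazzi equation, obtained from the symmetry of
  the mixed derivatives of \<open>x\<close> and \<open>y\<close>, determines the normal connection.\<close>

lemma normal_connection:
  assumes p: "p \<in> D"
  shows "mink (pdu n p) (m p) = - k1 p" "mink (pdv n p) (m p) = - k2 p"
proof -
  note f = null_frameD[OF frame[OF p]] and t = tangent_derivatives[OF p] and g = gram_derivatives[OF p]
    and nc = normal_components[OF p]
  have dn: "has_pd du n (pdu n p) p" "has_pd dv n (pdv n p) p"
    using smooth_on_has_pdu[OF open_D smooth_frame(3) p] smooth_on_has_pdv[OF open_D smooth_frame(3) p] by blast+
  have dk: "has_pd du (pdv k) (pdu (pdv k) p) p" "has_pd dv (pdu k) (pdu (pdv k) p) p" if "smooth_on D k" for k :: "real \<times> real \<Rightarrow> real^4"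
    using smooth_on_has_pdu[OF open_D smooth_on_pdv[OF that] p] smooth_on_has_pdv[OF open_D smooth_on_pdu[OF that] p]
    by (simp_all add: smooth_on_pdv_pdu[OF open_D that p])
  \<comment> \<open><x_v, n> is differentiated in u and <x_u, n> in v; subtraction eliminates the
    mixed derivative of \<open>x\<close>.\<close>
  have U: "mink (pdv x p) (pdu n p) + mink (pdu (pdv x) p) (n p) = - (Q p * pdu \<mu> p + pdu Q p * \<mu> p)"
    by (rule has_pd_unique[OF has_pd_cong[OF open_D p normal_components(3) has_pd_mink[OF dk(1)[OF smooth_frame(1)] dn(1)]]], assumption)
      (intro pd_intros data_du p)
  moreover have "mink (pdu x p) (pdv n p) + mink (pdu (pdv x) p) (n p) = 0"
    by (rule has_pd_unique[OF has_pd_cong[OF open_D p normal_components(1) has_pd_mink[OF dk(2)[OF smooth_frame(1)] dn(2)]]], assumption)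
      (intro pd_intros)
  ultimately have "mink (pdv x p) (pdu n p) - mink (pdu x p) (pdv n p) = - (Q p * pdu \<mu> p + pdu Q p * \<mu> p)" by linarith
  moreover have "mink (pdv x p) (pdu n p) = b p * (P p * \<mu> p) + Q p * \<mu> p * mink (pdu n p) (m p)"
    "mink (pdu x p) (pdv n p) = 0"
    using g(5,6) g(13,14) nc(5,7)
    by (simp_all add: t mink_simps mink_commute[of _ "pdu n p"] mink_commute[of _ "pdv n p"])
  ultimately have "Q p * \<mu> p * mink (pdu n p) (m p) = Q p * \<mu> p * (- k1 p)"
    using k1_eq[OF p] Q_u_eq[OF p] by (simp add: algebra_simps)
  then show "mink (pdu n p) (m p) = - k1 p" using Q_nz[OF p] mu_nz[OF p] by (metis mult_cancel_left mult_eq_0_iff)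
  have "mink (pdu y p) (pdv n p) + mink (pdu (pdv y) p) (n p) = - (P p * pdv \<mu> p + pdv P p * \<mu> p)"
    by (rule has_pd_unique[OF has_pd_cong[OF open_D p normal_components(5) has_pd_mink[OF dk(2)[OF smooth_frame(2)] dn(2)]]], assumption)
      (intro pd_intros data_dv p)
  moreover have "mink (pdv y p) (pdu n p) + mink (pdu (pdv y) p) (n p) = 0"
    by (rule has_pd_unique[OF has_pd_cong[OF open_D p normal_components(7) has_pd_mink[OF dk(1)[OF smooth_frame(2)] dn(1)]]], assumption)
      (intro pd_intros)
  ultimately have "mink (pdu y p) (pdv n p) - mink (pdv y p) (pdu n p) = - (P p * pdv \<mu> p + pdv P p * \<mu> p)" by linarith
  moreover have "mink (pdu y p) (pdv n p) = a p * (Q p * \<mu> p) + P p * \<mu> p * mink (pdv n p) (m p)"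
    "mink (pdv y p) (pdu n p) = 0"
    using g(5,6) g(11,12) nc(1,3)
    by (simp_all add: t mink_simps mink_commute[of _ "pdu n p"] mink_commute[of _ "pdv n p"])
  ultimately have "P p * \<mu> p * mink (pdv n p) (m p) = P p * \<mu> p * (- k2 p)"
    using k2_eq[OF p] P_v_eq[OF p] by (simp add: algebra_simps)
  then show "mink (pdv n p) (m p) = - k2 p" using P_nz[OF p] mu_nz[OF p] by (metis mult_cancel_left mult_eq_0_iff)
qed

lemma normal_derivatives:
  assumes p: "p \<in> D"
  shows "pdu n p = (P p * \<mu> p) *\<^sub>R y p + k1 p *\<^sub>R n p"
    "pdv n p = (Q p * \<mu> p) *\<^sub>R x p + k2 p *\<^sub>R n p"
    "pdu m p = (P p * (1 + \<nu> p)) *\<^sub>R x p + (P p * lam p) *\<^sub>R y p - k1 p *\<^sub>R m p"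
    "pdv m p = (Q p * lam p) *\<^sub>R x p + (Q p * (1 - \<nu> p)) *\<^sub>R y p - k2 p *\<^sub>R m p"
proof -
  note comps = gram_derivatives[OF p] normal_connection[OF p] normal_components[OF p]
  show "pdu n p = (P p * \<mu> p) *\<^sub>R y p + k1 p *\<^sub>R n p"
    using expand[OF p, of "pdu n p"] by (simp add: comps)
  show "pdv n p = (Q p * \<mu> p) *\<^sub>R x p + k2 p *\<^sub>R n p"
    using expand[OF p, of "pdv n p"] by (simp add: comps)
  show "pdu m p = (P p * (1 + \<nu> p)) *\<^sub>R x p + (P p * lam p) *\<^sub>R y p - k1 p *\<^sub>R m p"
    using expand[OF p, of "pdu m p"] by (simp add: comps)
  show "pdv m p = (Q p * lam p) *\<^sub>R x p + (Q p * (1 - \<nu> p)) *\<^sub>R y p - k2 p *\<^sub>R m p"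
    using expand[OF p, of "pdv m p"] by (simp add: comps)
qed

lemma adapted: "adapted_frame D u0 v0 \<nu> lam \<mu> P Q x y n m z"
proof unfold_locales
  show "frame_eqs x y n m"
    unfolding frame_eqs_def
  proof
    fix p assume p: "p \<in> D"
    note du = smooth_frame[THEN smooth_on_has_pdu[OF open_D _ p]]
      and dv = smooth_frame[THEN smooth_on_has_pdv[OF open_D _ p]]
    show "has_pd du x (- a p *\<^sub>R y p + (P p * (1 + \<nu> p)) *\<^sub>R n p) p \<and>
      has_pd dv x (b p *\<^sub>R y p + (Q p * lam p) *\<^sub>R n p + (Q p * \<mu> p) *\<^sub>R m p) p \<and>
      has_pd du y (a p *\<^sub>R x p + (P p * lam p) *\<^sub>R n p + (P p * \<mu> p) *\<^sub>R m p) p \<and>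
      has_pd dv y (- b p *\<^sub>R x p + (Q p * (1 - \<nu> p)) *\<^sub>R n p) p \<and>
      has_pd du n ((P p * \<mu> p) *\<^sub>R y p + k1 p *\<^sub>R n p) p \<and>
      has_pd dv n ((Q p * \<mu> p) *\<^sub>R x p + k2 p *\<^sub>R n p) p \<and>
      has_pd du m ((P p * (1 + \<nu> p)) *\<^sub>R x p + (P p * lam p) *\<^sub>R y p - k1 p *\<^sub>R m p) p \<and>
      has_pd dv m ((Q p * lam p) *\<^sub>R x p + (Q p * (1 - \<nu> p)) *\<^sub>R y p - k2 p *\<^sub>R m p) p"
      unfolding tangent_derivatives[OF p, symmetric] normal_derivatives[OF p, symmetric] using du dv by blast
  qed
  show "has_pd du z (P p *\<^sub>R x p) p" "has_pd dv z (Q p *\<^sub>R y p) p" if "p \<in> D" for p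
    using smooth_on_has_pdu[OF open_D smooth_z that] smooth_on_has_pdv[OF open_D smooth_z that] pd_z[OF that] by simp_all
qed (use smooth_frame smooth_z frame in auto)

end

section \<open>Congruence, and assembly of the theorem\<close>

text \<open>The constant transition operator \<open>T\<close> carries one frame to the other
  everywhere, so z' - T z has zero derivatives; its constant value is the translation part.
  \<open>T\<close> is an isometry because it maps one null frame to another.\<close>

lemma (in structure_data) adapted_frames_congruent:
  assumes "adapted_frame D u0 v0 \<nu> lam \<mu> P Q x y n m z" "adapted_frame D u0 v0 \<nu> lam \<mu> P Q x' y' n' m' z'"
  shows "\<exists>T. motion T \<and> (\<forall>p\<in>D. z' p = T (z p))"
proof -
  interpret A: adapted_frame D u0 v0 \<nu> lam \<mu> P Q x y n m z by fact
  interpret A': adapted_frame D u0 v0 \<nu> lam \<mu> P Q x' y' n' m' z' by fact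
  define T where "T = (\<lambda>w. mink (x (u0, v0)) w *\<^sub>R x' (u0, v0) + mink (y (u0, v0)) w *\<^sub>R y' (u0, v0)
    - mink (m (u0, v0)) w *\<^sub>R n' (u0, v0) - mink (n (u0, v0)) w *\<^sub>R m' (u0, v0))"
  have T_eq: "T w = mink (x p) w *\<^sub>R x' p + mink (y p) w *\<^sub>R y' p - mink (m p) w *\<^sub>R n' p - mink (n p) w *\<^sub>R m' p"
    if "p \<in> D" for p w
    unfolding T_def frame_transition_constant[OF A.eqs A'.eqs that] ..
  have T_xy: "T (x p) = x' p" "T (y p) = y' p" if "p \<in> D" for p
    by (simp_all add: T_eq[OF that] null_frameD[OF A.frame[OF that]])
  have lin: "linear T"
    by (rule linearI) (simp_all add: T_def mink_simps algebra_simps)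
  have isom: "mink (T w) (T w') = mink w w'" for w w'
  proof -
    note f = A.frame[OF base_in_D] and f' = A'.frame[OF base_in_D]
    have "mink (T w) (T w') = mink (mink (x (u0, v0)) w *\<^sub>R x (u0, v0) + mink (y (u0, v0)) w *\<^sub>R y (u0, v0)
      - mink (m (u0, v0)) w *\<^sub>R n (u0, v0) - mink (n (u0, v0)) w *\<^sub>R m (u0, v0)) w'"
      by (simp add: T_def mink_simps null_frameD[OF f'])
    then show ?thesis by (simp only: null_frame_expansion[OF f])
  qed
  have "z' p - T (z p) = z' (u0, v0) - T (z (u0, v0))" if "p \<in> D" for p
  proof (rule has_pd_zero_imp_constant[OF base _ _ that, where f="\<lambda>p. z' p - T (z p)"])
    fix q assume q: "q \<in> D"
    note bl = has_pd_bounded_linear[OF lin[unfolded linear_conv_bounded_linear]]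
    show "has_pd du (\<lambda>p. z' p - T (z p)) 0 q"
      using has_pd_diff[OF A'.z_u[OF q] bl[OF A.z_u[OF q]]] by (simp add: linear_scale[OF lin] T_xy q)
    show "has_pd dv (\<lambda>p. z' p - T (z p)) 0 q"
      using has_pd_diff[OF A'.z_v[OF q] bl[OF A.z_v[OF q]]] by (simp add: linear_scale[OF lin] T_xy q)
  qed
  then have "\<forall>p\<in>D. z' p = T (z p) + (z' (u0, v0) - T (z (u0, v0)))" by (simp add: algebra_simps)
  moreover have "motion (\<lambda>w. T w + (z' (u0, v0) - T (z (u0, v0))))"
    unfolding motion_def using isom
    by (intro exI[of _ "matrix T"] exI[of _ "z' (u0, v0) - T (z (u0, v0))"]) (simp add: matrix_works[OF lin[folded linear_matrix_vector_mul_eq]])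
  ultimately show ?thesis by blast
qed

theorem (in canonical_data) existence:
  "\<exists>z. marginally_trapped D z \<and> general_type D z \<mu> \<and> canonical_parameters D z \<nu> lam \<mu> u0 v0 c1 c2"
proof -
  obtain x y n m z where "adapted_frame D u0 v0 \<nu> lam \<mu> P Q x y n m z"
    using frame_and_surface_exist
    by (metis adapted_frame.intro adapted_frame_axioms.intro structure_data_axioms)
  then interpret A: adapted_frame D u0 v0 \<nu> lam \<mu> P Q x y n m z .
  show ?thesis
    using A.marginally_trapped A.general_type A.principal canonical_integrals[OF A.fundamental_form(1,3)]
    unfolding canonical_parameters_def by blast
qed

theorem (in canonical_data) uniqueness:
  assumes "marginally_trapped D z" "canonical_parameters D z \<nu> lam \<mu> u0 v0 c1 c2"
    and "marginally_trapped D z'" "canonical_parameters D z' \<nu> lam \<mu> u0 v0 c1 c2"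
  shows "\<exists>T. motion T \<and> (\<forall>p\<in>D. z' p = T (z p))"
proof -
  have ps: "principal_surface D u0 v0 \<nu> lam \<mu> P Q w"
    if w: "marginally_trapped D w" "canonical_parameters D w \<nu> lam \<mu> u0 v0 c1 c2" for w
  proof unfold_locales
    have canon: "canon_u w \<nu> lam \<mu> u0 v0 c1 p = 1" "canon_v w \<nu> lam \<mu> u0 v0 c2 p = 1" if "p \<in> D" for p
      using w(2) that by (auto simp: canonical_parameters_def)
    show "fE w p = (P p)\<^sup>2" "fG w p = (Q p)\<^sup>2" if "p \<in> D" for p
      using fundamental_form_determined[OF w(1) canon that] by auto
  qed (use w in \<open>auto simp: canonical_parameters_def\<close>)
  show ?thesis
    by (rule adapted_frames_congruent[OF principal_surface.adapted[OF ps[OF assms(1,2)]]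
      principal_surface.adapted[OF ps[OF assms(3,4)]]])
qed

text \<open>The initial conditions are imposed only where the axis segment from the base point lies
  in \<open>D\<close>, since the integrals in \<open>g1\<close> and \<open>g2\<close> run along it.
  Likewise the claim is made on each base domain inside \<open>D\<close>;
  \<open>base_domain_exists\<close> provides one. Nonvanishing of \<Phi> and \<Psi> gives sense to
  the quotients and the logarithm.\<close>

theorem theorem4p1:
  fixes D :: "(real \<times> real) set"
    and \<nu> lam \<mu> \<Phi> \<Psi> :: "real \<times> real \<Rightarrow> real"
    and u0 v0 c1 c2 c :: real
    and g1 g2 :: "real \<Rightarrow> real"
  assumes "open D" and "connected D" and "(u0, v0) \<in> D"
    and "smooth_on D \<nu>" and "smooth_on D lam" and "smooth_on D \<mu>"
    and "\<And>p. p \<in> D \<Longrightarrow> \<mu> p \<noteq> 0"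
    and "\<And>p. p \<in> D \<Longrightarrow> 4 * (\<nu> p)\<^sup>2 + 4 * (lam p)\<^sup>2 - 1 \<noteq> 0"
    and "c = exp (c2 - c1)"
    and "\<And>u. g1 u = exp ((LBINT t=ereal u0..ereal u.
            c * phi3 \<nu> lam \<mu> (t, v0) + phi4 \<nu> lam \<mu> (t, v0)) - c1)"
    and "\<And>v. g2 v = exp ((LBINT s=ereal v0..ereal v.
            phi1 \<nu> lam \<mu> (u0, s) + 1 / c * phi2 \<nu> lam \<mu> (u0, s)) - c2)"
    and "smooth_on D \<Phi>" and "smooth_on D \<Psi>"
    and "\<And>p. p \<in> D \<Longrightarrow> \<Phi> p \<noteq> 0 \<and> \<Psi> p \<noteq> 0"
    and "\<And>p. p \<in> D \<Longrightarrow> pdv \<Phi> p = phi1 \<nu> lam \<mu> p * \<Phi> p + phi2 \<nu> lam \<mu> p * \<Psi> p"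
    and "\<And>p. p \<in> D \<Longrightarrow> pdu \<Psi> p = phi3 \<nu> lam \<mu> p * \<Phi> p + phi4 \<nu> lam \<mu> p * \<Psi> p"
    and "\<And>u. closed_segment (u0, v0) (u, v0) \<subseteq> D \<Longrightarrow> \<Phi> (u, v0) = g1 u"
    and "\<And>v. closed_segment (u0, v0) (u0, v) \<subseteq> D \<Longrightarrow> \<Psi> (u0, v) = g2 v"
    and "\<And>p. p \<in> D \<Longrightarrow> 2 * lam p * \<mu> p =
           - (1 / (\<Phi> p * \<Psi> p)) * (pdv (\<lambda>q. pdv \<Phi> q / \<Psi> q) p + pdu (\<lambda>q. pdu \<Psi> q / \<Phi> q) p)"
    and "\<And>p. p \<in> D \<Longrightarrow> 2 * \<nu> p * \<mu> p =
           2 / (\<Phi> p * \<Psi> p) * pdv (pdu (\<lambda>q. ln (\<bar>\<Psi> q\<bar> / \<bar>\<Phi> q\<bar>))) p"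
  shows "\<forall>D0\<subseteq>D. base_domain u0 v0 D0 \<longrightarrow>
    (\<exists>z. marginally_trapped D0 z \<and> general_type D0 z \<mu> \<and>
         canonical_parameters D0 z \<nu> lam \<mu> u0 v0 c1 c2) \<and>
    (\<forall>z z'. marginally_trapped D0 z \<and> general_type D0 z \<mu> \<and>
            canonical_parameters D0 z \<nu> lam \<mu> u0 v0 c1 c2 \<and>
            marginally_trapped D0 z' \<and> general_type D0 z' \<mu> \<and>
            canonical_parameters D0 z' \<nu> lam \<mu> u0 v0 c1 c2 \<longrightarrow>
            (\<exists>T. motion T \<and> (\<forall>p\<in>D0. z' p = T (z p))))"
proof (intro allI impI)
  fix D0 assume sub: "D0 \<subseteq> D" and base: "base_domain u0 v0 D0"
  have open_D0: "open D0" using base by (simp add: base_domain_def)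
  note D0_mem = base_domainD[OF base]
  have seg_u: "closed_segment (u0, y) (u, y) \<subseteq> D0" and seg_v: "closed_segment (x, v0) (x, v) \<subseteq> D0"
    if "(u, v) \<in> D0" "y \<in> closed_segment v0 v" "x \<in> closed_segment u0 u" for u v x y
    using D0_mem[OF that(1)] that(2,3) by (auto dest!: closed_segment_PairD)
  have \<Phi>_axis: "\<Phi> (u, v0) = g1 u" if "(u, v0) \<in> D0" for u
    using assms(17) seg_u[OF that] sub by (meson ends_in_segment(1) subset_trans)
  have \<Psi>_axis: "\<Psi> (u0, v) = g2 v" if "(u0, v) \<in> D0" for v
    using assms(18) seg_v[OF that] sub by (meson ends_in_segment(1) subset_trans)
  \<comment> \<open>Intermediate values: a nonvanishing function cannot change sign along a segment.
    The axis data are exponentials, so \<Phi> is positive along vertical segments from v = v0 and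
    \<Psi> along horizontal ones from u = u0.\<close>
  have pos_propagates: "f q > 0"
    if "closed_segment p q \<subseteq> D0" "f p > 0" "smooth_on D f" "\<And>r. r \<in> D \<Longrightarrow> f r \<noteq> 0" for f :: "real \<times> real \<Rightarrow> real" and p q
  proof (rule ccontr)
    assume "\<not> f q > 0"
    have "continuous_on (closed_segment p q) f"
      using smooth_on_imp_continuous_on[OF that(3)] that(1) sub by (meson continuous_on_subset subset_trans)
    then have "connected (f ` closed_segment p q)" by (rule connected_continuous_image) simp
    then have "0 \<in> f ` closed_segment p q"
      using \<open>\<not> f q > 0\<close> that(2) unfolding connected_iff_interval
      by (meson ends_in_segment image_eqI less_imp_le not_less)
    then show False using that(1,4) sub by force
  qed
  have pos: "\<Phi> p > 0" "\<Psi> p > 0" if "p \<in> D0" for p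
  proof -
    obtain u v where p: "p = (u, v)" by (cases p)
    have mem: "(u, v) \<in> D0" "(u, v0) \<in> D0" "(u0, v) \<in> D0" using that p D0_mem by auto
    show "\<Phi> p > 0" unfolding p
      by (rule pos_propagates[OF seg_v[OF mem(1)]]) (use \<Phi>_axis[OF mem(2)] assms(10,12,14) in auto)
    show "\<Psi> p > 0" unfolding p
      by (rule pos_propagates[OF seg_u[OF mem(1)]]) (use \<Psi>_axis[OF mem(3)] assms(11,13,14) in auto)
  qed
  interpret canonical_data D0 u0 v0 \<nu> lam \<mu> \<Phi> \<Psi> c1 c2 c
  proof unfold_locales
    show "smooth_on D0 \<nu>" "smooth_on D0 lam" "smooth_on D0 \<mu>" "smooth_on D0 \<Phi>" "smooth_on D0 \<Psi>"
      using smooth_on_subset[OF assms(1) open_D0 sub] assms(4-6,12,13) by auto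
  qed (use sub base pos assms \<Phi>_axis \<Psi>_axis in auto)
  show "(\<exists>z. marginally_trapped D0 z \<and> general_type D0 z \<mu> \<and>
         canonical_parameters D0 z \<nu> lam \<mu> u0 v0 c1 c2) \<and>
    (\<forall>z z'. marginally_trapped D0 z \<and> general_type D0 z \<mu> \<and>
            canonical_parameters D0 z \<nu> lam \<mu> u0 v0 c1 c2 \<and>
            marginally_trapped D0 z' \<and> general_type D0 z' \<mu> \<and>
            canonical_parameters D0 z' \<nu> lam \<mu> u0 v0 c1 c2 \<longrightarrow>
            (\<exists>T. motion T \<and> (\<forall>p\<in>D0. z' p = T (z p))))"
    using existence uniqueness by blast
qed

end
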